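(* Let $k$ be a field of characteristic $p>0$, let $(\mathfrak g,[-,-],\blacktriangleright)$ be a post-Lie algebra over $k$ and let $(-)^{[p]}$ be a $p$-map on $(\mathfrak g,[-,-])$, so that $(\mathfrak g,[-,-],(-)^{[p]})$ is a restricted Lie algebra. For $x\in\mathfrak g$ set $$x^{[p]_\blacktriangleright}:=x^{[p]}+\sum_{n=1}^{p-1}\frac1n\sum_{\substack{\ell_1+\cdots+\ell_n=p\\ \ell_i\ge1}}\frac{(p-1)!}{(\ell_1-1)!\cdots(\ell_n-1)!}\,\frac{1}{C_{\ell_1,\ldots,\ell_n}}\,[x^{\bullet\ell_1}\cdots x^{\bullet\ell_n}],$$ and define $D(x):\mathfrak g\to\mathfrak g$ by $D(x)(y):=(x^{\star_\blacktriangleright p}-x^{[p]_\blacktriangleright})\blacktriangleright y$. Assume that for every $y\in\mathfrak g$ the map $x\mapsto y\blacktriangleright x$ is a restricted derivation of $(\mathfrak g,[-,-],(-)^{[p]})$. Then: 1. for all $x,y\in\mathfrak g$, $D(x)$ is a derivation of $(\mathfrak g,\blacktriangleright)$, and $[D(x),D(y)]=0$ (commutator of endomorphisms); 2. for all $x,y\in\mathfrak g$, $$(x+y)^{[p]_\blacktriangleright}=x^{[p]_\blacktriangleright}+y^{[p]_\blacktriangleright}+\sum_{\substack{(x_k)_k\in\{x,y\}^p\\ x_{p-1}=y,\ x_p=x}}\frac{1}{\sharp(x)}\,\llbracket x_1,\llbracket x_2,\llbracket\cdots,\llbracket x_{p-1},x_p\rrbracket\cdots\rrbracket\rrbracket\rrbracket,$$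 where $\llbracket-,-\rrbracket$ is the sub-adjacent Lie bracket and $\sharp(x)=\mathrm{card}\{k\in\{1,\ldots,p\}:x_k=x\}$ ($x,y$ being treated as formal symbols when counting and indexing).
   Context: A post-Lie algebra is a Lie algebra $(\mathfrak g,[-,-])$ over $k$ with a bilinear operation $\blacktriangleright$ such that for all $x,y,z$: $x\blacktriangleright[y,z]=[x\blacktriangleright y,z]+[y,x\blacktriangleright z]$ and $[x,y]\blacktriangleright z=a_\blacktriangleright(x,y,z)-a_\blacktriangleright(y,x,z)$, with $a_\blacktriangleright(x,y,z)=x\blacktriangleright(y\blacktriangleright z)-(x\blacktriangleright y)\blacktriangleright z$. Its sub-adjacent Lie bracket is $\llbracket x,y\rrbracket=[x,y]+x\blacktriangleright y-y\blacktriangleright x$. A $p$-map on a Lie algebra is a map $(-)^{[p]}$ with $(\lambda x)^{[p]}=\lambda^px^{[p]}$, $\mathrm{ad}_{x^{[p]}}=(\mathrm{ad}_x)^p$ and $(x+y)^{[p]}=x^{[p]}+y^{[p]}+\sum_{i=1}^{p-1}s_i(x,y)$, where $(\mathrm{ad}_{\lambda x+y})^{p-1}(x)=\sum_{i=1}^{p-1}i\,s_i(x,y)\lambda^{i-1}$. A restricted derivation $d$ is a Lie derivation with $d(x^{[p]})=\mathrm{ad}_x^{p-1}(d(x))$ for all $x$. $\mathfrak u(\mathfrak g)$ is the universal enveloping algebra of $(\mathfrak g,[-,-])$ with its usual Hopf structure (counit $\varepsilon$, Sweedler notation). $\blacktriangleright$ is extended to $\mathfrak u(\mathfrak g)$ by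 $1\blacktriangleright F=F$, $E\blacktriangleright1=\varepsilon(E)1$, $(xE)\blacktriangleright F=x\blacktriangleright(E\blacktriangleright F)-(x\blacktriangleright E)\blacktriangleright F$, $E\blacktriangleright(F_1F_2)=(E_{(1)}\blacktriangleright F_1)(E_{(2)}\blacktriangleright F_2)$ ($x\in\mathfrak g$; $E,F,F_1,F_2\in\mathfrak u(\mathfrak g)$), and $E\star_\blacktriangleright F=E_{(1)}(E_{(2)}\blacktriangleright F)$ is an associative product on $\mathfrak u(\mathfrak g)$; $x^{\star_\blacktriangleright p}$ is the $p$-th power for it. Notation: $x^{\bullet1}=x$, $x^{\bullet n}=x\blacktriangleright x^{\bullet(n-1)}$; $[x_1\cdots x_n]=[x_1,[x_2,\cdots[x_{n-1},x_n]\cdots]]$ (equal to $x_1$ if $n=1$); $C_{\ell_1,\ldots,\ell_n}=\prod_{1\le v\le n-1}(\ell_1+\cdots+\ell_v)$ mod $p$. *)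

theory Defs
  imports
    "HOL-Library.Poly_Mapping"
    "HOL-Library.Product_Plus"
    "HOL-Algebra.QuotRing"
    "HOL-Algebra.Algebraic_Closure_Type"
begin

definition bilinear_op :: "('k::field \<Rightarrow> 'g::ab_group_add \<Rightarrow> 'g) \<Rightarrow> ('g \<Rightarrow> 'g \<Rightarrow> 'g) \<Rightarrow> bool" where
  "bilinear_op scale m \<longleftrightarrow>
     (\<forall>x. Vector_Spaces.linear scale scale (m x)) \<and>
     (\<forall>y. Vector_Spaces.linear scale scale (\<lambda>x. m x y))"

definition derivation :: "('k::field \<Rightarrow> 'g::ab_group_add \<Rightarrow> 'g) \<Rightarrow> ('g \<Rightarrow> 'g \<Rightarrow> 'g) \<Rightarrow> ('g \<Rightarrow> 'g) \<Rightarrow> bool" where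
  "derivation scale m d \<longleftrightarrow>
     Vector_Spaces.linear scale scale d \<and> (\<forall>a b. d (m a b) = m (d a) b + m a (d b))"

locale lie_algebra = vector_space scale
  for scale :: "'k::field \<Rightarrow> 'g::ab_group_add \<Rightarrow> 'g" +
  fixes bracket :: "'g \<Rightarrow> 'g \<Rightarrow> 'g"
  assumes bracket_bilinear: "bilinear_op scale bracket"
    and bracket_alternating: "bracket x x = 0"
    and jacobi: "bracket x (bracket y z) + bracket y (bracket z x) + bracket z (bracket x y) = 0"

text \<open>
  In the axiom for sums, \<open>(ad\<^bsub>\<lambda>x+y\<^esub>)\<^bsup>p-1\<^esup>(x)\<close> is a polynomial in \<open>\<lambda>\<close> of degree at most
  \<open>p - 2\<close> (the coefficient of \<open>\<lambda>\<^bsup>p-1\<^esup>\<close> is \<open>(ad x)\<^bsup>p-1\<^esup>(x) = 0\<close>). A field of characteristic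
  \<open>p\<close> has at least \<open>p\<close> elements, so the values at all \<open>\<lambda>\<close> in the field determine the
  coefficients \<open>i s\<^sub>i(x,y)\<close>, and hence the \<open>s\<^sub>i(x,y)\<close>, uniquely.
\<close>

locale restricted_lie_algebra = lie_algebra scale bracket
  for scale :: "'k::field \<Rightarrow> 'g::ab_group_add \<Rightarrow> 'g" and bracket :: "'g \<Rightarrow> 'g \<Rightarrow> 'g" +
  fixes p :: nat and pmap :: "'g \<Rightarrow> 'g"
  assumes pmap_scale: "pmap (scale c x) = scale (c ^ p) (pmap x)"
    and pmap_ad: "bracket (pmap x) = bracket x ^^ p"
    and pmap_add: "\<exists>s :: nat \<Rightarrow> 'g.
          (\<forall>c. (bracket (scale c x + y) ^^ (p - 1)) x
               = (\<Sum>i = 1..p - 1. scale (of_nat i * c ^ (i - 1)) (s i))) \<and>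
          pmap (x + y) = pmap x + pmap y + (\<Sum>i = 1..p - 1. s i)"

definition restricted_derivation ::
  "('k::field \<Rightarrow> 'g::ab_group_add \<Rightarrow> 'g) \<Rightarrow> ('g \<Rightarrow> 'g \<Rightarrow> 'g) \<Rightarrow> nat \<Rightarrow> ('g \<Rightarrow> 'g) \<Rightarrow> ('g \<Rightarrow> 'g) \<Rightarrow> bool" where
  "restricted_derivation scale bracket p pmap d \<longleftrightarrow>
     derivation scale bracket d \<and> (\<forall>x. d (pmap x) = (bracket x ^^ (p - 1)) (d x))"

definition assoc_tri :: "('g::ab_group_add \<Rightarrow> 'g \<Rightarrow> 'g) \<Rightarrow> 'g \<Rightarrow> 'g \<Rightarrow> 'g \<Rightarrow> 'g" where
  "assoc_tri tri x y z = tri x (tri y z) - tri (tri x y) z"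

locale post_lie_algebra = lie_algebra scale bracket
  for scale :: "'k::field \<Rightarrow> 'g::ab_group_add \<Rightarrow> 'g" and bracket :: "'g \<Rightarrow> 'g \<Rightarrow> 'g" +
  fixes tri :: "'g \<Rightarrow> 'g \<Rightarrow> 'g"
  assumes tri_bilinear: "bilinear_op scale tri"
    and tri_bracket: "tri x (bracket y z) = bracket (tri x y) z + bracket y (tri x z)"
    and bracket_tri: "tri (bracket x y) z = assoc_tri tri x y z - assoc_tri tri y x z"

definition sub_adjacent ::
  "('g::ab_group_add \<Rightarrow> 'g \<Rightarrow> 'g) \<Rightarrow> ('g \<Rightarrow> 'g \<Rightarrow> 'g) \<Rightarrow> 'g \<Rightarrow> 'g \<Rightarrow> 'g" where
  "sub_adjacent bracket tri x y = bracket x y + tri x y - tri y x"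

fun nested_bracket :: "('g \<Rightarrow> 'g \<Rightarrow> 'g) \<Rightarrow> 'g::zero list \<Rightarrow> 'g" where
  "nested_bracket bracket [] = 0"
| "nested_bracket bracket [x] = x"
| "nested_bracket bracket (x # y # zs) = bracket x (nested_bracket bracket (y # zs))"

text \<open>Used only for \<open>n \<ge> 1\<close>.\<close>

definition bullet_pow :: "('g \<Rightarrow> 'g \<Rightarrow> 'g) \<Rightarrow> 'g \<Rightarrow> nat \<Rightarrow> 'g" where
  "bullet_pow tri x n = (tri x ^^ (n - 1)) x"

definition compositions :: "nat \<Rightarrow> nat \<Rightarrow> nat list set" where
  "compositions m n = {ls. length ls = n \<and> sum_list ls = m \<and> (\<forall>l \<in> set ls. 1 \<le> l)}"

definition C_coeff :: "nat list \<Rightarrow> 'k::field" where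
  "C_coeff ls = of_nat (\<Prod>v \<in> {1..<length ls}. sum_list (take v ls))"

text \<open>
  The divisions are performed in the field: for compositions of \<open>p\<close> into \<open>n\<close> parts with
  \<open>1 \<le> n \<le> p - 1\<close>, all denominators are products of integers strictly between \<open>0\<close> and \<open>p\<close>,
  hence nonzero in characteristic \<open>p\<close>.
\<close>

definition tri_pmap ::
  "('k::field \<Rightarrow> 'g::ab_group_add \<Rightarrow> 'g) \<Rightarrow> ('g \<Rightarrow> 'g \<Rightarrow> 'g) \<Rightarrow> ('g \<Rightarrow> 'g \<Rightarrow> 'g) \<Rightarrow> nat \<Rightarrow> ('g \<Rightarrow> 'g) \<Rightarrow> 'g \<Rightarrow> 'g" where
  "tri_pmap scale bracket tri p pmap x =
     pmap x +
     (\<Sum>n = 1..p - 1. scale (1 / of_nat n)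
        (\<Sum>ls \<in> compositions p n.
           scale (of_nat (fact (p - 1)) / of_nat (\<Prod>l\<leftarrow>ls. fact (l - 1)) * (1 / C_coeff ls))
             (nested_bracket bracket (map (bullet_pow tri x) ls))))"

text \<open>
  Lists form the free monoid, so that \<open>'g list \<Rightarrow>\<^sub>0 'k\<close>, with the convolution product of
  \<^theory>\<open>HOL-Library.Poly_Mapping\<close>, is the free unital associative \<open>'k\<close>-algebra on the
  \<^emph>\<open>set\<close> \<open>'g\<close>, and \<open>('g list \<times> 'g list) \<Rightarrow>\<^sub>0 'k\<close> is its tensor square.
\<close>

instantiation list :: (type) monoid_add
begin
definition zero_list :: "'a list" where "zero_list = []"
definition plus_list :: "'a list \<Rightarrow> 'a list \<Rightarrow> 'a list" where "plus_list = (@)"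
instance by standard (simp_all add: zero_list_def plus_list_def)
end

type_synonym ('g, 'k) free_alg = "'g list \<Rightarrow>\<^sub>0 'k"

definition gen :: "'g \<Rightarrow> ('g, 'k::field) free_alg" where
  "gen x = Poly_Mapping.single [x] 1"

definition scalar :: "'k \<Rightarrow> ('m::monoid_add \<Rightarrow>\<^sub>0 'k::field)" where
  "scalar c = Poly_Mapping.single 0 c"

text \<open>The algebra morphism determined by \<open>x \<mapsto> x \<otimes> 1 + 1 \<otimes> x\<close> on generators.\<close>

definition free_coproduct :: "('g, 'k::field) free_alg \<Rightarrow> ('g list \<times> 'g list \<Rightarrow>\<^sub>0 'k)" where
  "free_coproduct f =
     (\<Sum>w \<in> Poly_Mapping.keys f.
        scalar (Poly_Mapping.lookup f w) *
        (\<Prod>x\<leftarrow>w. Poly_Mapping.single ([x], []) 1 + Poly_Mapping.single ([], [x]) 1))"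

text \<open>The algebra morphism vanishing on generators.\<close>

definition free_counit :: "('g, 'k::field) free_alg \<Rightarrow> 'k" where
  "free_counit f = Poly_Mapping.lookup f []"

context lie_algebra
begin

text \<open>
  The first two families of relations make the generators linear (so that the free algebra
  becomes the tensor algebra of the vector space), the third is the Lie relation. A two-sided
  ring ideal of a unital algebra is stable under scalars.
\<close>

definition env_relations :: "('g, 'k) free_alg set" where
  "env_relations =
     {gen (x + y) - gen x - gen y | x y. True} \<union>
     {gen (scale c x) - scalar c * gen x | c x. True} \<union>
     {gen x * gen y - gen y * gen x - gen (bracket x y) | x y. True}"

definition env_ideal :: "('g, 'k) free_alg set" where
  "env_ideal = Idl\<^bsub>ring_of_type_algebra\<^esub> env_relations"

definition env :: "('g, 'k) free_alg set ring" where
  "env = ring_of_type_algebra Quot env_ideal"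

definition env_class :: "('g, 'k) free_alg \<Rightarrow> ('g, 'k) free_alg set" where
  "env_class f = env_ideal +>\<^bsub>ring_of_type_algebra\<^esub> f"

definition env_incl :: "'g \<Rightarrow> ('g, 'k) free_alg set" where
  "env_incl x = env_class (gen x)"

definition env_smult :: "'k \<Rightarrow> ('g, 'k) free_alg set \<Rightarrow> ('g, 'k) free_alg set" where
  "env_smult c E = env_class (scalar c) \<otimes>\<^bsub>env\<^esub> E"

text \<open>
  The ideal of relations is a Hopf ideal, so counit and coproduct descend to the quotient and
  can be computed on any representative. The coproduct is only ever needed through the sums
  \<open>B(E\<^sub>(\<^sub>1\<^sub>), E\<^sub>(\<^sub>2\<^sub>))\<close> of Sweedler notation, for \<open>B\<close> a bilinear operation on the enveloping algebra:
  if \<open>\<Delta>(e) = \<Sum> c\<^sub>u\<^sub>v u \<otimes> v\<close> for a representative \<open>e\<close> of \<open>E\<close>, this is \<open>\<Sum> c\<^sub>u\<^sub>v B([u],[v])\<close>.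
\<close>

definition env_rep :: "('g, 'k) free_alg set \<Rightarrow> ('g, 'k) free_alg" where
  "env_rep E = (SOME e. e \<in> E)"

definition env_counit :: "('g, 'k) free_alg set \<Rightarrow> 'k" where
  "env_counit E = free_counit (env_rep E)"

definition sweedler ::
  "(('g, 'k) free_alg set \<Rightarrow> ('g, 'k) free_alg set \<Rightarrow> ('g, 'k) free_alg set)
     \<Rightarrow> ('g, 'k) free_alg set \<Rightarrow> ('g, 'k) free_alg set" where
  "sweedler B E =
     (let d = free_coproduct (env_rep E) in
      \<Oplus>\<^bsub>env\<^esub>uv \<in> Poly_Mapping.keys d.
        env_smult (Poly_Mapping.lookup d uv)
          (B (env_class (Poly_Mapping.single (fst uv) 1)) (env_class (Poly_Mapping.single (snd uv) 1))))"

end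

context post_lie_algebra
begin

definition is_env_tri ::
  "(('g, 'k) free_alg set \<Rightarrow> ('g, 'k) free_alg set \<Rightarrow> ('g, 'k) free_alg set) \<Rightarrow> bool" where
  "is_env_tri T \<longleftrightarrow>
     (\<forall>E \<in> carrier env. \<forall>F \<in> carrier env. T E F \<in> carrier env) \<and>
     (\<forall>E \<in> carrier env. \<forall>E' \<in> carrier env. \<forall>F \<in> carrier env.
        T (E \<oplus>\<^bsub>env\<^esub> E') F = T E F \<oplus>\<^bsub>env\<^esub> T E' F) \<and>
     (\<forall>E \<in> carrier env. \<forall>F \<in> carrier env. \<forall>F' \<in> carrier env.
        T E (F \<oplus>\<^bsub>env\<^esub> F') = T E F \<oplus>\<^bsub>env\<^esub> T E F') \<and>
     (\<forall>c. \<forall>E \<in> carrier env. \<forall>F \<in> carrier env.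
        T (env_smult c E) F = env_smult c (T E F) \<and> T E (env_smult c F) = env_smult c (T E F)) \<and>
     (\<forall>x y. T (env_incl x) (env_incl y) = env_incl (tri x y)) \<and>
     (\<forall>F \<in> carrier env. T \<one>\<^bsub>env\<^esub> F = F) \<and>
     (\<forall>E \<in> carrier env. T E \<one>\<^bsub>env\<^esub> = env_smult (env_counit E) \<one>\<^bsub>env\<^esub>) \<and>
     (\<forall>x. \<forall>E \<in> carrier env. \<forall>F \<in> carrier env.
        T (env_incl x \<otimes>\<^bsub>env\<^esub> E) F
          = T (env_incl x) (T E F) \<ominus>\<^bsub>env\<^esub> T (T (env_incl x) E) F) \<and>
     (\<forall>E \<in> carrier env. \<forall>F \<in> carrier env. \<forall>G \<in> carrier env.
        T E (F \<otimes>\<^bsub>env\<^esub> G) = sweedler (\<lambda>A B. T A F \<otimes>\<^bsub>env\<^esub> T B G) E)"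

text \<open>
  On the carrier, the operation satisfying these equations exists and is unique; its values
  outside the carrier are irrelevant.
\<close>

definition env_tri ::
  "('g, 'k) free_alg set \<Rightarrow> ('g, 'k) free_alg set \<Rightarrow> ('g, 'k) free_alg set" where
  "env_tri = (SOME T. is_env_tri T)"

definition star ::
  "('g, 'k) free_alg set \<Rightarrow> ('g, 'k) free_alg set \<Rightarrow> ('g, 'k) free_alg set" where
  "star E F = sweedler (\<lambda>A B. A \<otimes>\<^bsub>env\<^esub> env_tri B F) E"

definition star_pow :: "('g, 'k) free_alg set \<Rightarrow> nat \<Rightarrow> ('g, 'k) free_alg set" where
  "star_pow E n = (star E ^^ n) \<one>\<^bsub>env\<^esub>"

text \<open>
  \<open>x\<^bsup>\<star>p\<^esup> - q x\<close> acts on the enveloping algebra, with \<open>q\<close> standing for the twisted \<open>p\<close>-map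
  \<^const>\<open>tri_pmap\<close>. The action preserves the image of the Lie algebra, which is identified
  with the Lie algebra itself (\<^const>\<open>env_incl\<close> is injective by the
  Poincare-Birkhoff-Witt theorem).
\<close>

definition defect :: "nat \<Rightarrow> ('g \<Rightarrow> 'g) \<Rightarrow> 'g \<Rightarrow> 'g \<Rightarrow> 'g" where
  "defect p pmap x y =
     (THE z. env_incl z =
        env_tri (star_pow (env_incl x) p
                   \<ominus>\<^bsub>env\<^esub> env_incl (tri_pmap scale bracket tri p pmap x))
          (env_incl y))"

end

datatype letter = Sym_x | Sym_y

fun letter_val :: "'g \<Rightarrow> 'g \<Rightarrow> letter \<Rightarrow> 'g" where
  "letter_val x y Sym_x = x"
| "letter_val x y Sym_y = y"

text \<open>Positions are counted from \<open>0\<close>: the last two letters are \<open>ws ! (p - 2)\<close> and \<open>ws ! (p - 1)\<close>.\<close>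

definition jacobson_words :: "nat \<Rightarrow> letter list set" where
  "jacobson_words p = {ws. length ws = p \<and> ws ! (p - 2) = Sym_y \<and> ws ! (p - 1) = Sym_x}"

end

theory Submission
  imports Defs "HOL-Library.Multiset"
begin

text \<open>
  The semidirect product \<open>h\<close> of \<open>(g, [-,-])\<close> with the sub-adjacent Lie algebra, acting through the post-Lie
  product, has a faithful representation by Poincare-Birkhoff-Witt. Let \<open>l\<close> and \<open>d\<close> be its restrictions to the
  two factors and \<open>r = l + d\<close>, which is again a representation of the sub-adjacent Lie algebra. Jacobson's
  formula, with the commutators of \<open>l x\<close> and \<open>d x\<close> sorted into compositions, says that
  \<open>r x\<^sup>p = (l x\<^sup>p - l (x\<^bsup>[p]\<^esup>)) + d x\<^sup>p + l (q x)\<close>, where \<open>q\<close> is the twisted p-map. The defect in parentheses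
  commutes with \<open>l\<close> (axiom for p-maps) and with \<open>d\<close> (restricted derivations) and is additive. Subtracting
  Jacobson's formulas for \<open>l\<close>, \<open>d\<close> and \<open>r\<close> from each other gives the formula for \<open>q (x + y)\<close>; commutators with
  the p-th powers give the assertions on \<open>L\<^sub>x\<^sup>p - L\<^bsub>q x\<^esub>\<close>, where \<open>L\<^sub>x y\<close> is the post-Lie product of \<open>x\<close> and \<open>y\<close>.
  This operator is \<open>D(x)\<close>: on the enveloping algebra \<open>x \<star> F\<close> acts as \<open>L\<^sub>x\<close> after the action of \<open>F\<close>.
\<close>

section \<open>Powers and commutators in characteristic p\<close>

text \<open>The p-th powers in the argument have no meaning inside a Lie algebra, hence the detour
  through an associative ring; faithfulness carries identities back. The map \<open>r\<close> is a
  representation because the diagonal \<open>x \<mapsto> (x, x)\<close> embeds the sub-adjacent Lie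
  algebra in \<open>h\<close>: the bracket of \<open>(x, x)\<close> and \<open>(y, y)\<close> has
  two equal components. The coefficients of \<open>q\<close> count growth histories. In
  \<open>(ad (t l x + d x))^(p-1) (l x)\<close> each \<open>d x\<close> raises one exponent in a
  bracket of bullet powers and each \<open>l x\<close> prepends a new \<open>x\<close>; a
  composition of \<open>p\<close> grows from \<open>[1]\<close> in
  \<open>(p-1)! / (C \<Prod> (l_i - 1)!)\<close> ways, and \<open>1/n\<close> is Jacobson's
  \<open>1/i\<close>. These numbers are handled as products of inverses in \<open>k\<close>, so the
  proper partial sums must stay below \<open>p\<close>. A second obstacle is that the enveloping
  algebra is a bare quotient on which post-Lie product and Sweedler sums are defined by choice: an
  operation with the required properties has to be constructed, the relations have to be shown to
  form a coideal, and injectivity of \<open>env_incl\<close> has to be proved to give meaning to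
  \<open>D(x)\<close>.\<close>

definition comm :: "'r::ring_1 \<Rightarrow> 'r \<Rightarrow> 'r" where
  "comm a b = a * b - b * a"

lemma comm_add_right: "comm z (a + b) = comm z a + comm z b"
  by (simp add: comm_def algebra_simps)

lemma comm_add_left: "comm (a + b) z = comm a z + comm b z"
  by (simp add: comm_def algebra_simps)

lemma comm_diff_right: "comm z (a - b) = comm z a - comm z b"
  by (simp add: comm_def algebra_simps)

lemma comm_diff_left: "comm (a - b) z = comm a z - comm b z"
  by (simp add: comm_def algebra_simps)

lemma comm_zero_right [simp]: "comm z 0 = 0"
  by (simp add: comm_def)

lemma comm_swap: "comm a b = - comm b a"
  by (simp add: comm_def)

text \<open>The coefficient of \<open>z^j a z^(n-j)\<close> in \<open>(ad z)^n a\<close>: left and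
  right multiplication by \<open>z\<close> commute, so the binomial theorem applies to their
  difference. The sign is \<open>(-1)^(n-j)\<close>, written with \<open>n + j\<close> to avoid
  truncated subtraction.\<close>

definition ad_coeff :: "nat \<Rightarrow> nat \<Rightarrow> int" where
  "ad_coeff n j = (-1) ^ (n + j) * int (n choose j)"

lemma ad_coeff_Suc_Suc: "ad_coeff (Suc n) (Suc j) = ad_coeff n j - ad_coeff n (Suc j)"
  by (simp add: ad_coeff_def algebra_simps)

lemma ad_coeff_Suc_0: "ad_coeff (Suc n) 0 = - ad_coeff n 0"
  by (simp add: ad_coeff_def)

lemma comm_funpow:
  fixes z a :: "'r::ring_1"
  shows "(comm z ^^ n) a = (\<Sum>j\<le>n. of_int (ad_coeff n j) * (z ^ j * a * z ^ (n - j)))"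
proof (induction n)
  case 0
  then show ?case by (simp add: ad_coeff_def)
next
  case (Suc n)
  let ?b = "\<lambda>j. z ^ j * a * z ^ (Suc n - j)"
  have step: "comm z (of_int (ad_coeff n j) * (z ^ j * a * z ^ (n - j)))
      = of_int (ad_coeff n j) * ?b (Suc j) - of_int (ad_coeff n j) * ?b j" if "j \<le> n" for j
  proof -
    have "z * (of_int (ad_coeff n j) * (z ^ j * a * z ^ (n - j))) = of_int (ad_coeff n j) * ?b (Suc j)"
      using mult_of_int_commute[of "ad_coeff n j" z] by (simp add: mult.assoc[symmetric])
    moreover have "(of_int (ad_coeff n j) * (z ^ j * a * z ^ (n - j))) * z = of_int (ad_coeff n j) * ?b j"
      using that by (simp add: mult.assoc power_Suc2 Suc_diff_le del: power_Suc)
    ultimately show ?thesis by (simp add: comm_def)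
  qed
  have comm_sum: "comm z (sum f A) = (\<Sum>j\<in>A. comm z (f j))" for f :: "nat \<Rightarrow> 'r" and A
    by (simp add: comm_def sum_distrib_left sum_distrib_right sum_subtractf)
  have "(comm z ^^ Suc n) a = (\<Sum>j\<le>n. of_int (ad_coeff n j) * ?b (Suc j) - of_int (ad_coeff n j) * ?b j)"
    unfolding funpow.simps comp_apply Suc.IH comm_sum by (intro sum.cong refl step) simp
  also have "\<dots> = (\<Sum>j\<le>n. of_int (ad_coeff n j) * ?b (Suc j)) - (\<Sum>j\<le>Suc n. of_int (ad_coeff n j) * ?b j)"
    by (simp add: sum_subtractf ad_coeff_def binomial_eq_0)
  also have "\<dots> = (\<Sum>j\<le>Suc n. of_int (ad_coeff (Suc n) j) * ?b j)"
    unfolding sum.atMost_Suc_shift ad_coeff_Suc_Suc ad_coeff_Suc_0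
    by (simp add: sum_subtractf left_diff_distrib)
  finally show ?case .
qed

locale char_p_ring =
  fixes p :: nat and ty :: "'r::ring_1 itself"
  assumes prime: "prime p" and char: "(of_nat p :: 'r) = 0"
begin

lemma ad_coeff_p: "0 < j \<Longrightarrow> j < p \<Longrightarrow> of_int (ad_coeff p j) = (0::'r)"
proof -
  assume "0 < j" "j < p"
  then have "p dvd (p choose j)" using prime by (intro dvd_choose_prime) auto
  then obtain m where "p choose j = p * m" by (elim dvdE)
  then show ?thesis by (simp add: ad_coeff_def char)
qed

text \<open>By Pascal's rule a coefficient for \<open>p\<close> strictly between the ends, which
  vanishes, is the difference of two neighbours for \<open>p - 1\<close>. So the latter all equal
  the last one, which is 1.\<close>

lemma ad_coeff_p_minus_1: "j < p \<Longrightarrow> of_int (ad_coeff (p - 1) j) = (1::'r)"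
proof -
  assume "j < p"
  then have "j \<le> p - 1" by simp
  then show ?thesis
  proof (induction rule: inc_induct)
    case base
    then show ?case by (simp add: ad_coeff_def flip: mult_2)
  next
    case (step j)
    have "of_int (ad_coeff (p - 1) j - ad_coeff (p - 1) (Suc j)) = (0::'r)"
      unfolding ad_coeff_Suc_Suc[symmetric] using step ad_coeff_p[of "Suc j"] by simp
    then show ?case using step.IH by simp
  qed
qed

lemma p_pos: "0 < p"
  using prime by (simp add: prime_gt_0_nat)

lemma comm_funpow_pred: "(comm z ^^ (p - 1)) (a::'r) = (\<Sum>j<p. z ^ j * a * z ^ (p - 1 - j))"
proof -
  have "{..p - 1} = {..<p}" using p_pos by auto
  then show ?thesis
    unfolding comm_funpow by (intro sum.cong) (simp_all add: ad_coeff_p_minus_1 del: One_nat_def)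
qed

text \<open>The sum for \<open>(ad z)^(p-1) a\<close> telescopes under one more commutator with
  \<open>z\<close>.\<close>

lemma comm_power: "comm (z ^ p) (a::'r) = (comm z ^^ p) a"
proof -
  have "(comm z ^^ p) a = comm z ((comm z ^^ (p - 1)) a)"
    using p_pos by (metis Suc_pred' comp_apply funpow.simps(2))
  also have "\<dots> = (\<Sum>j<p. z ^ Suc j * a * z ^ (p - Suc j) - z ^ j * a * z ^ (p - j))"
  proof -
    have "comm z (z ^ j * a * z ^ (p - 1 - j)) = z ^ Suc j * a * z ^ (p - Suc j) - z ^ j * a * z ^ (p - j)"
      if "j < p" for j
    proof -
      have "p - j = Suc (p - 1 - j)" using that by simp
      then have "z ^ (p - j) = z ^ (p - 1 - j) * z" by (simp add: power_Suc2 del: power_Suc)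
      then show ?thesis by (simp add: comm_def mult.assoc)
    qed
    moreover have "comm z (sum f A) = (\<Sum>j\<in>A. comm z (f j))" for f :: "nat \<Rightarrow> 'r" and A
      by (simp add: comm_def sum_distrib_left sum_distrib_right sum_subtractf)
    ultimately show ?thesis unfolding comm_funpow_pred by simp
  qed
  also have "\<dots> = z ^ p * a - a * z ^ p"
    by (subst sum_lessThan_telescope) simp
  finally show ?thesis by (simp add: comm_def)
qed

text \<open>Commutators with a fixed element are restricted derivations.\<close>

lemma comm_power_right: "comm e (z ^ p) = (comm z ^^ (p - 1)) (comm e (z::'r))"
proof -
  have neg: "(comm z ^^ n) (- x) = - (comm z ^^ n) x" for n and x :: 'r
    by (induction n) (simp_all add: comm_def)
  have "comm e (z ^ p) = - (comm z ^^ p) e"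
    by (subst comm_swap) (simp add: comm_power)
  also have "(comm z ^^ p) e = (comm z ^^ (p - 1)) (comm z e)"
    using p_pos by (metis Suc_pred' comp_apply funpow_Suc_right)
  finally show ?thesis by (simp add: neg[symmetric] comm_swap[of z e])
qed

end

section \<open>Jacobson's formula in an associative ring\<close>

text \<open>The coefficient of \<open>t\<^sup>i\<close> in \<open>(ad (t x + y))\<^sup>n x\<close>.\<close>

primrec jac_coeff :: "('g \<Rightarrow> 'g \<Rightarrow> 'g) \<Rightarrow> 'g::ab_group_add \<Rightarrow> 'g \<Rightarrow> nat \<Rightarrow> nat \<Rightarrow> 'g" where
  "jac_coeff br x y 0 i = (if i = 0 then x else 0)"
| "jac_coeff br x y (Suc n) i =
     (if i = 0 then 0 else br x (jac_coeff br x y n (i - 1))) + br y (jac_coeff br x y n i)"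

text \<open>Power series stand in for polynomials in an indeterminate \<open>t\<close> that commutes
  with all coefficients; this makes the commutator with \<open>t a + b\<close> act on coefficients
  by the recursion of \<open>jac_coeff\<close>.\<close>

lemma fps_nth_comm_pencil:
  fixes a b :: "'r::ring_1" and f :: "'r fps"
  shows "fps_nth (comm (fps_X * fps_const a + fps_const b) f) i =
    (if i = 0 then 0 else comm a (fps_nth f (i - 1))) + comm b (fps_nth f i)"
proof -
  have "f * (fps_X * fps_const a) = fps_X * (f * fps_const a)"
    by (metis fps_mult_fps_X_commute mult.assoc)
  then show ?thesis
    by (simp add: comm_def distrib_left distrib_right mult.assoc)
qed

lemma jac_coeff_fps:
  fixes a b :: "'r::ring_1"
  shows "fps_nth ((comm (fps_X * fps_const a + fps_const b) ^^ n) (fps_const a)) i = jac_coeff comm a b n i"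
  by (induction n arbitrary: i) (simp_all add: fps_nth_comm_pencil)

lemma fps_pencil_power_Suc_nth:
  fixes a b :: "'r::ring_1"
  shows "fps_nth ((fps_X * fps_const a + fps_const b) ^ Suc n) i =
    (if i = 0 then 0 else a * fps_nth ((fps_X * fps_const a + fps_const b) ^ n) (i - 1)) +
    b * fps_nth ((fps_X * fps_const a + fps_const b) ^ n) i"
  by (simp add: distrib_right mult.assoc)

text \<open>Both sides are the coefficient of \<open>t^i\<close> in the derivative of
  \<open>(t a + b)^n\<close>: by the noncommutative Leibniz rule on the left, termwise on the
  right.\<close>

lemma fps_pencil_deriv:
  fixes a b :: "'r::ring_1"
  defines "z \<equiv> fps_X * fps_const a + fps_const b"
  shows "fps_nth (\<Sum>j<n. z ^ j * fps_const a * z ^ (n - 1 - j)) i = of_nat (Suc i) * fps_nth (z ^ n) (Suc i)"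
proof (induction n arbitrary: i)
  case 0
  then show ?case by simp
next
  case (Suc n)
  let ?S = "\<Sum>j<n. z ^ j * fps_const a * z ^ (n - 1 - j)"
  have "(\<Sum>j<Suc n. z ^ j * fps_const a * z ^ (Suc n - 1 - j)) = fps_const a * z ^ n + z * ?S"
    unfolding sum.lessThan_Suc_shift by (simp add: sum_distrib_left mult.assoc)
  moreover have "fps_nth (z * ?S) i = (if i = 0 then 0 else a * fps_nth ?S (i - 1)) + b * fps_nth ?S i"
    by (simp add: z_def distrib_right mult.assoc)
  moreover have "fps_nth (z ^ Suc n) (Suc i) = a * fps_nth (z ^ n) i + b * fps_nth (z ^ n) (Suc i)"
    unfolding z_def fps_pencil_power_Suc_nth by simp
  moreover have "x * (of_nat k * y) = of_nat k * (x * y)" for x y :: 'r and k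
    by (metis mult.assoc mult_of_nat_commute)
  ultimately show ?case
    by (simp only: fps_add_nth fps_mult_left_const_nth Suc.IH) (cases i; simp add: algebra_simps)
qed

lemma fps_pencil_power_nth_gt:
  fixes a b :: "'r::ring_1"
  shows "n < i \<Longrightarrow> fps_nth ((fps_X * fps_const a + fps_const b) ^ n) i = 0"
  by (induction n arbitrary: i) (simp_all only: fps_pencil_power_Suc_nth, auto)

text \<open>Evaluation at \<open>t = 1\<close>, possible as a finite sum because the power has
  degree at most \<open>n\<close>.\<close>

lemma fps_pencil_power_sum:
  fixes a b :: "'r::ring_1"
  shows "(a + b) ^ n = (\<Sum>i\<le>n. fps_nth ((fps_X * fps_const a + fps_const b) ^ n) i)"
proof (induction n)
  case 0
  then show ?case by simp
next
  case (Suc n)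
  let ?e = "\<lambda>i. fps_nth ((fps_X * fps_const a + fps_const b) ^ n) i"
  have "(\<Sum>i\<le>Suc n. fps_nth ((fps_X * fps_const a + fps_const b) ^ Suc n) i) =
     (\<Sum>i\<le>Suc n. if i = 0 then 0 else a * ?e (i - 1)) + (\<Sum>i\<le>Suc n. b * ?e i)"
    unfolding fps_pencil_power_Suc_nth by (simp only: sum.distrib)
  also have "(\<Sum>i\<le>Suc n. if i = 0 then 0 else a * ?e (i - 1)) = a * (\<Sum>i\<le>n. ?e i)"
    unfolding sum.atMost_Suc_shift by (simp add: sum_distrib_left)
  also have "(\<Sum>i\<le>Suc n. b * ?e i) = b * (\<Sum>i\<le>n. ?e i)"
    by (simp add: sum_distrib_left fps_pencil_power_nth_gt)
  finally show ?case using Suc by (simp add: distrib_right)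
qed

lemma fps_pencil_power_nth_0:
  fixes a b :: "'r::ring_1"
  shows "fps_nth ((fps_X * fps_const a + fps_const b) ^ n) 0 = b ^ n"
  by (induction n) (simp_all only: fps_pencil_power_Suc_nth, auto)

lemma fps_pencil_power_nth_n:
  fixes a b :: "'r::ring_1"
  shows "fps_nth ((fps_X * fps_const a + fps_const b) ^ n) n = a ^ n"
  by (induction n) (simp_all only: fps_pencil_power_Suc_nth, auto simp: fps_pencil_power_nth_gt)

context char_p_ring
begin

lemma char_p_ring_fps: "char_p_ring TYPE('r fps) p"
  by unfold_locales (use prime char in \<open>auto simp: fps_eq_iff\<close>)

text \<open>The heart of Jacobson's formula: for \<open>z = t a + b\<close> the sum of the
  \<open>z^j a z^(p-1-j)\<close> is at once \<open>(ad z)^(p-1) a\<close>, by characteristic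
  \<open>p\<close>, and the derivative of \<open>z^p\<close> with respect to
  \<open>t\<close>.\<close>

lemma of_nat_mult_pencil_coeff:
  fixes a b :: 'r
  shows "of_nat (Suc i) * fps_nth ((fps_X * fps_const a + fps_const b) ^ p) (Suc i) = jac_coeff comm a b (p - 1) i"
  unfolding jac_coeff_fps[symmetric] fps_pencil_deriv[symmetric]
  by (subst char_p_ring.comm_funpow_pred[OF char_p_ring_fps]) simp

lemma power_add_eq_sum:
  fixes a b :: 'r
  shows "(a + b) ^ p = a ^ p + b ^ p + (\<Sum>i = 1..p - 1. fps_nth ((fps_X * fps_const a + fps_const b) ^ p) i)"
proof -
  have "{..p} = insert 0 (insert p {1..p - 1})" using p_pos by auto
  then show ?thesis
    using p_pos by (simp add: fps_pencil_power_sum[of a b p] fps_pencil_power_nth_0 fps_pencil_power_nth_n)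
qed

end

text \<open>The sum of Jacobson's \<open>s_i(x, y)\<close>: the coefficient of
  \<open>t^(i-1)\<close> is \<open>i s_i(x, y)\<close>, and \<open>i\<close> is invertible for
  \<open>0 < i < p\<close>.\<close>

definition jac_sum :: "('k::field \<Rightarrow> 'g \<Rightarrow> 'g) \<Rightarrow> ('g \<Rightarrow> 'g \<Rightarrow> 'g) \<Rightarrow> nat \<Rightarrow> 'g::ab_group_add \<Rightarrow> 'g \<Rightarrow> 'g" where
  "jac_sum scale br p x y = (\<Sum>i = 1..p - 1. scale (1 / of_nat i) (jac_coeff br x y (p - 1) (i - 1)))"

lemma of_nat_eq_0_char_iff:
  "CHAR('k::field) = p \<Longrightarrow> (of_nat n :: 'k) = 0 \<longleftrightarrow> p dvd n"
  using of_nat_eq_0_iff_char_dvd[of n, where 'a = 'k] by simp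

lemma of_nat_neq_0_below_char:
  "CHAR('k::field) = p \<Longrightarrow> 0 < n \<Longrightarrow> n < p \<Longrightarrow> (of_nat n :: 'k) \<noteq> 0"
  by (auto simp: of_nat_eq_0_char_iff dest: dvd_imp_le)

lemma fact_neq_0_below_char:
  "CHAR('k::field) = p \<Longrightarrow> n < p \<Longrightarrow> (of_nat (fact n) :: 'k) \<noteq> 0"
proof (induction n)
  case 0
  then show ?case by simp
next
  case (Suc n)
  then show ?case using of_nat_neq_0_below_char[of p "Suc n", where 'k = 'k]
    by (simp only: fact_Suc of_nat_mult) (simp del: of_nat_Suc)
qed

lemma inj_on_of_nat_below_char:
  assumes "CHAR('k::field) = p"
  shows "inj_on (of_nat :: nat \<Rightarrow> 'k) {..<p}"
proof -
  have "i = j" if "i < p" "j < p" "i \<le> j" "(of_nat i :: 'k) = of_nat j" for i j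
  proof -
    have "(of_nat (j - i) :: 'k) = 0" using that by (simp add: of_nat_diff)
    then show ?thesis using that of_nat_neq_0_below_char[OF assms, of "j - i"] by fastforce
  qed
  then show ?thesis by (intro inj_onI) (metis lessThan_iff nat_le_linear)
qed

section \<open>Jacobson's correction term as a sum over words\<close>

context lie_algebra
begin

lemma bracket_add_right: "bracket x (y + z) = bracket x y + bracket x z"
  and bracket_add_left: "bracket (x + y) z = bracket x z + bracket y z"
  and bracket_scale_right: "bracket x (scale c y) = scale c (bracket x y)"
  and bracket_scale_left: "bracket (scale c x) y = scale c (bracket x y)"
  using bracket_bilinear by (simp_all add: bilinear_op_def Vector_Spaces.linear_iff)

lemma bracket_zero_right [simp]: "bracket x 0 = 0"
  using bracket_add_right[of x 0 0] by simp

lemma bracket_zero_left [simp]: "bracket 0 x = 0"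
  using bracket_add_left[of 0 0 x] by simp

lemma bracket_minus_right: "bracket x (- y) = - bracket x y"
  using bracket_add_right[of x y "- y"] by (simp add: minus_unique)

lemma bracket_diff_right: "bracket x (y - z) = bracket x y - bracket x z"
  using bracket_add_right[of x y "- z"] by (simp add: bracket_minus_right)

lemma bracket_sum_right: "bracket x (sum f A) = (\<Sum>a\<in>A. bracket x (f a))"
  by (induction A rule: infinite_finite_induct) (simp_all add: bracket_add_right)

lemma bracket_antisym: "bracket x y = - bracket y x"
proof -
  have "bracket x y + bracket y x = 0"
    using bracket_alternating[of "x + y"] bracket_alternating[of x] bracket_alternating[of y]
    by (simp only: bracket_add_left bracket_add_right) (simp add: add.commute)
  then show ?thesis by (simp add: eq_neg_iff_add_eq_0)
qed

lemma jac_coeff_gt: "n < i \<Longrightarrow> jac_coeff bracket x y n i = 0"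
  by (induction n arbitrary: i) auto

text \<open>The leading coefficient is \<open>(ad x)^n x\<close>. Its vanishing for
  \<open>n = p - 1\<close> keeps division by \<open>p\<close> out of Jacobson's formula.\<close>

lemma jac_coeff_top: "jac_coeff bracket x y n n = (if n = 0 then x else 0)"
proof (induction n)
  case (Suc n)
  then show ?case by (simp add: jac_coeff_gt bracket_alternating)
qed simp

definition word_ad :: "'g \<Rightarrow> 'g \<Rightarrow> letter list \<Rightarrow> 'g" where
  "word_ad x y u = foldr (\<lambda>l. bracket (letter_val x y l)) u x"

lemma word_ad_Cons: "word_ad x y (l # u) = bracket (letter_val x y l) (word_ad x y u)"
  by (simp add: word_ad_def)

lemma nested_bracket_Cons:
  "zs \<noteq> [] \<Longrightarrow> nested_bracket br (x # zs) = br x (nested_bracket br zs)"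
  by (cases zs) simp_all

lemma nested_bracket_word_ad:
  "nested_bracket bracket (map (letter_val x y) (u @ [Sym_x])) = word_ad x y u"
  by (induction u) (simp_all add: word_ad_def nested_bracket_Cons)

definition sym_words :: "nat \<Rightarrow> nat \<Rightarrow> letter list set" where
  "sym_words n i = {u. length u = n \<and> count_list u Sym_x = i}"

lemma sym_words_0: "sym_words 0 i = (if i = 0 then {[]} else {})"
  by (auto simp: sym_words_def)

lemma sym_words_Suc:
  "sym_words (Suc n) i =
     (if i = 0 then {} else (#) Sym_x ` sym_words n (i - 1)) \<union> (#) Sym_y ` sym_words n i"
proof -
  have "u \<in> sym_words (Suc n) i \<longleftrightarrow>
    u \<in> (if i = 0 then {} else (#) Sym_x ` sym_words n (i - 1)) \<union> (#) Sym_y ` sym_words n i" for u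
  proof (cases u)
    case Nil
    then show ?thesis by (auto simp: sym_words_def)
  next
    case (Cons l v)
    then show ?thesis by (cases l) (auto simp: sym_words_def)
  qed
  then show ?thesis by blast
qed

lemma finite_sym_words [simp]: "finite (sym_words n i)"
  by (induction n arbitrary: i) (auto simp: sym_words_0 sym_words_Suc)

lemma jac_coeff_eq_sum_words: "jac_coeff bracket x y n i = (\<Sum>u\<in>sym_words n i. word_ad x y u)"
proof (induction n arbitrary: i)
  case 0
  then show ?case by (simp add: sym_words_0 word_ad_def)
next
  case (Suc n)
  have "(\<Sum>u\<in>sym_words (Suc n) i. word_ad x y u) =
    (\<Sum>u\<in>(if i = 0 then {} else (#) Sym_x ` sym_words n (i - 1)). word_ad x y u) +
    (\<Sum>u\<in>(#) Sym_y ` sym_words n i. word_ad x y u)"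
    unfolding sym_words_Suc by (rule sum.union_disjoint) auto
  then show ?case
    by (simp add: Suc.IH sum.reindex word_ad_Cons bracket_sum_right)
qed

lemma count_Sym_x_le: "count_list u Sym_x \<le> length u"
  by (induction u) auto

lemma length_words_eq: "{u :: letter list. length u = n} = (\<Union>i\<le>n. sym_words n i)"
  using count_Sym_x_le by (auto simp: sym_words_def)

lemma card_Sym_x_positions: "card {k. k < length ws \<and> ws ! k = Sym_x} = count_list ws Sym_x"
  by (simp add: count_list_eq_length_filter length_filter_conv_card eq_commute)

lemma jacobson_words_eq:
  assumes "2 \<le> p"
  shows "jacobson_words p = (\<lambda>u. u @ [Sym_x]) ` {u. length u = p - 1 \<and> u ! (p - 2) = Sym_y}"
proof -
  have "ws \<in> jacobson_words p \<longleftrightarrow> ws \<in> (\<lambda>u. u @ [Sym_x]) ` {u. length u = p - 1 \<and> u ! (p - 2) = Sym_y}" for ws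
  proof (cases ws rule: rev_cases)
    case Nil
    then show ?thesis using assms by (auto simp: jacobson_words_def)
  next
    case (snoc u l)
    then show ?thesis using assms
      by (auto simp: jacobson_words_def nth_append image_iff)
  qed
  then show ?thesis by blast
qed

lemma word_ad_last_Sym_x:
  assumes "u \<noteq> []" "last u = Sym_x"
  shows "word_ad x y u = 0"
  using assms
proof (induction u)
  case (Cons l u)
  then show ?case
    by (cases "u = []") (simp_all add: word_ad_Cons, simp_all add: word_ad_def bracket_alternating)
qed simp

text \<open>The final \<open>x\<close> of a word is the argument of the nested \<open>ad\<close>. A
  word with \<open>i\<close> letters \<open>x\<close> in front of it contributes to
  \<open>t^i\<close> and has \<open>i + 1\<close> letters \<open>x\<close> in all, so the weight
  \<open>1/\<sharp>(x)\<close> is Jacobson's \<open>1/(i + 1)\<close>.\<close>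

lemma jac_sum_eq_words:
  assumes p: "CHAR('k) = p" "2 \<le> p"
  shows "jac_sum scale bracket p x y =
    (\<Sum>ws \<in> jacobson_words p. scale (1 / of_nat (card {k. k < p \<and> ws ! k = Sym_x}))
       (nested_bracket bracket (map (letter_val x y) ws)))"
proof -
  let ?U = "{u. length u = p - 1 \<and> u ! (p - 2) = Sym_y}"
  let ?w = "\<lambda>u. scale (1 / of_nat (Suc (count_list u Sym_x))) (word_ad x y u)"
  have fin: "finite {u :: letter list. length u = n}" for n
    by (simp add: length_words_eq)
  have "(\<Sum>ws \<in> jacobson_words p. scale (1 / of_nat (card {k. k < p \<and> ws ! k = Sym_x}))
       (nested_bracket bracket (map (letter_val x y) ws))) = (\<Sum>u\<in>?U. ?w u)"
    unfolding jacobson_words_eq[OF p(2)]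
  proof (subst sum.reindex, simp add: inj_on_def, rule sum.cong[OF refl])
    fix u assume "u \<in> ?U"
    then have "card {k. k < p \<and> (u @ [Sym_x]) ! k = Sym_x} = Suc (count_list u Sym_x)"
      using card_Sym_x_positions[of "u @ [Sym_x]"] p(2) by simp
    then show "((\<lambda>ws. scale (1 / of_nat (card {k. k < p \<and> ws ! k = Sym_x}))
       (nested_bracket bracket (map (letter_val x y) ws))) \<circ> (\<lambda>u. u @ [Sym_x])) u = ?w u"
      unfolding comp_apply nested_bracket_word_ad by simp
  qed
  \<comment> \<open>The words excluded by the condition on the penultimate letter have innermost
    bracket \<open>[x, x] = 0\<close>.\<close>
  also have "\<dots> = (\<Sum>u | length u = p - 1. ?w u)"
  proof (rule sum.mono_neutral_left[OF fin])
    show "\<forall>u\<in>{u. length u = p - 1} - ?U. ?w u = 0"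
    proof
      fix u assume u: "u \<in> {u. length u = p - 1} - ?U"
      then have len: "length u = Suc (p - 2)" using p(2) by auto
      then have "u \<noteq> []" by auto
      then have "last u = u ! (p - 2)" using len by (simp add: last_conv_nth)
      moreover have "u ! (p - 2) = Sym_x" using u by (cases "u ! (p - 2)") auto
      ultimately show "?w u = 0" using \<open>u \<noteq> []\<close> by (simp add: word_ad_last_Sym_x)
    qed
  qed auto
  also have "\<dots> = (\<Sum>i\<le>p - 1. \<Sum>u\<in>sym_words (p - 1) i. ?w u)"
    unfolding length_words_eq by (rule sum.UNION_disjoint) (simp_all, auto simp: sym_words_def)
  also have "\<dots> = (\<Sum>i\<le>p - 1. scale (1 / of_nat (Suc i)) (jac_coeff bracket x y (p - 1) i))"
  proof (rule sum.cong[OF refl])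
    fix i
    have "(\<Sum>u\<in>sym_words (p - 1) i. ?w u) = (\<Sum>u\<in>sym_words (p - 1) i. scale (1 / of_nat (Suc i)) (word_ad x y u))"
      by (rule sum.cong[OF refl]) (auto simp: sym_words_def)
    then show "(\<Sum>u\<in>sym_words (p - 1) i. ?w u) = scale (1 / of_nat (Suc i)) (jac_coeff bracket x y (p - 1) i)"
      by (simp only: jac_coeff_eq_sum_words scale_sum_right)
  qed
  \<comment> \<open>The term \<open>i = p - 1\<close>, with its scalar \<open>1 / of_nat p\<close>,
    has coefficient zero by \<open>jac_coeff_top\<close>.\<close>
  also have "\<dots> = (\<Sum>i<p - 1. scale (1 / of_nat (Suc i)) (jac_coeff bracket x y (p - 1) i))"
    using p(2) by (simp add: lessThan_Suc_atMost[symmetric] jac_coeff_top del: Suc_pred)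
  also have "\<dots> = jac_sum scale bracket p x y"
    unfolding jac_sum_def
    by (rule sum.reindex_bij_witness[of _ "\<lambda>i. i - 1" Suc]) auto
  finally show ?thesis by simp
qed

lemma ad_pencil_funpow:
  "(bracket (scale c x + y) ^^ n) x = (\<Sum>i\<le>n. scale (c ^ i) (jac_coeff bracket x y n i))"
proof (induction n)
  case 0
  then show ?case by simp
next
  case (Suc n)
  have "(bracket (scale c x + y) ^^ Suc n) x =
      (\<Sum>i\<le>n. scale (c ^ Suc i) (bracket x (jac_coeff bracket x y n i)))
      + (\<Sum>i\<le>n. scale (c ^ i) (bracket y (jac_coeff bracket x y n i)))"
    by (simp add: Suc.IH bracket_add_left bracket_scale_left bracket_sum_right bracket_scale_right
        scale_sum_right sum.distrib scale_right_distrib mult.commute)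
  also have "(\<Sum>i\<le>n. scale (c ^ Suc i) (bracket x (jac_coeff bracket x y n i))) =
      (\<Sum>i\<le>Suc n. scale (c ^ i) (if i = 0 then 0 else bracket x (jac_coeff bracket x y n (i - 1))))"
    unfolding sum.atMost_Suc_shift by simp
  also have "(\<Sum>i\<le>n. scale (c ^ i) (bracket y (jac_coeff bracket x y n i))) =
      (\<Sum>i\<le>Suc n. scale (c ^ i) (bracket y (jac_coeff bracket x y n i)))"
    by (simp add: jac_coeff_gt)
  finally show ?case
    by (simp only: sum.distrib[symmetric] scale_right_distrib[symmetric] jac_coeff.simps)
qed

end

text \<open>Each coordinate in a basis is a scalar polynomial of degree less than
  \<open>m \<le> p\<close>; if it were nonzero, the \<open>p\<close> elements of the prime field
  would be too many roots.\<close>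

lemma (in vector_space) polynomial_coeffs_eq_0:
  assumes p: "CHAR('a) = p" and m: "m \<le> p"
    and zero: "\<And>c. (\<Sum>i<m. scale (c ^ i) (v i)) = 0" and i: "i < m"
  shows "v i = 0"
proof -
  obtain B where B: "independent B" "span B = UNIV"
    using basis_exists[of UNIV] by (metis UNIV_I subset_antisym subsetI)
  have "representation B (v i) b = 0" for b
  proof -
    define P where "P = (\<Sum>i<m. monom (representation B (v i) b) i)"
    have root: "poly P c = 0" for c
    proof -
      have "representation B (\<Sum>i<m. scale (c ^ i) (v i)) b = (\<Sum>i<m. c ^ i * representation B (v i) b)"
        using B by (simp add: representation_sum representation_scale)
      then show ?thesis by (simp add: zero representation_zero P_def poly_sum poly_monom mult.commute)
    qed
    have coeff: "coeff P j = (if j < m then representation B (v j) b else 0)" for j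
      by (simp add: P_def coeff_sum)
    have "P = 0"
    proof (rule ccontr)
      assume "P \<noteq> 0"
      have "degree P < m"
        using i by (intro degree_lessI) (auto simp: coeff)
      moreover have "p \<le> card {x. poly P x = 0}"
        using card_mono[OF poly_roots_finite[OF \<open>P \<noteq> 0\<close>], of "of_nat ` {..<p}"] root
          card_image[OF inj_on_of_nat_below_char[OF p]] by auto
      ultimately show False
        using card_poly_roots_bound[OF \<open>P \<noteq> 0\<close>] m by simp
    qed
    then show ?thesis using coeff[of i] i by simp
  qed
  then show ?thesis
    using sum_nonzero_representation_eq[OF B(1), of "v i"] B(2) by simp
qed

context restricted_lie_algebra
begin

text \<open>The axiom prescribes only the values of a polynomial in \<open>c\<close>; since its
  degree is at most \<open>p - 2\<close>, they determine the coefficients and hence the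
  \<open>s i\<close>.\<close>

lemma pmap_add_jac_sum:
  assumes p: "CHAR('k) = p" "2 \<le> p"
  shows "pmap (x + y) = pmap x + pmap y + jac_sum scale bracket p x y"
proof -
  obtain s where s: "\<And>c. (bracket (scale c x + y) ^^ (p - 1)) x
               = (\<Sum>i = 1..p - 1. scale (of_nat i * c ^ (i - 1)) (s i))"
    and add: "pmap (x + y) = pmap x + pmap y + (\<Sum>i = 1..p - 1. s i)"
    using pmap_add by blast
  have "jac_coeff bracket x y (p - 1) i = scale (of_nat (Suc i)) (s (Suc i))" if i: "i < p - 1" for i
  proof -
    have "(\<Sum>i<p - 1. scale (c ^ i) (jac_coeff bracket x y (p - 1) i - scale (of_nat (Suc i)) (s (Suc i)))) = 0" for c
    proof -
      have "(\<Sum>i<p - 1. scale (c ^ i) (scale (of_nat (Suc i)) (s (Suc i)))) =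
          (\<Sum>i = 1..p - 1. scale (of_nat i * c ^ (i - 1)) (s i))"
        by (rule sum.reindex_bij_witness[of _ "\<lambda>i. i - 1" Suc]) (auto simp: mult.commute)
      also have "\<dots> = (\<Sum>i\<le>p - 1. scale (c ^ i) (jac_coeff bracket x y (p - 1) i))"
        by (simp only: s[symmetric] ad_pencil_funpow)
      also have "\<dots> = (\<Sum>i<p - 1. scale (c ^ i) (jac_coeff bracket x y (p - 1) i))"
        using p(2) by (simp add: lessThan_Suc_atMost[symmetric] jac_coeff_top del: Suc_pred)
      finally show ?thesis by (simp add: scale_right_diff_distrib sum_subtractf)
    qed
    from polynomial_coeffs_eq_0[OF p(1) _ this i] show ?thesis by simp
  qed
  then have "jac_sum scale bracket p x y = (\<Sum>i = 1..p - 1. scale (1 / of_nat i) (scale (of_nat i) (s i)))"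
    unfolding jac_sum_def by (intro sum.cong refl) auto
  also have "\<dots> = (\<Sum>i = 1..p - 1. s i)"
    using of_nat_neq_0_below_char[OF p(1)] p(2) by (intro sum.cong refl) (auto simp: less_eq_Suc_le)
  finally show ?thesis using add by simp
qed

end

section \<open>The composition coefficients\<close>

text \<open>
  The iterated integral of \<open>\<Prod> v\<^sub>i\<^bsup>l\<^sub>i - 1\<^esup> / (l\<^sub>i - 1)!\<close> over the simplex, started at total degree \<open>s\<close>:
  for \<open>s = 0\<close> this is the coefficient in the twisted p-map, up to the factor \<open>(p - 1)!\<close>.
\<close>

fun simplex_weight :: "nat \<Rightarrow> nat list \<Rightarrow> 'k::field" where
  "simplex_weight s [] = 1"
| "simplex_weight s [l] = 1 / of_nat (fact (l - 1))"
| "simplex_weight s (l # m # ls) = 1 / of_nat (fact (l - 1)) * (1 / of_nat (s + l)) * simplex_weight (s + l) (m # ls)"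

lemma simplex_weight_Cons:
  "ls \<noteq> [] \<Longrightarrow> simplex_weight s (l # ls) = 1 / of_nat (fact (l - 1)) * (1 / of_nat (s + l)) * (simplex_weight (s + l) ls :: 'k::field)"
  by (cases ls) simp_all

lemma simplex_weight_eq:
  "ls \<noteq> [] \<Longrightarrow> simplex_weight s ls =
     1 / of_nat (\<Prod>l\<leftarrow>ls. fact (l - 1)) *
     (1 / of_nat (\<Prod>v \<in> {1..<length ls}. s + sum_list (take v ls)) :: 'k::field)"
proof (induction s ls rule: simplex_weight.induct)
  case (3 s l m ls)
  let ?n = "length (m # ls)"
  have prod: "(\<Prod>v \<in> {1..<length (l # m # ls)}. s + sum_list (take v (l # m # ls))) =
      (\<Prod>v \<in> {0..<?n}. s + l + sum_list (take v (m # ls)))"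
    by (rule prod.reindex_bij_witness[of _ Suc "\<lambda>i. i - 1"]) (auto simp: take_Cons')
  have prod': "\<dots> = (s + l) * (\<Prod>v \<in> {1..<?n}. s + l + sum_list (take v (m # ls)))"
    by (subst prod.atLeast_Suc_lessThan) simp_all
  have "1 / a * (1 / b) * (1 / c * (1 / d)) = 1 / (a * c) * (1 / (b * d))" for a b c d :: 'k
    by simp
  then show ?case
    unfolding simplex_weight.simps(3) "3.IH"[OF list.distinct(2)] prod prod' list.map(2)[of _ l] prod_list.Cons[of "fact (l - 1)"] of_nat_mult
    by blast
qed simp_all

text \<open>The total weight of the compositions from which \<open>ls\<close> arises by incrementing
  one part. A part equal to 1 cannot be the one that was incremented.\<close>

definition decrement_weight :: "nat \<Rightarrow> nat list \<Rightarrow> 'k::field" where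
  "decrement_weight s ls =
     (\<Sum>j<length ls. if 2 \<le> ls ! j then simplex_weight s (ls[j := ls ! j - 1]) else 0)"

lemma decrement_weight_Cons:
  assumes "ls \<noteq> []"
  shows "decrement_weight s (l # ls) =
     (if 2 \<le> l then simplex_weight s ((l - 1) # ls) else 0) +
     1 / of_nat (fact (l - 1)) * (1 / of_nat (s + l)) * (decrement_weight (s + l) ls :: 'k::field)"
proof -
  let ?c = "1 / of_nat (fact (l - 1)) * (1 / of_nat (s + l)) :: 'k"
  have "simplex_weight s (l # ls[j := m]) = ?c * simplex_weight (s + l) (ls[j := m])" for j m
    using assms by (intro simplex_weight_Cons) auto
  then have step: "(if 2 \<le> (l # ls) ! Suc j then simplex_weight s ((l # ls)[Suc j := (l # ls) ! Suc j - 1]) else 0) =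
      ?c * (if 2 \<le> ls ! j then simplex_weight (s + l) (ls[j := ls ! j - 1]) else 0)" for j
    by (cases "2 \<le> ls ! j") (simp_all only: nth_Cons_Suc list_update.simps nat.case if_True if_False mult_zero_right)
  show ?thesis
    unfolding decrement_weight_def length_Cons sum.lessThan_Suc_shift sum_distrib_left step
    by (simp only: nth_Cons_0 list_update.simps nat.case)
qed

lemma of_nat_pred_div_fact:
  assumes "CHAR('k::field) = p" "2 \<le> l" "l \<le> p"
  shows "1 / of_nat (fact (l - 1 - 1)) = (of_nat (l - 1) * (1 / of_nat (fact (l - 1))) :: 'k)"
proof -
  from assms(2) have m: "l = Suc (Suc (l - 2))" by simp
  define m where "m = l - 2"
  with m have m: "l = Suc (Suc m)" by simp
  have "(of_nat (Suc m) :: 'k) \<noteq> 0" "(of_nat (fact m) :: 'k) \<noteq> 0"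
    using of_nat_neq_0_below_char[OF assms(1), of "Suc m"] fact_neq_0_below_char[OF assms(1), of m] assms(3) m
    by simp_all
  moreover have "(of_nat (fact (Suc m)) :: 'k) = of_nat (Suc m) * of_nat (fact m)"
    by (simp only: fact_Suc of_nat_mult of_nat_id)
  ultimately show ?thesis by (simp add: m del: of_nat_Suc fact_Suc)
qed

text \<open>A general start \<open>s\<close> is forced by the induction, because stripping the first
  part \<open>l\<close> moves the start to \<open>s + l\<close>. The term with \<open>s - 1\<close>
  comes from decrementing the first part, which lowers all later partial sums by one. The bound by
  \<open>p\<close> and the last premise keep the denominators \<open>s + l\<close> and
  \<open>s + l - 1\<close> nonzero when further parts follow.\<close>

lemma decrement_weight_eq:
  assumes p: "CHAR('k::field) = p"
  shows "ls \<noteq> [] \<Longrightarrow> \<forall>l\<in>set ls. 1 \<le> l \<Longrightarrow> s + sum_list ls \<le> p \<Longrightarrow> 1 \<le> s \<or> 2 \<le> hd ls \<Longrightarrow>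
    decrement_weight s ls =
      of_nat (s + sum_list ls - 1) * simplex_weight s ls - of_nat s * (simplex_weight (s - 1) ls :: 'k)"
proof (induction ls arbitrary: s)
  case Nil
  then show ?case by simp
next
  case (Cons l ls)
  have l: "1 \<le> l" "l \<le> p" using Cons.prems by auto
  show ?case
  proof (cases "ls = []")
    case True
    have "of_nat (s + l - 1) = (of_nat s + of_nat (l - 1) :: 'k)"
      using l by (simp flip: of_nat_add)
    moreover have "decrement_weight s [l] = of_nat (l - 1) * (1 / of_nat (fact (l - 1)) :: 'k)"
    proof (cases "2 \<le> l")
      case True
      then show ?thesis using of_nat_pred_div_fact[OF p True l(2)] by (simp add: decrement_weight_def)
    next
      case False
      then have "l = 1" using l by simp
      then show ?thesis by (simp add: decrement_weight_def)
    qed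
    ultimately show ?thesis
      using True by (simp only: simplex_weight.simps sum_list.Cons sum_list.Nil add_0_right distrib_right) simp
  next
    case False
    then obtain m where m: "m \<in> set ls" by (cases ls) auto
    have "1 \<le> m" "m \<le> sum_list ls" using m Cons.prems(2) by (auto intro: member_le_sum_list)
    then have sl: "s + l < p" using Cons.prems(3) by simp
    let ?f = "1 / of_nat (fact (l - 1)) :: 'k"
    let ?W = "simplex_weight (s + l) ls :: 'k" and ?W' = "simplex_weight (s + l - 1) ls :: 'k"
    have nz: "(of_nat (s + l) :: 'k) \<noteq> 0" "(of_nat (s + l - 1) :: 'k) \<noteq> 0"
      using sl l Cons.prems(4) of_nat_neq_0_below_char[OF p, of "s + l"] of_nat_neq_0_below_char[OF p, of "s + l - 1"]
      by (force simp del: of_nat_add of_nat_diff)+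
    have IH: "decrement_weight (s + l) ls = of_nat (s + l + sum_list ls - 1) * ?W - of_nat (s + l) * ?W'"
      using Cons.prems l by (intro Cons.IH[OF False]) auto
    have first: "(if 2 \<le> l then simplex_weight s ((l - 1) # ls) else 0) =
        ?f * (of_nat (l - 1) / of_nat (s + l - 1)) * ?W'"
    proof (cases "2 \<le> l")
      case True
      then show ?thesis
        using of_nat_pred_div_fact[OF p True l(2)] simplex_weight_Cons[OF False, of s "l - 1", where 'k = 'k]
        by simp
    next
      case False
      then have "l = 1" using l by simp
      then show ?thesis by simp
    qed
    \<comment> \<open>For \<open>s = 0\<close> the truncated \<open>s - 1\<close> is multiplied by
      zero.\<close>
    have prev: "of_nat s * simplex_weight (s - 1) (l # ls) = ?f * (of_nat s / of_nat (s + l - 1)) * ?W'"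
      using simplex_weight_Cons[OF False, of "s - 1" l, where 'k = 'k] by (cases s) simp_all
    have split: "(of_nat (l - 1) :: 'k) = of_nat (s + l - 1) - of_nat s"
      using l by (simp add: of_nat_diff)
    have "decrement_weight s (l # ls) =
        ?f * (of_nat (l - 1) / of_nat (s + l - 1)) * ?W' +
        ?f * (1 / of_nat (s + l)) * (of_nat (s + l + sum_list ls - 1) * ?W - of_nat (s + l) * ?W')"
      unfolding decrement_weight_Cons[OF False] first IH ..
    also have "\<dots> = of_nat (s + l + sum_list ls - 1) * (?f * (1 / of_nat (s + l)) * ?W)
        - ?f * (of_nat s / of_nat (s + l - 1)) * ?W'"
      unfolding split using nz
      by (simp add: diff_divide_distrib algebra_simps del: of_nat_add)
    finally show ?thesis
      by (simp only: prev simplex_weight_Cons[OF False, of s l, symmetric] sum_list.Cons add.assoc)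
  qed
qed

text \<open>The last step in the growth of \<open>ls\<close> either incremented a part or prepended
  a part 1. With the factorials restored this is the recursion for the number of growth
  histories.\<close>

lemma decrement_weight_start:
  assumes p: "CHAR('k::field) = p"
    and ls: "ls \<noteq> []" "\<forall>l\<in>set ls. 1 \<le> l" "sum_list ls \<le> p"
  shows "of_nat (sum_list ls - 1) * simplex_weight 0 ls =
    decrement_weight 0 ls + (if hd ls = 1 \<and> tl ls \<noteq> [] then simplex_weight 0 (tl ls) else (0 :: 'k))"
proof (cases "hd ls = 1")
  case False
  then have "2 \<le> hd ls" using ls by (cases ls) auto
  then show ?thesis using decrement_weight_eq[OF p, of ls 0] ls False by simp
next
  case True
  then obtain ms where ms: "ls = 1 # ms" using ls(1) by (cases ls) auto
  show ?thesis
  proof (cases "ms = []")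
    case True
    then show ?thesis by (simp add: ms decrement_weight_def)
  next
    case False
    have "decrement_weight 1 ms = of_nat (sum_list ms) * simplex_weight 1 ms - (simplex_weight 0 ms :: 'k)"
      using decrement_weight_eq[OF p False, of 1] ls ms by simp
    then show ?thesis
      using False decrement_weight_Cons[OF False, of 0 1, where 'k = 'k]
        simplex_weight_Cons[OF False, of 0 1, where 'k = 'k] by (simp add: ms)
  qed
qed

section \<open>Growth of compositions and of brackets of bullet powers\<close>

lemma compositions_Suc_length: "ls \<in> compositions m (Suc n) \<Longrightarrow> ls \<noteq> []"
  by (auto simp: compositions_def)

lemma finite_compositions [simp]: "finite (compositions m n)"
proof (rule finite_subset)
  show "compositions m n \<subseteq> {ls. set ls \<subseteq> {..m} \<and> length ls = n}"
    by (auto simp: compositions_def intro: member_le_sum_list)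
  show "finite {ls. set ls \<subseteq> {..m} \<and> length ls = n}"
    by (rule finite_lists_length_eq) simp
qed

text \<open>Incrementing part \<open>j\<close> is a bijection onto the pairs in which part
  \<open>j\<close> is at least 2; the sum is reindexed along it.\<close>

lemma sum_compositions_increment:
  fixes F :: "nat list \<Rightarrow> nat list \<Rightarrow> 'v::comm_monoid_add"
  shows "(\<Sum>ls\<in>compositions m n. \<Sum>j<n. F ls (ls[j := Suc (ls ! j)])) =
    (\<Sum>ls\<in>compositions (Suc m) n. \<Sum>j<n. if 2 \<le> ls ! j then F (ls[j := ls ! j - 1]) ls else 0)"
proof -
  have "(\<Sum>ls\<in>compositions m n. \<Sum>j<n. F ls (ls[j := Suc (ls ! j)])) =
      (\<Sum>(ls, j)\<in>compositions m n \<times> {..<n}. F ls (ls[j := Suc (ls ! j)]))"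
    by (rule sum.cartesian_product)
  also have "\<dots> = (\<Sum>(ls, j)\<in>{(ls, j). ls \<in> compositions (Suc m) n \<and> j < n \<and> 2 \<le> ls ! j}. F (ls[j := ls ! j - 1]) ls)"
  proof (rule sum.reindex_bij_witness[of _ "\<lambda>(ls, j). (ls[j := ls ! j - 1], j)" "\<lambda>(ls, j). (ls[j := Suc (ls ! j)], j)"], goal_cases)
    case (1 a)
    then show ?case by (auto simp: compositions_def)
  next
    case (2 a)
    then obtain ls j where a: "a = (ls, j)" and "ls \<in> compositions m n" "j < n" by auto
    then have "length ls = n" "sum_list ls = m" "\<forall>l\<in>set ls. 1 \<le> l" by (auto simp: compositions_def)
    then show ?case using \<open>j < n\<close> a
      by (auto simp: compositions_def sum_list_update dest!: set_update_subset_insert[THEN subsetD])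
  next
    case (3 b)
    then show ?case by (auto simp: compositions_def)
  next
    case (4 b)
    then obtain ls j where b: "b = (ls, j)" and "ls \<in> compositions (Suc m) n" "j < n" "2 \<le> ls ! j" by auto
    then have "length ls = n" "sum_list ls = Suc m" "\<forall>l\<in>set ls. 1 \<le> l" by (auto simp: compositions_def)
    moreover have "ls ! j \<le> sum_list ls" using \<open>length ls = n\<close> \<open>j < n\<close> by (intro elem_le_sum_list) simp
    ultimately show ?case using \<open>j < n\<close> \<open>2 \<le> ls ! j\<close> b
      by (auto simp: compositions_def sum_list_update dest!: set_update_subset_insert[THEN subsetD])
  next
    case (5 b)
    then show ?case by (auto simp: compositions_def)
  qed
  also have "\<dots> = (\<Sum>(ls, j)\<in>compositions (Suc m) n \<times> {..<n}. if 2 \<le> ls ! j then F (ls[j := ls ! j - 1]) ls else 0)"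
    by (rule sum.mono_neutral_cong_left) (auto split: if_splits)
  also have "\<dots> = (\<Sum>ls\<in>compositions (Suc m) n. \<Sum>j<n. if 2 \<le> ls ! j then F (ls[j := ls ! j - 1]) ls else 0)"
    by (rule sum.cartesian_product[symmetric])
  finally show ?thesis .
qed

lemma sum_compositions_Cons_1:
  fixes F :: "nat list \<Rightarrow> 'v::comm_monoid_add"
  assumes "0 < n"
  shows "(\<Sum>ls\<in>compositions m n. F (1 # ls)) =
    (\<Sum>ls\<in>compositions (Suc m) (Suc n). if hd ls = 1 \<and> tl ls \<noteq> [] then F ls else 0)"
proof -
  have "(\<Sum>ls\<in>compositions m n. F (1 # ls)) = (\<Sum>ls\<in>(#) 1 ` compositions m n. F ls)"
    by (simp add: sum.reindex)
  also have "\<dots> = (\<Sum>ls\<in>compositions (Suc m) (Suc n). if hd ls = 1 \<and> tl ls \<noteq> [] then F ls else 0)"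
  proof (rule sum.mono_neutral_cong_left)
    show "\<forall>ls\<in>compositions (Suc m) (Suc n) - (#) 1 ` compositions m n.
        (if hd ls = 1 \<and> tl ls \<noteq> [] then F ls else 0) = 0"
    proof
      fix ls assume "ls \<in> compositions (Suc m) (Suc n) - (#) 1 ` compositions m n"
      then have "hd ls \<noteq> 1" by (cases ls) (auto simp: compositions_def image_iff)
      then show "(if hd ls = 1 \<and> tl ls \<noteq> [] then F ls else 0) = 0" by simp
    qed
  qed (use assms in \<open>simp_all, auto simp: compositions_def\<close>)
  finally show ?thesis .
qed

context post_lie_algebra
begin

lemma tri_add_right: "tri x (y + z) = tri x y + tri x z"
  and tri_add_left: "tri (x + y) z = tri x z + tri y z"
  and tri_scale_right: "tri x (scale c y) = scale c (tri x y)"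
  and tri_scale_left: "tri (scale c x) y = scale c (tri x y)"
  using tri_bilinear by (simp_all add: bilinear_op_def Vector_Spaces.linear_iff)

lemma tri_zero_right [simp]: "tri x 0 = 0"
  using tri_add_right[of x 0 0] by simp

lemma tri_zero_left [simp]: "tri 0 x = 0"
  using tri_add_left[of 0 0 x] by simp

lemma tri_minus_right: "tri x (- y) = - tri x y"
  using tri_add_right[of x y "- y"] by (simp add: minus_unique)

lemma tri_minus_left: "tri (- x) y = - tri x y"
  using tri_add_left[of x "- x" y] by (simp add: minus_unique)

lemma tri_diff_right: "tri x (y - z) = tri x y - tri x z"
  using tri_add_right[of x y "- z"] by (simp add: tri_minus_right)

lemma tri_diff_left: "tri (x - y) z = tri x z - tri y z"
  using tri_add_left[of x "- y" z] by (simp add: tri_minus_left)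

lemma tri_sum_right: "tri x (sum f A) = (\<Sum>a\<in>A. tri x (f a))"
  by (induction A rule: infinite_finite_induct) (simp_all add: tri_add_right)

definition bullet_bracket :: "'g \<Rightarrow> nat list \<Rightarrow> 'g" where
  "bullet_bracket x ls = nested_bracket bracket (map (bullet_pow tri x) ls)"

lemma bullet_bracket_Cons:
  "ls \<noteq> [] \<Longrightarrow> bullet_bracket x (l # ls) = bracket (bullet_pow tri x l) (bullet_bracket x ls)"
  by (simp add: bullet_bracket_def nested_bracket_Cons)

lemma tri_bullet_pow: "1 \<le> l \<Longrightarrow> tri x (bullet_pow tri x l) = bullet_pow tri x (Suc l)"
  by (cases l) (simp_all add: bullet_pow_def)

text \<open>\<open>tri x\<close> is a derivation of the bracket and raises the exponent of a bullet
  power, so the Leibniz rule increments one part at a time.\<close>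

lemma tri_bullet_bracket:
  "ls \<noteq> [] \<Longrightarrow> \<forall>l\<in>set ls. 1 \<le> l \<Longrightarrow>
    tri x (bullet_bracket x ls) = (\<Sum>j<length ls. bullet_bracket x (ls[j := Suc (ls ! j)]))"
proof (induction ls)
  case Nil
  then show ?case by simp
next
  case (Cons l ls)
  show ?case
  proof (cases "ls = []")
    case True
    then show ?thesis using Cons.prems by (simp add: bullet_bracket_def tri_bullet_pow)
  next
    case False
    then have "bullet_bracket x (l # ls[j := m]) = bracket (bullet_pow tri x l) (bullet_bracket x (ls[j := m]))" for j m
      by (intro bullet_bracket_Cons) simp
    then show ?thesis
      using False Cons
      unfolding length_Cons sum.lessThan_Suc_shift
      by (simp add: bullet_bracket_Cons tri_bracket tri_bullet_pow bracket_sum_right)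
  qed
qed

text \<open>This will turn out to be the coefficient of \<open>t^i\<close> in
  \<open>(ad (t (x, 0) + (0, x)))^n (x, 0)\<close> in the semidirect product: \<open>i\<close>
  brackets with \<open>x\<close> make \<open>i + 1\<close> parts, and every step raises the total by
  one. For \<open>n < p\<close> the scalar \<open>fact n * simplex_weight 0 ls\<close> is the number
  of growth histories of \<open>ls\<close> modulo \<open>p\<close>.\<close>

definition composition_coeff :: "'g \<Rightarrow> nat \<Rightarrow> nat \<Rightarrow> 'g" where
  "composition_coeff x n i =
    (\<Sum>ls\<in>compositions (Suc n) (Suc i). scale (of_nat (fact n) * simplex_weight 0 ls) (bullet_bracket x ls))"

lemma composition_coeff_0: "composition_coeff x 0 i = (if i = 0 then x else 0)"
proof -
  have "compositions (Suc 0) (Suc i) = (if i = 0 then {[1]} else {})"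
  proof (cases "i = 0")
    case True
    then show ?thesis by (auto simp: compositions_def length_Suc_conv)
  next
    case False
    have "length ls \<le> sum_list ls" if "\<forall>l\<in>set ls. 1 \<le> l" for ls :: "nat list"
      using that by (induction ls) auto
    then show ?thesis using False by (fastforce simp: compositions_def)
  qed
  then show ?thesis by (simp add: composition_coeff_def bullet_bracket_def bullet_pow_def)
qed

text \<open>
  Both summands of the recursion raise the degree by one: the derivation increments one of the parts,
  and bracketing with \<open>x\<close> prepends a part equal to 1.
\<close>

lemma composition_coeff_Suc:
  assumes p: "CHAR('k) = p" and n: "Suc (Suc n) \<le> p"
  shows "composition_coeff x (Suc n) i =
    (if i = 0 then 0 else bracket x (composition_coeff x n (i - 1))) + tri x (composition_coeff x n i)"
proof -
  let ?C = "compositions (Suc (Suc n)) (Suc i)"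
  let ?f = "of_nat (fact n) :: 'k"
  have "tri x (composition_coeff x n i) =
      (\<Sum>ls\<in>compositions (Suc n) (Suc i). \<Sum>j<Suc i. scale (?f * simplex_weight 0 ls) (bullet_bracket x (ls[j := Suc (ls ! j)])))"
    unfolding composition_coeff_def tri_sum_right
    by (intro sum.cong refl)
       (simp add: tri_scale_right tri_bullet_bracket compositions_Suc_length scale_sum_right compositions_def
         del: sum.lessThan_Suc)
  also have "\<dots> = (\<Sum>ls\<in>?C. \<Sum>j<Suc i.
      if 2 \<le> ls ! j then scale (?f * simplex_weight 0 (ls[j := ls ! j - 1])) (bullet_bracket x ls) else 0)"
    by (rule sum_compositions_increment)
  also have "\<dots> = (\<Sum>ls\<in>?C. scale (?f * decrement_weight 0 ls) (bullet_bracket x ls))"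
  proof (rule sum.cong[OF refl])
    fix ls assume "ls \<in> ?C"
    then have "length ls = Suc i" by (simp add: compositions_def)
    then show "(\<Sum>j<Suc i. if 2 \<le> ls ! j then scale (?f * simplex_weight 0 (ls[j := ls ! j - 1])) (bullet_bracket x ls) else 0)
        = scale (?f * decrement_weight 0 ls) (bullet_bracket x ls)"
      unfolding decrement_weight_def sum_distrib_left scale_sum_left by (intro sum.cong) simp_all
  qed
  finally have tri: "tri x (composition_coeff x n i) = (\<Sum>ls\<in>?C. scale (?f * decrement_weight 0 ls) (bullet_bracket x ls))" .
  have br: "(if i = 0 then 0 else bracket x (composition_coeff x n (i - 1))) =
      (\<Sum>ls\<in>?C. if hd ls = 1 \<and> tl ls \<noteq> [] then scale (?f * simplex_weight 0 (tl ls)) (bullet_bracket x ls) else 0)"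
  proof (cases i)
    case 0
    have "tl ls = []" if "ls \<in> ?C" for ls
      using that 0 by (auto simp: compositions_def length_Suc_conv)
    then show ?thesis using 0 by simp
  next
    case (Suc k)
    have "bracket x (composition_coeff x n k) =
        (\<Sum>ls\<in>compositions (Suc n) (Suc k). scale (?f * simplex_weight 0 (tl (1 # ls))) (bullet_bracket x (1 # ls)))"
      unfolding composition_coeff_def bracket_sum_right
      by (intro sum.cong refl) (simp add: bullet_bracket_Cons compositions_Suc_length bracket_scale_right bullet_pow_def)
    also have "\<dots> = (\<Sum>ls\<in>?C. if hd ls = 1 \<and> tl ls \<noteq> [] then scale (?f * simplex_weight 0 (tl ls)) (bullet_bracket x ls) else 0)"
      unfolding Suc by (rule sum_compositions_Cons_1[where F = "\<lambda>ls. scale (?f * simplex_weight 0 (tl ls)) (bullet_bracket x ls)"]) simp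
    finally show ?thesis using Suc by simp
  qed
  have "scale (of_nat (fact (Suc n)) * simplex_weight 0 ls) (bullet_bracket x ls) =
      (if hd ls = 1 \<and> tl ls \<noteq> [] then scale (?f * simplex_weight 0 (tl ls)) (bullet_bracket x ls) else 0) +
      scale (?f * decrement_weight 0 ls) (bullet_bracket x ls)" if "ls \<in> ?C" for ls
  proof -
    have ls: "ls \<noteq> []" "\<forall>l\<in>set ls. 1 \<le> l" "sum_list ls = Suc (Suc n)"
      using that by (auto simp: compositions_def)
    have "of_nat (Suc n) * simplex_weight 0 ls =
      decrement_weight 0 ls + (if hd ls = 1 \<and> tl ls \<noteq> [] then simplex_weight 0 (tl ls) else (0 :: 'k))"
      using decrement_weight_start[OF p ls(1,2)] ls(3) n by simp
    moreover have "of_nat (fact (Suc n)) * simplex_weight 0 ls = ?f * (of_nat (Suc n) * simplex_weight 0 ls)"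
      by (simp only: fact_Suc of_nat_mult of_nat_id mult_ac)
    ultimately have "of_nat (fact (Suc n)) * simplex_weight 0 ls =
        ?f * (if hd ls = 1 \<and> tl ls \<noteq> [] then simplex_weight 0 (tl ls) else 0) + ?f * decrement_weight 0 ls"
      by (simp only: distrib_left add.commute)
    then show ?thesis by (simp only: scale_left_distrib) simp
  qed
  then show ?thesis
    unfolding tri br sum.distrib[symmetric] by (subst composition_coeff_def) (rule sum.cong[OF refl])
qed

text \<open>Compositions with \<open>i\<close> parts belong to \<open>t^(i-1)\<close>, so the factor
  \<open>1/n\<close> in the twisted p-map is the \<open>1/i\<close> of Jacobson's sum.\<close>

lemma tri_pmap_eq:
  assumes "0 < p"
  shows "tri_pmap scale bracket tri p pmap x =
    pmap x + (\<Sum>i = 1..p - 1. scale (1 / of_nat i) (composition_coeff x (p - 1) (i - 1)))"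
proof -
  have "(\<Sum>ls \<in> compositions p i.
           scale (of_nat (fact (p - 1)) / of_nat (\<Prod>l\<leftarrow>ls. fact (l - 1)) * (1 / C_coeff ls))
             (nested_bracket bracket (map (bullet_pow tri x) ls))) = composition_coeff x (p - 1) (i - 1)"
    if "i \<in> {1..p - 1}" for i
  proof -
    have i: "Suc (i - 1) = i" "Suc (p - 1) = p" using that by auto
    show ?thesis
      unfolding composition_coeff_def i bullet_bracket_def
    proof (rule sum.cong[OF refl])
      fix ls assume "ls \<in> compositions p i"
      then have "ls \<noteq> []" using that by (auto simp: compositions_def)
      then show "scale (of_nat (fact (p - 1)) / of_nat (\<Prod>l\<leftarrow>ls. fact (l - 1)) * (1 / C_coeff ls))
             (nested_bracket bracket (map (bullet_pow tri x) ls)) =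
           scale (of_nat (fact (p - 1)) * simplex_weight 0 ls) (nested_bracket bracket (map (bullet_pow tri x) ls))"
        by (simp add: simplex_weight_eq C_coeff_def)
    qed
  qed
  then show ?thesis by (simp add: tri_pmap_def)
qed

end

section \<open>A faithful representation of a Lie algebra\<close>

lemma lookup_scalar_times: "Poly_Mapping.lookup (scalar c * f) w = c * Poly_Mapping.lookup f w"
  for f :: "'m::monoid_add \<Rightarrow>\<^sub>0 'k::field"
proof -
  have "scalar c * f = Poly_Mapping.map ((*) c) f"
    by (simp add: scalar_def mult_map_scale_conv_mult)
  then show ?thesis by (simp add: map.rep_eq when_def)
qed

lemma vector_space_poly_mapping: "vector_space (\<lambda>c (f :: 'm::monoid_add \<Rightarrow>\<^sub>0 'k::field). scalar c * f)"
  by unfold_locales (auto intro!: poly_mapping_eqI simp: lookup_scalar_times lookup_add algebra_simps)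

interpretation poly_mapping: vector_space "\<lambda>c (f :: 'm::monoid_add \<Rightarrow>\<^sub>0 'k::field). scalar c * f"
  by (rule vector_space_poly_mapping)

lemma scalar_single: "scalar c * Poly_Mapping.single w d = Poly_Mapping.single w (c * d)"
  for d :: "'k::field"
  by (simp add: scalar_def mult_single)

lemma scalar_commute: "f * scalar c = scalar c * f" for f :: "'m::monoid_add \<Rightarrow>\<^sub>0 'k::field"
proof -
  have "prod_fun (Poly_Mapping.lookup f) (\<lambda>w. c when 0 = w) k = c * Poly_Mapping.lookup f k" for k
  proof -
    have "prod_fun (Poly_Mapping.lookup f) (\<lambda>w. c when 0 = w) k =
       (\<Sum>l. Poly_Mapping.lookup f l * (\<Sum>q. (c when k = l + q) when q = 0))"
      unfolding prod_fun_def
      by (intro Sum_any.cong arg_cong2[where f = "(*)"] refl) (auto simp: when_def)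
    also have "\<dots> = (\<Sum>l. (Poly_Mapping.lookup f l * c) when l = k)"
      by (intro Sum_any.cong) (auto simp: when_def)
    finally show ?thesis by (simp add: mult.commute)
  qed
  then show ?thesis
    by (intro poly_mapping_eqI) (simp add: lookup_scalar_times, simp add: scalar_def times_poly_mapping.rep_eq single.rep_eq)
qed

definition lin_ext :: "('k \<Rightarrow> 'v \<Rightarrow> 'v) \<Rightarrow> ('m \<Rightarrow> 'v::ab_group_add) \<Rightarrow> ('m \<Rightarrow>\<^sub>0 'k::field) \<Rightarrow> 'v" where
  "lin_ext scale \<phi> f = (\<Sum>w\<in>Poly_Mapping.keys f. scale (Poly_Mapping.lookup f w) (\<phi> w))"

context vector_space
begin

lemma lin_ext_superset:
  "finite S \<Longrightarrow> Poly_Mapping.keys f \<subseteq> S \<Longrightarrow> lin_ext scale \<phi> f = (\<Sum>w\<in>S. scale (Poly_Mapping.lookup f w) (\<phi> w))"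
  unfolding lin_ext_def by (rule sum.mono_neutral_left) (auto simp: in_keys_iff)

lemma lin_ext_zero [simp]: "lin_ext scale \<phi> 0 = 0"
  by (simp add: lin_ext_def)

lemma lin_ext_add: "lin_ext scale \<phi> (f + g) = lin_ext scale \<phi> f + lin_ext scale \<phi> g"
proof -
  let ?S = "Poly_Mapping.keys f \<union> Poly_Mapping.keys g"
  have "Poly_Mapping.keys (f + g) \<subseteq> ?S" by (rule keys_add)
  then show ?thesis
    using lin_ext_superset[of ?S f \<phi>] lin_ext_superset[of ?S g \<phi>] lin_ext_superset[of ?S "f + g" \<phi>]
    by (simp add: lookup_add scale_left_distrib sum.distrib)
qed

lemma lin_ext_minus: "lin_ext scale \<phi> (- f) = - lin_ext scale \<phi> f"
  using lin_ext_add[of \<phi> f "- f"] by (simp add: minus_unique)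

lemma lin_ext_diff: "lin_ext scale \<phi> (f - g) = lin_ext scale \<phi> f - lin_ext scale \<phi> g"
  using lin_ext_add[of \<phi> f "- g"] by (simp add: lin_ext_minus)

lemma lin_ext_scalar: "lin_ext scale \<phi> (scalar c * f) = scale c (lin_ext scale \<phi> f)"
proof -
  have "Poly_Mapping.keys (scalar c * f) \<subseteq> Poly_Mapping.keys f"
    by (auto simp: in_keys_iff lookup_scalar_times)
  then show ?thesis
    using lin_ext_superset[of "Poly_Mapping.keys f" "scalar c * f" \<phi>]
    by (simp add: lookup_scalar_times lin_ext_def scale_sum_right)
qed

lemma lin_ext_single: "lin_ext scale \<phi> (Poly_Mapping.single w c) = scale c (\<phi> w)"
  by (cases "c = 0") (simp_all add: lin_ext_def)

lemma lin_ext_cong: "(\<And>w. w \<in> Poly_Mapping.keys f \<Longrightarrow> \<phi> w = \<psi> w) \<Longrightarrow> lin_ext scale \<phi> f = lin_ext scale \<psi> f"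
  by (simp add: lin_ext_def)

lemma lin_ext_fun_add: "lin_ext scale (\<lambda>w. \<phi> w + \<psi> w) f = lin_ext scale \<phi> f + lin_ext scale \<psi> f"
  by (simp add: lin_ext_def scale_right_distrib sum.distrib)

lemma lin_ext_fun_diff: "lin_ext scale (\<lambda>w. \<phi> w - \<psi> w) f = lin_ext scale \<phi> f - lin_ext scale \<psi> f"
  by (simp add: lin_ext_def scale_right_diff_distrib sum_subtractf)

lemma lin_ext_fun_scale: "lin_ext scale (\<lambda>w. scale c (\<phi> w)) f = scale c (lin_ext scale \<phi> f)"
  by (simp add: lin_ext_def scale_sum_right mult.commute)

lemma lin_ext_fun_zero: "lin_ext scale (\<lambda>w. 0) f = 0"
  by (simp add: lin_ext_def)

end

lemma linear_lin_ext:
  fixes \<phi> :: "'m \<Rightarrow> 'v::ab_group_add"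
  assumes "Vector_Spaces.linear s1 s2 h"
  shows "h (lin_ext s1 \<phi> f) = lin_ext s2 (\<lambda>w. h (\<phi> w)) f"
proof -
  have add: "h (x + y) = h x + h y" and scale: "h (s1 c x) = s2 c (h x)" for x y c
    using assms by (simp_all add: Vector_Spaces.linear_iff)
  have "h 0 = 0" using add[of 0 0] by simp
  then have "h (sum g A) = (\<Sum>a\<in>A. h (g a))" for g :: "'m \<Rightarrow> _" and A
    by (induction A rule: infinite_finite_induct) (simp_all add: add)
  then show ?thesis by (simp add: lin_ext_def scale)
qed

lemma lin_ext_id: "lin_ext (\<lambda>c f. scalar c * f) (\<lambda>w. Poly_Mapping.single w 1) f = f"
  for f :: "'m::monoid_add \<Rightarrow>\<^sub>0 'k::field"
proof -
  have "Poly_Mapping.lookup (lin_ext (\<lambda>c f. scalar c * f) (\<lambda>w. Poly_Mapping.single w 1) f) v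
      = (\<Sum>w\<in>Poly_Mapping.keys f. Poly_Mapping.lookup f w when w = v)" for v
    by (simp add: lin_ext_def lookup_sum scalar_single lookup_single)
  also have "\<dots> v = Poly_Mapping.lookup f v" for v
    by (simp add: when_def in_keys_iff)
  finally show ?thesis by (rule poly_mapping_eqI)
qed

lemma linear_eq_lin_ext:
  fixes h :: "('m::monoid_add \<Rightarrow>\<^sub>0 'k::field) \<Rightarrow> 'v::ab_group_add"
  assumes "Vector_Spaces.linear (\<lambda>c f. scalar c * f) s h"
  shows "h f = lin_ext s (\<lambda>w. h (Poly_Mapping.single w 1)) f"
  using linear_lin_ext[OF assms, of "\<lambda>w. Poly_Mapping.single w 1" f] by (simp add: lin_ext_id)

lemma (in vector_space) linear_lin_extI:
  "Vector_Spaces.linear (\<lambda>c (f :: 'm::monoid_add \<Rightarrow>\<^sub>0 'a). scalar c * f) scale (lin_ext scale \<phi>)"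
  by (simp add: Vector_Spaces.linear_iff vector_space_poly_mapping vector_space_axioms lin_ext_add lin_ext_scalar)

text \<open>Operators are made into a type so that the ring lemmas on powers and commutators apply
  to them. Type classes carry no field of scalars, hence additive maps; scalars enter as separate
  operators \<open>\<kappa> c\<close>.\<close>

typedef (overloaded) 'v endo = "{f :: 'v::ab_group_add \<Rightarrow> 'v. \<forall>x y. f (x + y) = f x + f y}"
  morphisms apply_endo Endo
  by (rule exI[of _ id]) simp

lemma apply_endo_add: "apply_endo f (x + y) = apply_endo f x + apply_endo f y"
  using apply_endo[of f] by simp

lemma apply_Endo: "(\<And>x y. f (x + y) = f x + f y) \<Longrightarrow> apply_endo (Endo f) = f"
  by (simp add: Endo_inverse)

lemma endo_eqI: "(\<And>x. apply_endo f x = apply_endo g x) \<Longrightarrow> f = g"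
  by (metis apply_endo_inject ext)

instantiation endo :: (ab_group_add) ring
begin

definition "0 = Endo (\<lambda>_. 0)"
definition "f + g = Endo (\<lambda>x. apply_endo f x + apply_endo g x)"
definition "- f = Endo (\<lambda>x. - apply_endo f x)"
definition "f - g = Endo (\<lambda>x. apply_endo f x - apply_endo g x)"
definition "f * g = Endo (\<lambda>x. apply_endo f (apply_endo g x))"

lemma apply_zero [simp]: "apply_endo 0 x = 0"
  unfolding zero_endo_def by (subst apply_Endo) auto

lemma apply_plus [simp]: "apply_endo (f + g) x = apply_endo f x + apply_endo g x"
  unfolding plus_endo_def by (subst apply_Endo) (auto simp: apply_endo_add)

lemma apply_uminus [simp]: "apply_endo (- f) x = - apply_endo f x"
  unfolding uminus_endo_def by (subst apply_Endo) (auto simp: apply_endo_add)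

lemma apply_diff [simp]: "apply_endo (f - g) x = apply_endo f x - apply_endo g x"
  unfolding minus_endo_def by (subst apply_Endo) (auto simp: apply_endo_add)

lemma apply_times [simp]: "apply_endo (f * g) x = apply_endo f (apply_endo g x)"
  unfolding times_endo_def by (subst apply_Endo) (auto simp: apply_endo_add)

instance
  by standard (auto intro!: endo_eqI simp: apply_endo_add algebra_simps)

end

text \<open>Provides \<open>0 \<noteq> 1\<close> among the endomorphisms, as \<open>ring_1\<close>
  demands.\<close>

class nontrivial_ab_group_add = ab_group_add +
  assumes nontrivial: "\<exists>x. x \<noteq> 0"

instance poly_mapping :: (type, "{ab_group_add, zero_neq_one}") nontrivial_ab_group_add
proof
  have "Poly_Mapping.single undefined 1 \<noteq> (0 :: 'a \<Rightarrow>\<^sub>0 'b)"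
    by (metis lookup_single_eq lookup_zero zero_neq_one)
  then show "\<exists>x :: 'a \<Rightarrow>\<^sub>0 'b. x \<noteq> 0" by blast
qed

instantiation endo :: (nontrivial_ab_group_add) ring_1
begin

definition "1 = Endo (\<lambda>x. x)"

lemma apply_one [simp]: "apply_endo 1 x = x"
  unfolding one_endo_def by (subst apply_Endo) auto

instance
proof
  obtain x :: 'a where "x \<noteq> 0" using nontrivial by blast
  then have "apply_endo 0 x \<noteq> apply_endo 1 x" by simp
  then show "(0 :: 'a endo) \<noteq> 1" by metis
qed (auto intro!: endo_eqI)

end

text \<open>In a ring of additive endomorphisms scalar operators are in general not central, so
  \<open>\<kappa>\<close> is required to commute with the image of \<open>\<rho>\<close>
  only.\<close>

locale lie_rep = lie_algebra scale bracket
  for scale :: "'k::field \<Rightarrow> 'g::ab_group_add \<Rightarrow> 'g" and bracket :: "'g \<Rightarrow> 'g \<Rightarrow> 'g" +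
  fixes \<kappa> :: "'k \<Rightarrow> 'r::ring_1" and \<rho> :: "'g \<Rightarrow> 'r"
  assumes \<kappa>_add: "\<kappa> (c + d) = \<kappa> c + \<kappa> d" and \<kappa>_mult: "\<kappa> (c * d) = \<kappa> c * \<kappa> d" and \<kappa>_one: "\<kappa> 1 = 1"
    and \<kappa>_central: "\<kappa> c * \<rho> x = \<rho> x * \<kappa> c"
    and \<rho>_add: "\<rho> (x + y) = \<rho> x + \<rho> y" and \<rho>_scale: "\<rho> (scale c x) = \<kappa> c * \<rho> x"
    and \<rho>_bracket: "\<rho> (bracket x y) = comm (\<rho> x) (\<rho> y)"

section \<open>The action of a Lie algebra on a polynomial ring\<close>

context lie_algebra
begin

definition vs_basis :: "'g set" where
  "vs_basis = (SOME B. independent B \<and> span B = UNIV)"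

lemma vs_basis: "independent vs_basis" "span vs_basis = UNIV"
proof -
  have "\<exists>B. independent B \<and> span B = UNIV"
    using basis_exists[of UNIV] by (metis UNIV_I subset_antisym subsetI)
  then show "independent vs_basis" "span vs_basis = UNIV"
    unfolding vs_basis_def by (metis (mono_tags, lifting) someI_ex)+
qed

definition coords :: "'g \<Rightarrow> 'g \<Rightarrow>\<^sub>0 'k" where
  "coords v = Poly_Mapping.Abs_poly_mapping (representation vs_basis v)"

lemma lookup_coords: "Poly_Mapping.lookup (coords v) = representation vs_basis v"
  unfolding coords_def by (rule lookup_Abs_poly_mapping) (rule finite_representation)

lemma coords_add: "coords (v + w) = coords v + coords w"
  by (intro poly_mapping_eqI) (simp add: lookup_coords lookup_add representation_add vs_basis)

lemma coords_scale: "coords (scale c v) = scalar c * coords v"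
  by (intro poly_mapping_eqI) (simp add: lookup_coords lookup_scalar_times representation_scale vs_basis)

lemma lin_ext_coords: "lin_ext scale (\<lambda>b. b) (coords v) = v"
proof -
  have "Poly_Mapping.keys (coords v) = {b. representation vs_basis v b \<noteq> 0}"
    by (auto simp: in_keys_iff lookup_coords)
  then show ?thesis
    using sum_nonzero_representation_eq[OF vs_basis(1), of v] vs_basis(2)
    by (simp add: lin_ext_def lookup_coords)
qed

definition letter_le :: "'g \<Rightarrow> 'g \<Rightarrow> bool" where
  "letter_le x y \<longleftrightarrow> (x, y) \<in> (SOME r. well_order_on UNIV r)"

lemma letter_le_well_order: "well_order_on UNIV {(x, y). letter_le x y}"
proof -
  have "well_order_on UNIV (SOME r. well_order_on (UNIV :: 'g set) r)"
    by (rule someI_ex) (rule well_order_on)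
  then show ?thesis by (simp add: letter_le_def)
qed

lemma letter_le_refl [simp]: "letter_le x x"
  using letter_le_well_order
  by (auto simp: well_order_on_def linear_order_on_def partial_order_on_def preorder_on_def refl_on_def)

lemma letter_le_trans: "letter_le x y \<Longrightarrow> letter_le y z \<Longrightarrow> letter_le x z"
  using letter_le_well_order
  by (auto simp: well_order_on_def linear_order_on_def partial_order_on_def preorder_on_def elim: transE)

lemma letter_le_antisym: "letter_le x y \<Longrightarrow> letter_le y x \<Longrightarrow> x = y"
  using letter_le_well_order
  by (auto simp: well_order_on_def linear_order_on_def partial_order_on_def dest: antisymD)

lemma letter_le_total: "letter_le x y \<or> letter_le y x"
  using letter_le_well_order by (cases "x = y") (auto simp: well_order_on_def linear_order_on_def total_on_def)

lemma ex_min_letter: "M \<noteq> {#} \<Longrightarrow> \<exists>c\<in>#M. \<forall>d\<in>#M. letter_le c d"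
proof (induction M)
  case empty
  then show ?case by simp
next
  case (add x M)
  show ?case
  proof (cases "M = {#}")
    case False
    then obtain c where "c \<in># M" "\<forall>d\<in>#M. letter_le c d" using add.IH by blast
    then show ?thesis
      using letter_le_total[of x c] letter_le_trans by (metis add_mset_remove_trivial insert_iff letter_le_refl set_mset_add_mset_insert)
  qed simp
qed

definition min_letter :: "'g multiset \<Rightarrow> 'g" where
  "min_letter M = (SOME c. c \<in># M \<and> (\<forall>d\<in>#M. letter_le c d))"

lemma min_letter: "M \<noteq> {#} \<Longrightarrow> min_letter M \<in># M" "M \<noteq> {#} \<Longrightarrow> d \<in># M \<Longrightarrow> letter_le (min_letter M) d"
proof -
  assume "M \<noteq> {#}"
  then have "\<exists>c. c \<in># M \<and> (\<forall>d\<in>#M. letter_le c d)" using ex_min_letter by blast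
  then have *: "min_letter M \<in># M \<and> (\<forall>d\<in>#M. letter_le (min_letter M) d)"
    unfolding min_letter_def by (rule someI_ex)
  show "min_letter M \<in># M" using * by blast
  show "d \<in># M \<Longrightarrow> letter_le (min_letter M) d" using * by blast
qed

lemma min_letter_eq: "c \<in># M \<Longrightarrow> (\<And>d. d \<in># M \<Longrightarrow> letter_le c d) \<Longrightarrow> min_letter M = c"
  using min_letter[of M] letter_le_antisym by (metis empty_iff set_mset_empty)

abbreviation mon :: "'g multiset \<Rightarrow> 'g multiset \<Rightarrow>\<^sub>0 'k" where
  "mon M \<equiv> Poly_Mapping.single M 1"

abbreviation sym_ext :: "('b \<Rightarrow> 'g multiset \<Rightarrow>\<^sub>0 'k) \<Rightarrow> ('b \<Rightarrow>\<^sub>0 'k) \<Rightarrow> 'g multiset \<Rightarrow>\<^sub>0 'k" where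
  "sym_ext \<equiv> lin_ext (\<lambda>c f. scalar c * f)"

text \<open>
  A letter \<open>x\<close> acts on the symmetric algebra by multiplication with \<open>x\<close> plus a remainder of lower order,
  which is forced by \<open>x c N = c x N + [x, c] N\<close> whenever \<open>c < x\<close> is the smallest letter of \<open>c N\<close>.
  The first argument of the remainder is fuel: it has to be at least the size of the multiset.
\<close>

primrec pbw_rem_fuel :: "nat \<Rightarrow> 'g \<Rightarrow> 'g multiset \<Rightarrow> 'g multiset \<Rightarrow>\<^sub>0 'k" where
  "pbw_rem_fuel 0 x M = 0"
| "pbw_rem_fuel (Suc n) x M =
    (if \<forall>d\<in>#M. letter_le x d then 0
     else mon {#min_letter M#} * pbw_rem_fuel n x (M - {#min_letter M#})
       + sym_ext (pbw_rem_fuel n (min_letter M)) (pbw_rem_fuel n x (M - {#min_letter M#}))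
       + sym_ext (\<lambda>b. mon (add_mset b (M - {#min_letter M#})) + pbw_rem_fuel n b (M - {#min_letter M#}))
           (coords (bracket x (min_letter M))))"

definition pbw_rem :: "'g \<Rightarrow> 'g multiset \<Rightarrow> 'g multiset \<Rightarrow>\<^sub>0 'k" where
  "pbw_rem x M = pbw_rem_fuel (size M) x M"

definition letter_act :: "'g \<Rightarrow> ('g multiset \<Rightarrow>\<^sub>0 'k) \<Rightarrow> 'g multiset \<Rightarrow>\<^sub>0 'k" where
  "letter_act x f = mon {#x#} * f + sym_ext (pbw_rem x) f"

text \<open>The letters of the polynomial ring are all vectors of \<open>g\<close>, not only those
  of the basis. The free vector space on them is a Lie algebra when brackets of letters are expanded
  in the basis, and the PBW argument is carried out for it. A vector acts through its coordinates,
  which makes the action linear in \<open>v\<close>.\<close>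

definition pbw_act :: "'g \<Rightarrow> ('g multiset \<Rightarrow>\<^sub>0 'k) \<Rightarrow> 'g multiset \<Rightarrow>\<^sub>0 'k" where
  "pbw_act v f = sym_ext (\<lambda>b. letter_act b f) (coords v)"

definition size_le :: "nat \<Rightarrow> ('g multiset \<Rightarrow>\<^sub>0 'k) \<Rightarrow> bool" where
  "size_le n f \<longleftrightarrow> (\<forall>M\<in>Poly_Mapping.keys f. size M \<le> n)"

lemma size_le_add: "size_le n f \<Longrightarrow> size_le n g \<Longrightarrow> size_le n (f + g)"
  using keys_add[of f g] by (auto simp: size_le_def)

lemma size_le_zero [simp]: "size_le n 0"
  by (simp add: size_le_def)

lemma size_le_mono: "size_le m f \<Longrightarrow> m \<le> n \<Longrightarrow> size_le n f"
  by (auto simp: size_le_def)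

lemma size_le_scalar: "size_le n f \<Longrightarrow> size_le n (scalar c * f)"
  by (auto simp: size_le_def in_keys_iff lookup_scalar_times)

lemma size_le_mon: "size M \<le> n \<Longrightarrow> size_le n (mon M)"
  by (simp add: size_le_def)

lemma size_le_sum: "(\<And>a. a \<in> A \<Longrightarrow> size_le n (h a)) \<Longrightarrow> size_le n (sum h A)"
  by (induction A rule: infinite_finite_induct) (auto intro: size_le_add)

lemma size_le_sym_ext:
  "(\<And>w. w \<in> Poly_Mapping.keys f \<Longrightarrow> size_le n (\<phi> w)) \<Longrightarrow> size_le n (sym_ext \<phi> f)"
  unfolding lin_ext_def by (intro size_le_sum size_le_scalar)

lemma size_le_times_letter: "size_le n f \<Longrightarrow> size_le (Suc n) (mon {#x#} * f)"
  using keys_mult[of "mon {#x#}" f] by (fastforce simp: size_le_def)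

lemma size_remove_min: "M \<noteq> {#} \<Longrightarrow> size (M - {#min_letter M#}) = size M - 1"
  using min_letter(1) by (simp add: size_Diff_singleton)

text \<open>The two claims need each other: the nested call acts on the monomials of a remainder,
  and only the size bound shows that the fuel suffices for them.\<close>

lemma pbw_rem_fuel_stable:
  "size M \<le> n \<Longrightarrow> pbw_rem_fuel (Suc n) x M = pbw_rem_fuel n x M \<and> size_le (size M) (pbw_rem_fuel n x M)"
proof (induction n arbitrary: x M)
  case 0
  then show ?case by simp
next
  case (Suc n)
  show ?case
  proof (cases "\<forall>d\<in>#M. letter_le x d")
    case True
    then show ?thesis by simp
  next
    case False
    then have "M \<noteq> {#}" by auto
    let ?c = "min_letter M" and ?N = "M - {#min_letter M#}"
    have N: "size ?N \<le> n" "Suc (size ?N) = size M"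
      using Suc.prems \<open>M \<noteq> {#}\<close> by (auto simp: size_remove_min) (metis Suc_pred nonempty_has_size)
    have IH: "pbw_rem_fuel (Suc n) y ?N = pbw_rem_fuel n y ?N" "size_le (size ?N) (pbw_rem_fuel n y ?N)" for y
      using Suc.IH[OF N(1)] by auto
    have keys: "size K \<le> size ?N" if "K \<in> Poly_Mapping.keys (pbw_rem_fuel n x ?N)" for K
      using IH(2)[of x] that by (auto simp: size_le_def)
    have ext: "sym_ext (pbw_rem_fuel (Suc n) ?c) (pbw_rem_fuel n x ?N) = sym_ext (pbw_rem_fuel n ?c) (pbw_rem_fuel n x ?N)"
      using keys N(1) by (intro poly_mapping.lin_ext_cong Suc.IH[THEN conjunct1]) (meson le_trans)
    have "pbw_rem_fuel (Suc (Suc n)) x M = pbw_rem_fuel (Suc n) x M"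
      using False by (simp only: pbw_rem_fuel.simps(2)[of "Suc n"] IH(1) ext) (simp only: pbw_rem_fuel.simps(2)[of n])
    moreover have "size_le (size M) (pbw_rem_fuel (Suc n) x M)"
    proof -
      have "size_le (size M) (mon {#?c#} * pbw_rem_fuel n x ?N)"
        using size_le_times_letter[OF IH(2)] N(2) by simp
      moreover have "size_le (size M) (sym_ext (pbw_rem_fuel n ?c) (pbw_rem_fuel n x ?N))"
      proof (rule size_le_sym_ext)
        fix K assume "K \<in> Poly_Mapping.keys (pbw_rem_fuel n x ?N)"
        then have "size K \<le> size ?N" by (rule keys)
        moreover from this have "size K \<le> n" using N(1) by (rule le_trans)
        ultimately show "size_le (size M) (pbw_rem_fuel n ?c K)"
          using N(2) Suc.IH[of K ?c] by (auto intro: size_le_mono)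
      qed
      moreover have "size_le (size M) (sym_ext (\<lambda>b. mon (add_mset b ?N) + pbw_rem_fuel n b ?N) (coords (bracket x ?c)))"
        using N IH(2) by (intro size_le_sym_ext size_le_add size_le_mon size_le_mono[OF IH(2)]) auto
      ultimately show ?thesis using False by (simp add: size_le_add)
    qed
    ultimately show ?thesis by blast
  qed
qed

lemma pbw_rem_fuel_eq: "size M \<le> n \<Longrightarrow> pbw_rem_fuel n x M = pbw_rem x M"
  unfolding pbw_rem_def by (induction n rule: dec_induct) (use pbw_rem_fuel_stable in auto)

lemma size_le_pbw_rem: "size_le (size M) (pbw_rem x M)"
  unfolding pbw_rem_def using pbw_rem_fuel_stable by blast

lemma letter_act_add: "letter_act x (f + g) = letter_act x f + letter_act x g"
  by (simp add: letter_act_def poly_mapping.lin_ext_add distrib_left)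

lemma letter_act_scalar: "letter_act x (scalar c * f) = scalar c * letter_act x f"
  by (simp only: letter_act_def poly_mapping.lin_ext_scalar distrib_left mult.left_commute[of "mon {#x#}"])

lemma linear_letter_act: "Vector_Spaces.linear (\<lambda>c f. scalar c * f) (\<lambda>c f. scalar c * f) (letter_act x)"
  by (simp add: Vector_Spaces.linear_iff vector_space_poly_mapping letter_act_add letter_act_scalar)

lemma letter_act_diff: "letter_act x (f - g) = letter_act x f - letter_act x g"
  using letter_act_add[of x "f - g" g] by (simp add: algebra_simps)

lemma letter_act_mon: "letter_act x (mon M) = mon (add_mset x M) + pbw_rem x M"
  by (simp add: letter_act_def mult_single poly_mapping.lin_ext_single add.commute)

lemma pbw_act_add: "pbw_act v (f + g) = pbw_act v f + pbw_act v g"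
  by (simp add: pbw_act_def letter_act_add poly_mapping.lin_ext_fun_add)

lemma pbw_act_scalar: "pbw_act v (scalar c * f) = scalar c * pbw_act v f"
  by (simp add: pbw_act_def letter_act_scalar poly_mapping.lin_ext_fun_scale)

lemma linear_pbw_act: "Vector_Spaces.linear (\<lambda>c f. scalar c * f) (\<lambda>c f. scalar c * f) (pbw_act v)"
  by (simp add: Vector_Spaces.linear_iff vector_space_poly_mapping pbw_act_add pbw_act_scalar)

lemma pbw_act_add_left: "pbw_act (v + w) f = pbw_act v f + pbw_act w f"
  by (simp add: pbw_act_def coords_add poly_mapping.lin_ext_add)

lemma pbw_act_scale_left: "pbw_act (scale c v) f = scalar c * pbw_act v f"
  by (simp add: pbw_act_def coords_scale poly_mapping.lin_ext_scalar)

lemma pbw_act_zero_left: "pbw_act 0 f = 0"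
  using pbw_act_add_left[of 0 0 f] by simp

lemma pbw_act_minus_left: "pbw_act (- v) f = - pbw_act v f"
  using pbw_act_add_left[of v "- v" f] by (simp add: pbw_act_zero_left minus_unique)

lemma linear_pbw_act_left: "Vector_Spaces.linear scale (\<lambda>c f. scalar c * f) (\<lambda>v. pbw_act v f)"
  by (simp add: Vector_Spaces.linear_iff vector_space_poly_mapping vector_space_axioms pbw_act_add_left pbw_act_scale_left)

lemma linear_bracket_right: "Vector_Spaces.linear scale scale (bracket x)"
  using bracket_bilinear by (simp add: bilinear_op_def)

lemma linear_bracket_left: "Vector_Spaces.linear scale scale (\<lambda>x. bracket x y)"
  using bracket_bilinear by (simp add: bilinear_op_def)

lemma pbw_act_lin_ext:
  assumes "Vector_Spaces.linear scale scale h"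
  shows "pbw_act (h v) f = sym_ext (\<lambda>b. pbw_act (h b) f) (coords v)"
proof -
  have "pbw_act (h v) f = pbw_act (h (lin_ext scale (\<lambda>b. b) (coords v))) f"
    by (simp only: lin_ext_coords)
  also have "\<dots> = sym_ext (\<lambda>b. pbw_act (h b) f) (coords v)"
    by (simp only: linear_lin_ext[OF assms] linear_lin_ext[OF linear_pbw_act_left])
  finally show ?thesis .
qed

lemma pbw_rem_min: "(\<And>d. d \<in># M \<Longrightarrow> letter_le x d) \<Longrightarrow> pbw_rem x M = 0"
  using pbw_rem_fuel_eq[of M "Suc (size M)" x] by simp

lemma letter_act_min: "(\<And>d. d \<in># M \<Longrightarrow> letter_le x d) \<Longrightarrow> letter_act x (mon M) = mon (add_mset x M)"
  by (simp add: letter_act_mon pbw_rem_min)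

lemma pbw_rem_step:
  assumes c: "\<And>d. d \<in># N \<Longrightarrow> letter_le c d" and x: "\<not> letter_le x c"
  shows "pbw_rem x (add_mset c N) = letter_act c (pbw_rem x N) + pbw_act (bracket x c) (mon N)"
proof -
  let ?M = "add_mset c N"
  have min: "min_letter ?M = c" by (rule min_letter_eq) (use c in auto)
  have "pbw_rem_fuel (Suc (size N)) x ?M =
      mon {#c#} * pbw_rem_fuel (size N) x N + sym_ext (pbw_rem_fuel (size N) c) (pbw_rem_fuel (size N) x N)
       + sym_ext (\<lambda>b. mon (add_mset b N) + pbw_rem_fuel (size N) b N) (coords (bracket x c))"
    using x by (simp add: min)
  moreover have "sym_ext (pbw_rem_fuel (size N) c) (pbw_rem x N) = sym_ext (pbw_rem c) (pbw_rem x N)"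
    using size_le_pbw_rem[of N x] by (intro poly_mapping.lin_ext_cong pbw_rem_fuel_eq) (auto simp: size_le_def)
  moreover have "pbw_rem_fuel (Suc (size N)) x ?M = pbw_rem x ?M"
    by (rule pbw_rem_fuel_eq) simp
  ultimately show ?thesis
    by (simp only: pbw_rem_fuel_eq[OF order_refl] pbw_act_def letter_act_mon) (simp only: letter_act_def)
qed

section \<open>Compatibility of the action with the bracket\<close>

definition pbw_rel :: "'g \<Rightarrow> 'g \<Rightarrow> ('g multiset \<Rightarrow>\<^sub>0 'k) \<Rightarrow> bool" where
  "pbw_rel x y f \<longleftrightarrow> letter_act x (letter_act y f) - letter_act y (letter_act x f) = pbw_act (bracket x y) f"

lemma pbw_rel_swap: "pbw_rel x y f \<Longrightarrow> pbw_rel y x f"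
proof -
  assume "pbw_rel x y f"
  then have "pbw_act (bracket x y) f = letter_act x (letter_act y f) - letter_act y (letter_act x f)"
    by (simp add: pbw_rel_def)
  then show "pbw_rel y x f"
    by (simp add: pbw_rel_def bracket_antisym[of y x] pbw_act_minus_left)
qed

lemma pbw_rel_add: "pbw_rel x y f \<Longrightarrow> pbw_rel x y g \<Longrightarrow> pbw_rel x y (f + g)"
  by (simp add: pbw_rel_def letter_act_add pbw_act_add algebra_simps)

lemma pbw_rel_lin:
  assumes "\<And>M. M \<in> Poly_Mapping.keys f \<Longrightarrow> pbw_rel x y (mon M)"
  shows "pbw_rel x y f"
proof -
  let ?h = "\<lambda>f. letter_act x (letter_act y f) - letter_act y (letter_act x f) - pbw_act (bracket x y) f"
  have "Vector_Spaces.linear (\<lambda>c f. scalar c * f) (\<lambda>c f. scalar c * f) ?h"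
    unfolding Vector_Spaces.linear_iff
  proof (intro conjI allI vector_space_poly_mapping)
    show "?h (f + g) = ?h f + ?h g" for f g
      by (simp add: letter_act_add pbw_act_add algebra_simps)
    show "?h (scalar c * f) = scalar c * ?h f" for c f
      by (simp only: letter_act_scalar pbw_act_scalar right_diff_distrib)
  qed
  then have "?h f = sym_ext (\<lambda>M. ?h (mon M)) f"
    by (rule linear_eq_lin_ext)
  also have "\<dots> = sym_ext (\<lambda>M. 0) f"
    using assms by (intro poly_mapping.lin_ext_cong) (auto simp: pbw_rel_def)
  finally show ?thesis by (simp add: pbw_rel_def poly_mapping.lin_ext_fun_zero)
qed

text \<open>When \<open>y\<close> is the smallest letter, the relation is just the recursion
  defining the remainder of \<open>x\<close> on \<open>y M\<close>.\<close>

lemma pbw_rel_min: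
  assumes y: "\<And>d. d \<in># M \<Longrightarrow> letter_le y d" and "letter_le y x"
  shows "pbw_rel x y (mon M)"
proof (cases "x = y")
  case True
  then show ?thesis by (simp add: pbw_rel_def bracket_alternating pbw_act_zero_left)
next
  case False
  then have "\<not> letter_le x y" using assms letter_le_antisym by blast
  then have "letter_act x (mon (add_mset y M)) =
      mon (add_mset x (add_mset y M)) + letter_act y (pbw_rem x M) + pbw_act (bracket x y) (mon M)"
    using y by (simp add: letter_act_mon pbw_rem_step add.assoc)
  moreover have "letter_act y (mon (add_mset x M)) = mon (add_mset y (add_mset x M))"
    using assms by (intro letter_act_min) auto
  ultimately show ?thesis
    using y by (simp add: pbw_rel_def letter_act_min letter_act_mon[of x M] letter_act_add add_mset_commute)
qed

lemma letter_act_pbw_act: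
  assumes "\<And>b. pbw_rel x b f"
  shows "letter_act x (pbw_act v f) = pbw_act v (letter_act x f) + pbw_act (bracket x v) f"
proof -
  have *: "letter_act x (letter_act b f) = letter_act b (letter_act x f) + pbw_act (bracket x b) f" for b
    using assms[of b] by (simp add: pbw_rel_def algebra_simps)
  have "letter_act x (pbw_act v f) = sym_ext (\<lambda>b. letter_act x (letter_act b f)) (coords v)"
    unfolding pbw_act_def by (rule linear_lin_ext[OF linear_letter_act])
  also have "\<dots> = sym_ext (\<lambda>b. letter_act b (letter_act x f) + pbw_act (bracket x b) f) (coords v)"
    by (rule poly_mapping.lin_ext_cong) (rule *)
  also have "\<dots> = pbw_act v (letter_act x f) + pbw_act (bracket x v) f"
    unfolding poly_mapping.lin_ext_fun_add pbw_act_lin_ext[OF linear_bracket_right, of x v]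
    by (simp only: pbw_act_def)
  finally show ?thesis .
qed

text \<open>Outside the case of \<open>pbw_rel_min\<close> the smallest letter \<open>c\<close> of
  \<open>M = c N\<close> is at most \<open>x\<close> and \<open>y\<close>. Both products are
  rewritten with \<open>c\<close> outermost; the induction hypothesis for \<open>N\<close> settles
  the commutator of \<open>x\<close> and \<open>y\<close>, and the leftover double brackets cancel
  by the Jacobi identity.\<close>

lemma pbw_rel_mon: "pbw_rel x y (mon M)"
proof (induction "size M" arbitrary: x y M rule: less_induct)
  case less
  show ?case
  proof (cases "(\<forall>d\<in>#M. letter_le y d) \<and> letter_le y x \<or> (\<forall>d\<in>#M. letter_le x d) \<and> letter_le x y")
    case True
    then show ?thesis using pbw_rel_min pbw_rel_swap by blast
  next
    case False
    define c where "c = min_letter M"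
    define N where "N = M - {#c#}"
    have "M \<noteq> {#}" using False letter_le_total by auto
    then have M: "M = add_mset c N" and c: "letter_le c d" if "d \<in># M" for d
      using min_letter that by (simp_all add: c_def N_def)
    have M: "M = add_mset c N" using min_letter(1)[OF \<open>M \<noteq> {#}\<close>] by (simp add: c_def N_def)
    have cN: "letter_le c d" if "d \<in># N" for d using c that M by simp
    have cx: "letter_le c x" and cy: "letter_le c y"
      using False c letter_le_total letter_le_trans by metis+
    have IH: "pbw_rel u v f" if "size_le (size N) f" for u v f
    proof (rule pbw_rel_lin)
      fix K assume "K \<in> Poly_Mapping.keys f"
      then have "size K < size M" using that by (auto simp: size_le_def M)
      then show "pbw_rel u v (mon K)" by (rule less)
    qed
    have IHN: "pbw_rel u v (mon N)" for u v by (rule IH) (simp add: size_le_mon)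
    have actc: "letter_act c (mon N) = mon M" using cN by (simp add: letter_act_min M)
    have commute: "letter_act u (letter_act c f) = letter_act c (letter_act u f) + pbw_act (bracket u c) f"
      if "pbw_rel u c f" for u f
      using that by (simp add: pbw_rel_def algebra_simps)
    have two: "letter_act u (letter_act v (mon M)) =
        letter_act c (letter_act u (letter_act v (mon N))) + pbw_act (bracket u c) (letter_act v (mon N))
        + pbw_act (bracket v c) (letter_act u (mon N)) + pbw_act (bracket u (bracket v c)) (mon N)"
      if cu: "letter_le c u" and cv: "letter_le c v" for u v
    proof -
      \<comment> \<open>The monomial \<open>v N\<close> is too large for the induction hypothesis,
        but \<open>c\<close> is smallest there too, so \<open>pbw_rel_min\<close> applies; the
        remainder has size at most that of \<open>N\<close>.\<close>
      have "pbw_rel u c (letter_act v (mon N))"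
        unfolding letter_act_mon using cu cv cN
        by (intro pbw_rel_add pbw_rel_min IH size_le_pbw_rem) auto
      then show ?thesis
        by (simp add: actc[symmetric] commute IHN letter_act_add letter_act_pbw_act add.assoc)
    qed
    have "letter_act x (letter_act y (mon M)) - letter_act y (letter_act x (mon M)) =
        letter_act c (letter_act x (letter_act y (mon N)) - letter_act y (letter_act x (mon N)))
        + (pbw_act (bracket x (bracket y c)) (mon N) - pbw_act (bracket y (bracket x c)) (mon N))"
      by (simp add: two cx cy letter_act_diff)
    also have "letter_act c (letter_act x (letter_act y (mon N)) - letter_act y (letter_act x (mon N))) =
        pbw_act (bracket x y) (mon M) + pbw_act (bracket c (bracket x y)) (mon N)"
      using IHN[of x y] by (simp add: pbw_rel_def letter_act_pbw_act[OF IHN] actc)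
    also have "\<dots> + (pbw_act (bracket x (bracket y c)) (mon N) - pbw_act (bracket y (bracket x c)) (mon N)) =
        pbw_act (bracket x y) (mon M) +
        pbw_act (bracket x (bracket y c) + bracket y (bracket c x) + bracket c (bracket x y)) (mon N)"
      using bracket_antisym[of x c]
      by (simp add: pbw_act_add_left pbw_act_minus_left bracket_minus_right)
    finally show ?thesis
      by (simp add: jacobi pbw_act_zero_left pbw_rel_def)
  qed
qed

lemma pbw_act_bracket: "pbw_act u (pbw_act v f) - pbw_act v (pbw_act u f) = pbw_act (bracket u v) f"
proof -
  have rel: "pbw_rel x y f" for x y f
    by (rule pbw_rel_lin) (rule pbw_rel_mon)
  have "pbw_act u (pbw_act v f) = sym_ext (\<lambda>b. letter_act b (pbw_act v f)) (coords u)"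
    by (simp add: pbw_act_def)
  also have "\<dots> = sym_ext (\<lambda>b. pbw_act v (letter_act b f)) (coords u) + sym_ext (\<lambda>b. pbw_act (bracket b v) f) (coords u)"
    by (simp add: letter_act_pbw_act rel poly_mapping.lin_ext_fun_add)
  also have "sym_ext (\<lambda>b. pbw_act (bracket b v) f) (coords u) = pbw_act (bracket u v) f"
    by (rule pbw_act_lin_ext[OF linear_bracket_left, symmetric])
  also have "sym_ext (\<lambda>b. pbw_act v (letter_act b f)) (coords u) = pbw_act v (pbw_act u f)"
    by (simp add: pbw_act_def[of u] linear_lin_ext[OF linear_pbw_act])
  finally show ?thesis by simp
qed

lemma pbw_act_one: "pbw_act v (mon {#}) = sym_ext (\<lambda>b. mon {#b#}) (coords v)"
proof -
  have "letter_act b (mon {#}) = mon {#b#}" for b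
    by (rule letter_act_min) simp
  then show ?thesis by (simp only: pbw_act_def)
qed

text \<open>Acting on the constant 1 yields the coordinates of \<open>v\<close> on one-letter
  monomials. Sending such a monomial to its letter, and all others to zero, recovers
  \<open>v\<close>.\<close>

lemma inj_pbw_act: "pbw_act v = pbw_act w \<Longrightarrow> v = w"
proof -
  assume "pbw_act v = pbw_act w"
  then have "lin_ext scale (\<lambda>M. if size M = 1 then (THE b. M = {#b#}) else 0) (sym_ext (\<lambda>b. mon {#b#}) (coords v)) =
      lin_ext scale (\<lambda>M. if size M = 1 then (THE b. M = {#b#}) else 0) (sym_ext (\<lambda>b. mon {#b#}) (coords w))"
    by (metis pbw_act_one)
  then show ?thesis
    by (simp add: linear_lin_ext[OF linear_lin_extI] lin_ext_single lin_ext_coords)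
qed

text \<open>A weak form of the Poincare-Birkhoff-Witt theorem.\<close>

theorem ex_faithful_rep:
  "\<exists>(\<kappa> :: 'k \<Rightarrow> ('g multiset \<Rightarrow>\<^sub>0 'k) endo) \<rho>. lie_rep scale bracket \<kappa> \<rho> \<and> inj \<rho>"
proof (intro exI conjI)
  define \<kappa> :: "'k \<Rightarrow> ('g multiset \<Rightarrow>\<^sub>0 'k) endo" where "\<kappa> c = Endo (\<lambda>f. scalar c * f)" for c
  define \<rho> where "\<rho> v = Endo (pbw_act v)" for v
  have \<kappa>: "apply_endo (\<kappa> c) f = scalar c * f" for c f
    unfolding \<kappa>_def by (subst apply_Endo) (simp_all add: distrib_left)
  have \<rho>: "apply_endo (\<rho> v) = pbw_act v" for v
    unfolding \<rho>_def by (rule apply_Endo) (simp add: pbw_act_add)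
  show "lie_rep scale bracket \<kappa> \<rho>"
  proof unfold_locales
    show "\<kappa> (c + d) = \<kappa> c + \<kappa> d" for c d
      by (rule endo_eqI) (simp only: \<kappa> apply_plus poly_mapping.scale_left_distrib)
    show "\<kappa> (c * d) = \<kappa> c * \<kappa> d" for c d
      by (rule endo_eqI) (simp only: \<kappa> apply_times poly_mapping.scale_scale)
    show "\<kappa> 1 = 1"
      by (rule endo_eqI) (simp only: \<kappa> apply_one poly_mapping.scale_one)
  qed (auto intro!: endo_eqI simp: \<kappa> \<rho> pbw_act_scalar pbw_act_add_left pbw_act_scale_left comm_def pbw_act_bracket)
  show "inj \<rho>"
    by (intro injI inj_pbw_act) (metis \<rho>)
qed

end

section \<open>The twisted p-map in the semidirect product\<close>

lemma comm_jacobi: "comm a (comm b c) = comm (comm a b) c + comm b (comm a c)"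
  by (simp add: comm_def algebra_simps)

lemma comm_funpow_hom:
  assumes "\<And>z. comm (f x) (f z) = f (b x z)"
  shows "(comm (f x) ^^ n) (f y) = f ((b x ^^ n) y)"
  by (induction n) (simp_all add: assms)

context lie_rep
begin

lemma \<kappa>_of_nat: "\<kappa> (of_nat n) = of_nat n"
proof -
  have "\<kappa> 0 = 0" using \<kappa>_add[of 0 0] by simp
  then show ?thesis by (induction n) (simp_all add: \<kappa>_add \<kappa>_one)
qed

lemma \<rho>_zero: "\<rho> 0 = 0"
  using \<rho>_add[of 0 0] by simp

lemma \<rho>_minus: "\<rho> (- x) = - \<rho> x"
  using \<rho>_add[of x "- x"] by (simp add: \<rho>_zero minus_unique)

lemma \<rho>_diff: "\<rho> (x - y) = \<rho> x - \<rho> y"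
  using \<rho>_add[of x "- y"] by (simp add: \<rho>_minus)

lemma \<rho>_sum: "\<rho> (sum f A) = (\<Sum>a\<in>A. \<rho> (f a))"
  by (induction A rule: infinite_finite_induct) (simp_all add: \<rho>_zero \<rho>_add)

lemma \<rho>_jac_coeff: "\<rho> (jac_coeff bracket x y n i) = jac_coeff comm (\<rho> x) (\<rho> y) n i"
  by (induction n arbitrary: i) (simp_all add: \<rho>_zero \<rho>_add \<rho>_bracket)

lemma char_p_ring:
  assumes "CHAR('k) = p" "prime p"
  shows "char_p_ring TYPE('r) p"
proof
  show "(of_nat p :: 'r) = 0"
    using \<kappa>_of_nat[of p] \<kappa>_of_nat[of 0] of_nat_CHAR[where 'a = 'k] assms(1) by simp
qed (fact assms(2))

text \<open>Jacobson's coefficients are iterated commutators, hence images of elements of the Lie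
  algebra; the division by \<open>i\<close> takes place in \<open>k\<close> and enters the ring
  through \<open>\<kappa>\<close>.\<close>

lemma power_add:
  assumes p: "CHAR('k) = p" "prime p"
  shows "(\<rho> x + \<rho> y) ^ p = \<rho> x ^ p + \<rho> y ^ p + \<rho> (jac_sum scale bracket p x y)"
proof -
  interpret R: char_p_ring p "TYPE('r)" by (rule char_p_ring[OF p])
  let ?e = "\<lambda>i. fps_nth ((fps_X * fps_const (\<rho> x) + fps_const (\<rho> y)) ^ p) i"
  have "\<rho> (scale (1 / of_nat i) (jac_coeff bracket x y (p - 1) (i - 1))) = ?e i" if i: "i \<in> {1..p - 1}" for i
  proof -
    from i have Suc: "Suc (i - 1) = i" by simp
    have "(of_nat i :: 'k) \<noteq> 0"
      using i by (intro of_nat_neq_0_below_char[OF p(1)]) auto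
    then have "\<kappa> (1 / of_nat i) * of_nat i = 1"
      by (simp add: \<kappa>_one flip: \<kappa>_of_nat \<kappa>_mult)
    moreover have "\<rho> (jac_coeff bracket x y (p - 1) (i - 1)) = of_nat i * ?e i"
      using R.of_nat_mult_pencil_coeff[of "i - 1" "\<rho> x" "\<rho> y"] by (simp only: \<rho>_jac_coeff Suc)
    ultimately show ?thesis by (simp add: \<rho>_scale mult.assoc[symmetric])
  qed
  then show ?thesis
    by (simp add: R.power_add_eq_sum jac_sum_def \<rho>_sum)
qed

end

section \<open>The semidirect product\<close>

definition semidirect_scale :: "('k \<Rightarrow> 'g \<Rightarrow> 'g) \<Rightarrow> 'k \<Rightarrow> 'g \<times> 'g \<Rightarrow> 'g \<times> 'g" where
  "semidirect_scale scale c u = (scale c (fst u), scale c (snd u))"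

text \<open>The semidirect product of \<open>(g, [-,-])\<close> with the sub-adjacent Lie algebra, acting by \<open>tri\<close>.\<close>

definition semidirect_bracket ::
  "('g \<Rightarrow> 'g \<Rightarrow> 'g) \<Rightarrow> ('g \<Rightarrow> 'g \<Rightarrow> 'g) \<Rightarrow> 'g \<times> 'g \<Rightarrow> 'g \<times> 'g \<Rightarrow> 'g::ab_group_add \<times> 'g" where
  "semidirect_bracket bracket tri u v =
     (bracket (fst u) (fst v) + tri (snd u) (fst v) - tri (snd v) (fst u),
      sub_adjacent bracket tri (snd u) (snd v))"

context post_lie_algebra
begin

abbreviation sbr :: "'g \<Rightarrow> 'g \<Rightarrow> 'g" where
  "sbr \<equiv> sub_adjacent bracket tri"

text \<open>A rearrangement of the second post-Lie axiom. With \<open>tri_bracket\<close> it says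
  that the sub-adjacent Lie algebra acts on \<open>(g, [-,-])\<close> by derivations, which is what
  a semidirect product requires.\<close>

lemma tri_sbr: "tri (sbr x y) z = tri x (tri y z) - tri y (tri x z)"
  using bracket_tri[of x y z]
  by (simp add: sub_adjacent_def tri_add_left tri_diff_left assoc_tri_def algebra_simps)

lemma lie_algebra_sbr: "lie_algebra scale sbr"
proof
  show "bilinear_op scale sbr"
    by (simp add: bilinear_op_def Vector_Spaces.linear_iff vector_space_axioms sub_adjacent_def
        bracket_add_left bracket_add_right bracket_scale_left bracket_scale_right
        tri_add_left tri_add_right tri_scale_left tri_scale_right scale_right_distrib scale_right_diff_distrib)
  show "sbr x x = 0" for x
    by (simp add: sub_adjacent_def bracket_alternating)
  have expand: "sbr x (sbr y z) =
      bracket x (bracket y z) + bracket x (tri y z) - bracket x (tri z y)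
      + (bracket (tri x y) z + bracket y (tri x z)) + tri x (tri y z) - tri x (tri z y)
      - tri y (tri z x) + tri z (tri y x)" for x y z
    by (subst sub_adjacent_def, subst tri_sbr)
      (simp add: sub_adjacent_def bracket_add_right bracket_diff_right tri_add_right tri_diff_right tri_bracket)
  show "sbr x (sbr y z) + sbr y (sbr z x) + sbr z (sbr x y) = 0" for x y z
    unfolding expand
    using jacobi[of x y z] bracket_antisym[of "tri x y" z] bracket_antisym[of "tri y z" x] bracket_antisym[of "tri z x" y]
    by (simp add: algebra_simps)
qed

lemma lie_algebra_semidirect: "lie_algebra (semidirect_scale scale) (semidirect_bracket bracket tri)"
proof -
  interpret S: lie_algebra scale sbr by (rule lie_algebra_sbr)
  have vs: "vector_space (semidirect_scale scale)"
    by unfold_locales (simp_all add: semidirect_scale_def scale_right_distrib scale_left_distrib)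
  interpret V: vector_space "semidirect_scale scale" by (rule vs)
  show ?thesis
  proof
    show "bilinear_op (semidirect_scale scale) (semidirect_bracket bracket tri)"
      by (simp add: bilinear_op_def Vector_Spaces.linear_iff vs semidirect_scale_def semidirect_bracket_def
          bracket_add_left bracket_add_right bracket_scale_left bracket_scale_right
          S.bracket_add_left S.bracket_add_right S.bracket_scale_left S.bracket_scale_right
          tri_add_left tri_add_right tri_scale_left tri_scale_right scale_right_distrib scale_right_diff_distrib)
    show "semidirect_bracket bracket tri u u = 0" for u
      by (simp add: semidirect_bracket_def bracket_alternating S.bracket_alternating zero_prod_def)
    show "semidirect_bracket bracket tri u (semidirect_bracket bracket tri v w) +
        semidirect_bracket bracket tri v (semidirect_bracket bracket tri w u) +
        semidirect_bracket bracket tri w (semidirect_bracket bracket tri u v) = 0" for u v w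
    proof -
      obtain a x b y c z where u: "u = (a, x)" and v: "v = (b, y)" and w: "w = (c, z)"
        by (cases u, cases v, cases w) blast
      have fst: "fst (semidirect_bracket bracket tri (a, x) (semidirect_bracket bracket tri (b, y) (c, z))) =
          bracket a (bracket b c) + bracket a (tri y c) - bracket a (tri z b)
          + (bracket (tri x b) c + bracket b (tri x c)) + tri x (tri y c) - tri x (tri z b)
          - tri y (tri z a) + tri z (tri y a)" for a x b y c z
        by (simp add: semidirect_bracket_def tri_sbr bracket_add_right bracket_diff_right tri_add_right
            tri_diff_right tri_bracket)
      show ?thesis
        unfolding u v w
      proof (rule prod_eqI)
        show "fst (semidirect_bracket bracket tri (a, x) (semidirect_bracket bracket tri (b, y) (c, z)) +
          semidirect_bracket bracket tri (b, y) (semidirect_bracket bracket tri (c, z) (a, x)) +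
          semidirect_bracket bracket tri (c, z) (semidirect_bracket bracket tri (a, x) (b, y))) = fst 0"
          unfolding fst_add fst
          using jacobi[of a b c] bracket_antisym[of "tri x b" c] bracket_antisym[of "tri y c" a] bracket_antisym[of "tri z a" b]
          by (simp add: algebra_simps)
      qed (simp add: semidirect_bracket_def S.jacobi)
    qed
  qed
qed

text \<open>On the first factor \<open>(x, 0)\<close> acts by bracketing with \<open>x\<close> and
  \<open>(0, x)\<close> by \<open>tri x\<close>, so both sides obey the same recursion.\<close>

lemma jac_coeff_semidirect:
  assumes "CHAR('k) = p" "Suc n \<le> p"
  shows "jac_coeff (semidirect_bracket bracket tri) (x, 0) (0, x) n i = (composition_coeff x n i, 0)"
  using assms(2)
proof (induction n arbitrary: i)
  case 0
  then show ?case by (simp add: composition_coeff_0 zero_prod_def)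
next
  case (Suc n)
  have "sbr 0 v = 0" "sbr v 0 = 0" for v
    by (simp_all add: sub_adjacent_def)
  then show ?case
    using Suc by (simp add: composition_coeff_Suc[OF assms(1)] semidirect_bracket_def zero_prod_def)
qed

end

text \<open>\<open>tri_pmap_right\<close> is the part of the restricted derivation hypothesis that
  concerns the p-map; the Leibniz rule is already \<open>tri_bracket\<close>.\<close>

locale restricted_post_lie = post_lie_algebra scale bracket tri + restricted_lie_algebra scale bracket p pmap
  for scale :: "'k::field \<Rightarrow> 'g::ab_group_add \<Rightarrow> 'g" and bracket tri :: "'g \<Rightarrow> 'g \<Rightarrow> 'g"
    and p :: nat and pmap :: "'g \<Rightarrow> 'g" +
  assumes CHAR_eq: "CHAR('k) = p" and prime_p: "prime p"
    and tri_pmap_right: "tri y (pmap x) = (bracket x ^^ (p - 1)) (tri y x)"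
begin

abbreviation q :: "'g \<Rightarrow> 'g" where
  "q \<equiv> tri_pmap scale bracket tri p pmap"

definition tri_defect :: "'g \<Rightarrow> 'g \<Rightarrow> 'g" where
  "tri_defect x y = (tri x ^^ p) y - tri (q x) y"

lemma p_ge_2: "2 \<le> p"
  by (rule prime_ge_2_nat[OF prime_p])

lemma jac_sum_semidirect:
  "jac_sum (semidirect_scale scale) (semidirect_bracket bracket tri) p (x, 0) (0, x) = (q x - pmap x, 0)"
proof -
  have "jac_sum (semidirect_scale scale) (semidirect_bracket bracket tri) p (x, 0) (0, x) =
      (\<Sum>i = 1..p - 1. (scale (1 / of_nat i) (composition_coeff x (p - 1) (i - 1)), 0))"
    using p_ge_2 by (simp add: jac_sum_def jac_coeff_semidirect[OF CHAR_eq] semidirect_scale_def)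
  also have "\<dots> = (\<Sum>i = 1..p - 1. scale (1 / of_nat i) (composition_coeff x (p - 1) (i - 1)), 0)"
    by (rule prod_eqI) (simp_all add: fst_sum snd_sum)
  finally show ?thesis
    using p_ge_2 by (simp add: tri_pmap_eq)
qed

end

section \<open>Comparison of p-th powers in a faithful representation\<close>

locale restricted_post_lie_rep = restricted_post_lie scale bracket tri p pmap +
  H: lie_rep "semidirect_scale scale" "semidirect_bracket bracket tri" \<kappa> \<rho>
  for scale :: "'k::field \<Rightarrow> 'g::ab_group_add \<Rightarrow> 'g" and bracket tri :: "'g \<Rightarrow> 'g \<Rightarrow> 'g"
    and p :: nat and pmap :: "'g \<Rightarrow> 'g" and \<kappa> :: "'k \<Rightarrow> 'r::ring_1" and \<rho> :: "'g \<times> 'g \<Rightarrow> 'r" +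
  assumes inj_\<rho>: "inj \<rho>"
begin

definition l :: "'g \<Rightarrow> 'r" where "l a = \<rho> (a, 0)"
definition d :: "'g \<Rightarrow> 'r" where "d x = \<rho> (0, x)"
definition r :: "'g \<Rightarrow> 'r" where "r x = \<rho> (x, x)"

lemma r_eq: "r x = l x + d x"
  by (simp add: r_def l_def d_def flip: H.\<rho>_add)

lemma sbr_zero [simp]: "sbr 0 v = 0" "sbr v 0 = 0"
  by (simp_all add: sub_adjacent_def)

lemma lie_rep_l: "lie_rep scale bracket \<kappa> l"
  by unfold_locales
    (simp_all add: H.\<kappa>_add H.\<kappa>_mult H.\<kappa>_one l_def semidirect_scale_def semidirect_bracket_def
      flip: H.\<kappa>_central H.\<rho>_add H.\<rho>_scale H.\<rho>_bracket)

lemma lie_rep_d: "lie_rep scale sbr \<kappa> d"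
proof -
  interpret S: lie_algebra scale sbr by (rule lie_algebra_sbr)
  show ?thesis
    by unfold_locales
      (simp_all add: H.\<kappa>_add H.\<kappa>_mult H.\<kappa>_one d_def semidirect_scale_def semidirect_bracket_def
        flip: H.\<kappa>_central H.\<rho>_add H.\<rho>_scale H.\<rho>_bracket)
qed

lemma lie_rep_r: "lie_rep scale sbr \<kappa> r"
proof -
  interpret S: lie_algebra scale sbr by (rule lie_algebra_sbr)
  show ?thesis
    by unfold_locales
      (simp_all add: H.\<kappa>_add H.\<kappa>_mult H.\<kappa>_one r_def semidirect_scale_def semidirect_bracket_def
        sub_adjacent_def flip: H.\<kappa>_central H.\<rho>_add H.\<rho>_scale H.\<rho>_bracket)
qed

sublocale L: lie_rep scale bracket \<kappa> l by (rule lie_rep_l)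
sublocale D: lie_rep scale sbr \<kappa> d by (rule lie_rep_d)
sublocale R: lie_rep scale sbr \<kappa> r by (rule lie_rep_r)
sublocale char_p_ring p "TYPE('r)" by (rule L.char_p_ring[OF CHAR_eq prime_p])

lemma comm_d_l: "comm (d x) (l a) = l (tri x a)"
  by (simp add: d_def l_def semidirect_bracket_def flip: H.\<rho>_bracket)

lemma l_plus_d_eqD: "l a + d x = l b + d y \<Longrightarrow> a = b"
  using inj_\<rho> by (auto simp: l_def d_def simp flip: H.\<rho>_add dest: injD)

lemma l_eqD: "l a = l b \<Longrightarrow> a = b"
  using l_plus_d_eqD[of a 0 b 0] by simp

definition p_defect :: "'g \<Rightarrow> 'r" where
  "p_defect x = l x ^ p - l (pmap x)"

lemma r_power: "r x ^ p = p_defect x + d x ^ p + l (q x)"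
  using H.power_add[OF CHAR_eq prime_p, of "(x, 0)" "(0, x)"]
  by (simp add: jac_sum_semidirect p_defect_def r_eq l_def[symmetric] d_def[symmetric] L.\<rho>_diff)

lemma comm_p_defect_l: "comm (p_defect x) (l a) = 0"
proof -
  have "comm (l x ^ p) (l a) = l ((bracket x ^^ p) a)"
    by (simp add: comm_power comm_funpow_hom[where f = l] L.\<rho>_bracket)
  then show ?thesis
    by (simp add: p_defect_def comm_diff_left pmap_ad L.\<rho>_bracket[symmetric])
qed

lemma comm_d_p_defect: "comm (d y) (p_defect x) = 0"
proof -
  have "comm (d y) (l x ^ p) = l ((bracket x ^^ (p - 1)) (tri y x))"
    by (simp add: comm_power_right comm_d_l comm_funpow_hom[where f = l and b = bracket] L.\<rho>_bracket)
  then show ?thesis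
    by (simp add: p_defect_def comm_diff_right comm_d_l tri_pmap_right)
qed

lemma comm_d_power_l: "comm (d x ^ p) (l a) = l ((tri x ^^ p) a)"
proof -
  have "(comm (d x) ^^ n) (l a) = l ((tri x ^^ n) a)" for n
    by (induction n) (simp_all add: comm_d_l)
  then show ?thesis by (simp add: comm_power)
qed

lemma comm_d_power_d: "comm (d x ^ p) (d a) = d ((sbr x ^^ p) a)"
  by (simp add: comm_power comm_funpow_hom[where f = d] D.\<rho>_bracket)

text \<open>\<open>comm (r x ^ p) (r a)\<close> is computed twice, by iterating \<open>sbr\<close>
  and from \<open>r_power\<close>, and the components under \<open>l\<close> are compared. Thus
  \<open>D(x)\<close> measures how far \<open>q\<close> is from satisfying the \<open>ad\<close>
  axiom of a p-map on the sub-adjacent Lie algebra.\<close>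

lemma sbr_funpow: "(sbr x ^^ p) a = tri_defect x a + sbr (q x) a"
proof -
  have "comm (p_defect x) (d a) = 0"
    by (subst comm_swap) (simp add: comm_d_p_defect)
  moreover have "comm (l (q x)) (d a) = - l (tri a (q x))"
    by (subst comm_swap) (simp add: comm_d_l)
  ultimately have "comm (r x ^ p) (r a) =
      l ((tri x ^^ p) a) + d ((sbr x ^^ p) a) + l (bracket (q x) a) - l (tri a (q x))"
    unfolding r_eq[of a] r_power
    by (simp add: comm_add_left comm_add_right comm_p_defect_l comm_d_power_l comm_d_power_d L.\<rho>_bracket)
  moreover have "comm (r x ^ p) (r a) = r ((sbr x ^^ p) a)"
    by (simp add: comm_power comm_funpow_hom[where f = r] R.\<rho>_bracket)
  ultimately have "l ((sbr x ^^ p) a) + d ((sbr x ^^ p) a) =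
      l ((tri x ^^ p) a + bracket (q x) a - tri a (q x)) + d ((sbr x ^^ p) a)"
    by (simp add: r_eq L.\<rho>_add L.\<rho>_diff)
  then have "(sbr x ^^ p) a = (tri x ^^ p) a + bracket (q x) a - tri a (q x)"
    by (rule l_plus_d_eqD)
  then show ?thesis by (simp add: tri_defect_def sub_adjacent_def)
qed

lemma q_add: "q (x + y) = q x + q y + jac_sum scale sbr p x y"
proof -
  let ?J = "jac_sum scale sbr p x y"
  \<comment> \<open>\<open>l x ^ p\<close> and \<open>l (pmap x)\<close> acquire the same Jacobson
    sum for the original bracket, which cancels.\<close>
  have "p_defect (x + y) = p_defect x + p_defect y"
    using L.power_add[OF CHAR_eq prime_p, of x y]
    by (simp add: p_defect_def pmap_add_jac_sum[OF CHAR_eq p_ge_2] L.\<rho>_add)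
  moreover have "d (x + y) ^ p = d x ^ p + d y ^ p + d ?J"
    using D.power_add[OF CHAR_eq prime_p, of x y] by (simp add: D.\<rho>_add)
  moreover have "r (x + y) ^ p = r x ^ p + r y ^ p + l ?J + d ?J"
    using R.power_add[OF CHAR_eq prime_p, of x y] by (simp add: R.\<rho>_add r_eq[of ?J] add.assoc)
  ultimately have "l (q (x + y)) = l (q x) + l (q y) + l ?J"
    by (simp add: r_power)
  then show ?thesis
    by (intro l_eqD) (simp add: L.\<rho>_add)
qed

text \<open>An element whose commutators realise \<open>D(x)\<close> on \<open>l\<close>,
  \<open>d\<close> and \<open>r\<close> at once, so that properties of \<open>D(x)\<close> become
  identities between commutators.\<close>

definition e :: "'g \<Rightarrow> 'r" where
  "e x = d x ^ p - d (q x)"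

lemma comm_e_l: "comm (e x) (l b) = l (tri_defect x b)"
  by (simp add: e_def comm_diff_left comm_d_power_l comm_d_l tri_defect_def L.\<rho>_diff)

lemma comm_e_d: "comm (e x) (d b) = d (tri_defect x b)"
  by (simp add: e_def comm_diff_left comm_d_power_d sbr_funpow D.\<rho>_add flip: D.\<rho>_bracket)

lemma comm_e_r: "comm (e x) (r b) = r (tri_defect x b)"
  by (simp add: r_eq comm_add_right comm_e_l comm_e_d)

text \<open>\<open>tri\<close> is itself a commutator of \<open>d\<close> with \<open>l\<close>, and
  commutation with \<open>e x\<close> is a derivation.\<close>

lemma tri_defect_tri: "tri_defect x (tri a b) = tri (tri_defect x a) b + tri a (tri_defect x b)"
proof (rule l_eqD)
  have "l (tri_defect x (tri a b)) = comm (e x) (comm (d a) (l b))"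
    by (simp add: comm_d_l comm_e_l)
  also have "\<dots> = comm (comm (e x) (d a)) (l b) + comm (d a) (comm (e x) (l b))"
    by (rule comm_jacobi)
  finally show "l (tri_defect x (tri a b)) = l (tri (tri_defect x a) b + tri a (tri_defect x b))"
    by (simp add: comm_e_d comm_e_l comm_d_l L.\<rho>_add)
qed

lemma comm_e_d_power: "comm (e x) (d y ^ p) = d ((sbr y ^^ (p - 1)) (tri_defect x y))"
  by (simp add: comm_power_right comm_e_d comm_funpow_hom[where f = d and b = sbr] D.\<rho>_bracket)

text \<open>Commutation with \<open>e x\<close> is applied to \<open>r_power\<close> for
  \<open>y\<close>. It kills \<open>p_defect y\<close> and sends \<open>r y ^ p\<close> and
  \<open>d y ^ p\<close> to the images under \<open>r\<close> and \<open>d\<close> of one element of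
  \<open>g\<close>; the difference of these images has to come from \<open>l (q y)\<close>.\<close>

lemma tri_defect_q: "tri_defect x (q y) = (sbr y ^^ (p - 1)) (tri_defect x y)"
proof -
  have "(comm (d x) ^^ n) (p_defect y) = 0" if "0 < n" for n
  proof -
    have "(comm (d x) ^^ m) 0 = 0" for m by (induction m) simp_all
    then show ?thesis
      using that by (cases n) (simp_all add: comm_d_p_defect funpow_Suc_right del: funpow.simps(2))
  qed
  then have e_p: "comm (e x) (p_defect y) = 0"
    using p_pos by (simp add: e_def comm_diff_left comm_power comm_d_p_defect)
  let ?s = "(sbr y ^^ (p - 1)) (tri_defect x y)"
  have "comm (e x) (r y ^ p) = r ?s"
    by (simp add: comm_power_right comm_e_r comm_funpow_hom[where f = r and b = sbr] R.\<rho>_bracket)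
  then have "l ?s = l (tri_defect x (q y))"
    by (simp add: r_power comm_add_right e_p comm_e_l comm_e_d_power) (simp add: r_eq)
  then show ?thesis by (rule l_eqD[symmetric])
qed

text \<open>By \<open>tri_defect_q\<close> the two terms of \<open>e y\<close> have the same
  commutator with \<open>e x\<close>, so \<open>e x\<close> and \<open>e y\<close> commute.\<close>

lemma tri_defect_commute: "tri_defect x (tri_defect y b) = tri_defect y (tri_defect x b)"
proof (rule l_eqD)
  have "comm (e x) (e y) = 0"
    by (simp add: e_def[of y] comm_diff_right comm_e_d comm_e_d_power tri_defect_q)
  then have "comm (e x) (comm (e y) (l b)) = comm (e y) (comm (e x) (l b))"
    by (subst comm_jacobi) (simp add: comm_def)
  then show "l (tri_defect x (tri_defect y b)) = l (tri_defect y (tri_defect x b))"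
    by (simp add: comm_e_l)
qed

end

context restricted_post_lie
begin

lemma ex_rep:
  obtains \<kappa> :: "'k \<Rightarrow> (('g \<times> 'g) multiset \<Rightarrow>\<^sub>0 'k) endo" and \<rho>
  where "restricted_post_lie_rep scale bracket tri p pmap \<kappa> \<rho>"
proof -
  interpret H: lie_algebra "semidirect_scale scale" "semidirect_bracket bracket tri"
    by (rule lie_algebra_semidirect)
  obtain \<kappa> :: "'k \<Rightarrow> (('g \<times> 'g) multiset \<Rightarrow>\<^sub>0 'k) endo" and \<rho>
    where \<rho>: "lie_rep (semidirect_scale scale) (semidirect_bracket bracket tri) \<kappa> \<rho>" "inj \<rho>"
    using H.ex_faithful_rep by blast
  interpret lie_rep "semidirect_scale scale" "semidirect_bracket bracket tri" \<kappa> \<rho> by (rule \<rho>)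
  have "restricted_post_lie_rep scale bracket tri p pmap \<kappa> \<rho>"
    by unfold_locales (rule \<rho>(2))
  then show ?thesis by (rule that)
qed

lemma tri_pmap_add: "q (x + y) = q x + q y + jac_sum scale sbr p x y"
proof -
  obtain \<kappa> :: "'k \<Rightarrow> (('g \<times> 'g) multiset \<Rightarrow>\<^sub>0 'k) endo" and \<rho>
    where "restricted_post_lie_rep scale bracket tri p pmap \<kappa> \<rho>" by (rule ex_rep)
  then show ?thesis by (rule restricted_post_lie_rep.q_add)
qed

lemma tri_defect_tri: "tri_defect x (tri a b) = tri (tri_defect x a) b + tri a (tri_defect x b)"
proof -
  obtain \<kappa> :: "'k \<Rightarrow> (('g \<times> 'g) multiset \<Rightarrow>\<^sub>0 'k) endo" and \<rho>
    where "restricted_post_lie_rep scale bracket tri p pmap \<kappa> \<rho>" by (rule ex_rep)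
  then show ?thesis by (rule restricted_post_lie_rep.tri_defect_tri)
qed

lemma tri_defect_commute: "tri_defect x (tri_defect y b) = tri_defect y (tri_defect x b)"
proof -
  obtain \<kappa> :: "'k \<Rightarrow> (('g \<times> 'g) multiset \<Rightarrow>\<^sub>0 'k) endo" and \<rho>
    where "restricted_post_lie_rep scale bracket tri p pmap \<kappa> \<rho>" by (rule ex_rep)
  then show ?thesis by (rule restricted_post_lie_rep.tri_defect_commute)
qed

lemma funpow_tri_add: "(tri x ^^ n) (y + z) = (tri x ^^ n) y + (tri x ^^ n) z"
  by (induction n) (simp_all add: tri_add_right)

lemma funpow_tri_scale: "(tri x ^^ n) (scale c y) = scale c ((tri x ^^ n) y)"
  by (induction n) (simp_all add: tri_scale_right)

lemma linear_tri_defect: "Vector_Spaces.linear scale scale (tri_defect x)"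
  by (simp add: Vector_Spaces.linear_iff vector_space_axioms tri_defect_def funpow_tri_add funpow_tri_scale
      tri_add_right tri_scale_right scale_right_diff_distrib)

end

section \<open>The enveloping algebra\<close>

lemma poly_mapping_linear_induct [case_names zero add scalar single]:
  fixes f :: "'m::monoid_add \<Rightarrow>\<^sub>0 'k::field"
  assumes zero: "P 0" and add: "\<And>f g. P f \<Longrightarrow> P g \<Longrightarrow> P (f + g)"
    and scalar: "\<And>c f. P f \<Longrightarrow> P (scalar c * f)" and single: "\<And>w. P (Poly_Mapping.single w 1)"
  shows "P f"
proof -
  have "P (\<Sum>w\<in>S. scalar (Poly_Mapping.lookup f w) * Poly_Mapping.single w 1)" for S
    by (induction S rule: infinite_finite_induct) (auto intro: zero add scalar single)
  from this[of "Poly_Mapping.keys f"] show ?thesis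
    by (simp only: lin_ext_id[of f, unfolded lin_ext_def])
qed

lemma scalar_mult_left_commute: "f * (scalar c * g) = scalar c * (f * g)"
  for f g :: "'m::monoid_add \<Rightarrow>\<^sub>0 'k::field"
  by (simp only: mult.assoc[symmetric] scalar_commute[of f])

lemma free_one: "(1 :: ('g, 'k::field) free_alg) = Poly_Mapping.single [] 1"
  using single_one[where 'a = "'g list" and 'b = 'k] by (simp add: zero_list_def)

lemma free_mult_single:
  "Poly_Mapping.single u 1 * Poly_Mapping.single v 1 = (Poly_Mapping.single (u @ v) 1 :: ('g, 'k::field) free_alg)"
  by (simp add: mult_single plus_list_def)

lemma gen_mult_single: "gen x * Poly_Mapping.single w 1 = (Poly_Mapping.single (x # w) 1 :: ('g, 'k::field) free_alg)"
  by (simp add: gen_def free_mult_single)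

lemma single_mult_gen: "Poly_Mapping.single w 1 * gen x = (Poly_Mapping.single (w @ [x]) 1 :: ('g, 'k::field) free_alg)"
  by (simp add: gen_def free_mult_single)

lemma (in vector_space) lin_ext_gen_mult:
  "lin_ext scale \<phi> (gen x * f) = lin_ext scale (\<lambda>w. \<phi> (x # w)) f"
  by (induction f rule: poly_mapping_linear_induct)
    (simp_all add: distrib_left lin_ext_add scalar_mult_left_commute lin_ext_scalar gen_mult_single lin_ext_single)

lemma (in vector_space) lin_ext_mult_gen:
  "lin_ext scale \<phi> (f * gen x) = lin_ext scale (\<lambda>w. \<phi> (w @ [x])) f"
  by (induction f rule: poly_mapping_linear_induct)
    (simp_all add: distrib_right lin_ext_add mult.assoc lin_ext_scalar single_mult_gen lin_ext_single)

lemma (in vector_space) lin_ext_gen: "lin_ext scale \<phi> (gen x) = \<phi> [x]"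
  by (simp add: gen_def lin_ext_single)

text \<open>Unshuffles: each letter goes to the left or to the right factor, as in the expansion of
  \<open>\<Prod> (x \<otimes> 1 + 1 \<otimes> x)\<close>.\<close>

fun splits :: "'a list \<Rightarrow> ('a list \<times> 'a list) list" where
  "splits [] = [([], [])]"
| "splits (x # w) = map (\<lambda>(u, v). (x # u, v)) (splits w) @ map (\<lambda>(u, v). (u, x # v)) (splits w)"

text \<open>The Sweedler sum of a word, with a function on pairs of words in place of a bilinear
  map.\<close>

definition coprod_sum :: "('a list \<times> 'a list \<Rightarrow> 'v::comm_monoid_add) \<Rightarrow> 'a list \<Rightarrow> 'v" where
  "coprod_sum \<beta> w = sum_list (map \<beta> (splits w))"

lemma coprod_sum_Nil [simp]: "coprod_sum \<beta> [] = \<beta> ([], [])"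
  by (simp add: coprod_sum_def)

lemma coprod_sum_Cons:
  "coprod_sum \<beta> (x # w) = coprod_sum (\<lambda>(u, v). \<beta> (x # u, v)) w + coprod_sum (\<lambda>(u, v). \<beta> (u, x # v)) w"
  by (simp add: coprod_sum_def comp_def case_prod_beta')

lemma coprod_sum_snoc:
  "coprod_sum \<beta> (w @ [x]) = coprod_sum (\<lambda>(u, v). \<beta> (u @ [x], v)) w + coprod_sum (\<lambda>(u, v). \<beta> (u, v @ [x])) w"
  by (induction w arbitrary: \<beta>) (simp_all add: coprod_sum_Cons case_prod_beta' add_ac)

lemma coprod_sum_add:
  "coprod_sum (\<lambda>uv. \<beta> uv + \<gamma> uv) w = coprod_sum \<beta> w + coprod_sum \<gamma> w"
  by (simp add: coprod_sum_def sum_list_addf)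

lemma splits_eq_prod_list:
  "(\<Prod>x\<leftarrow>w. Poly_Mapping.single ([x], []) 1 + Poly_Mapping.single ([], [x]) 1) =
    (coprod_sum (\<lambda>uv. Poly_Mapping.single uv 1) w :: ('g list \<times> 'g list) \<Rightarrow>\<^sub>0 'k::field)"
proof (induction w)
  case Nil
  have "(1 :: ('g list \<times> 'g list) \<Rightarrow>\<^sub>0 'k) = Poly_Mapping.single ([], []) 1"
    using single_one[where 'a = "'g list \<times> 'g list" and 'b = 'k] by (simp add: zero_prod_def zero_list_def)
  then show ?case by simp
next
  case (Cons x w)
  have "Poly_Mapping.single m 1 * (coprod_sum (\<lambda>uv. Poly_Mapping.single uv 1) w) =
      (coprod_sum (\<lambda>uv. Poly_Mapping.single (m + uv) 1) w :: ('g list \<times> 'g list) \<Rightarrow>\<^sub>0 'k)" for m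
    by (simp add: coprod_sum_def sum_list_const_mult[symmetric] mult_single comp_def)
  then show ?case
    by (simp add: Cons distrib_right coprod_sum_Cons case_prod_beta' plus_prod_def plus_list_def)
qed

lemma (in vector_space) lin_ext_sum_list: "lin_ext scale \<phi> (sum_list fs) = sum_list (map (lin_ext scale \<phi>) fs)"
  by (induction fs) (simp_all add: lin_ext_add)

lemma (in vector_space) lin_ext_free_coproduct:
  "lin_ext scale \<beta> (free_coproduct f) = lin_ext scale (coprod_sum \<beta>) f"
proof -
  have "free_coproduct f = lin_ext (\<lambda>c f. scalar c * f) (coprod_sum (\<lambda>uv. Poly_Mapping.single uv 1)) f"
    by (simp add: free_coproduct_def lin_ext_def splits_eq_prod_list)
  then show ?thesis
    by (simp add: linear_lin_ext[OF linear_lin_extI] coprod_sum_def[abs_def] lin_ext_sum_list comp_def lin_ext_single)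
qed

lemma ring_of_type_algebra_simps [simp]:
  "carrier ring_of_type_algebra = UNIV"
  "monoid.mult ring_of_type_algebra = (*)"
  "add ring_of_type_algebra = (+)"
  "\<one>\<^bsub>ring_of_type_algebra\<^esub> = 1"
  "\<zero>\<^bsub>ring_of_type_algebra\<^esub> = 0"
  by (auto simp: ring_of_type_algebra_def fun_eq_iff)

lemma ring_ring_of_type_algebra: "ring (ring_of_type_algebra :: 'a::ring_1 ring)"
proof -
  have "\<exists>y. x + y = 0" for x :: 'a
    using add.right_inverse by blast
  then show ?thesis
    unfolding ring_of_type_algebra_def using add.right_inverse
    by unfold_locales (auto simp: algebra_simps Units_def)
qed

section \<open>The quotient by the relations\<close>

context lie_algebra
begin

abbreviation alg_ext :: "('b \<Rightarrow> ('g, 'k) free_alg) \<Rightarrow> ('b \<Rightarrow>\<^sub>0 'k) \<Rightarrow> ('g, 'k) free_alg" where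
  "alg_ext \<equiv> lin_ext (\<lambda>c f. scalar c * f)"

lemma ideal_env_ideal: "ideal env_ideal ring_of_type_algebra"
  unfolding env_ideal_def by (rule ring.genideal_ideal[OF ring_ring_of_type_algebra]) simp

interpretation env: ideal env_ideal ring_of_type_algebra
  by (rule ideal_env_ideal)

lemma env_ideal_zero: "0 \<in> env_ideal"
  using additive_subgroup.zero_closed[OF ideal.axioms(1)[OF ideal_env_ideal]] by simp

lemma env_ideal_add: "f \<in> env_ideal \<Longrightarrow> g \<in> env_ideal \<Longrightarrow> f + g \<in> env_ideal"
  using additive_subgroup.a_closed[OF ideal.axioms(1)[OF ideal_env_ideal]] by simp

lemma env_ideal_mult_left: "f \<in> env_ideal \<Longrightarrow> g * f \<in> env_ideal"
  using env.I_l_closed[of f g] by simp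

lemma env_ideal_mult_right: "f \<in> env_ideal \<Longrightarrow> f * g \<in> env_ideal"
  using env.I_r_closed[of f g] by simp

lemma env_ideal_minus: "f \<in> env_ideal \<Longrightarrow> - f \<in> env_ideal"
  using env_ideal_mult_left[of f "- 1"] by simp

lemma env_ideal_diff: "f \<in> env_ideal \<Longrightarrow> g \<in> env_ideal \<Longrightarrow> f - g \<in> env_ideal"
  using env_ideal_add[of f "- g"] env_ideal_minus by simp

lemma env_ideal_sum: "(\<And>a. a \<in> A \<Longrightarrow> h a \<in> env_ideal) \<Longrightarrow> sum h A \<in> env_ideal"
  by (induction A rule: infinite_finite_induct) (auto intro: env_ideal_zero env_ideal_add)

lemma env_ideal_sum_list: "(\<And>a. a \<in> set as \<Longrightarrow> h a \<in> env_ideal) \<Longrightarrow> sum_list (map h as) \<in> env_ideal"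
  by (induction as) (auto intro: env_ideal_zero env_ideal_add)

lemma env_ideal_alg_ext: "(\<And>w. \<phi> w \<in> env_ideal) \<Longrightarrow> alg_ext \<phi> f \<in> env_ideal"
  unfolding lin_ext_def by (intro env_ideal_sum env_ideal_mult_left)

lemma env_relations_subset: "env_relations \<subseteq> env_ideal"
  unfolding env_ideal_def by (rule ring.genideal_self[OF ring_ring_of_type_algebra]) simp

lemma gen_add_rel: "gen (x + y) - gen x - gen y \<in> env_ideal"
  and gen_scale_rel: "gen (scale c x) - scalar c * gen x \<in> env_ideal"
  and gen_bracket_rel: "gen x * gen y - gen y * gen x - gen (bracket x y) \<in> env_ideal"
  by (rule subsetD[OF env_relations_subset], auto simp: env_relations_def)+

text \<open>The elements of the ideal with property \<open>P\<close> form a two-sided ideal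
  containing the relations. Closure under single generators suffices, because every element is a
  linear combination of words.\<close>

lemma env_ideal_induct [consumes 1, case_names zero add scalar gen_left gen_right add_rel scale_rel bracket_rel]:
  assumes f: "f \<in> env_ideal"
    and zero: "P 0" and add: "\<And>f g. P f \<Longrightarrow> P g \<Longrightarrow> P (f + g)" and scalar: "\<And>c f. P f \<Longrightarrow> P (scalar c * f)"
    and left: "\<And>x f. f \<in> env_ideal \<Longrightarrow> P f \<Longrightarrow> P (gen x * f)"
    and right: "\<And>x f. f \<in> env_ideal \<Longrightarrow> P f \<Longrightarrow> P (f * gen x)"
    and rels: "\<And>x y. P (gen (x + y) - gen x - gen y)" "\<And>c x. P (gen (scale c x) - scalar c * gen x)"
      "\<And>x y. P (gen x * gen y - gen y * gen x - gen (bracket x y))"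
  shows "P f"
proof -
  define K where "K = {f \<in> env_ideal. P f}"
  have Kadd: "f + g \<in> K" if "f \<in> K" "g \<in> K" for f g
    using that by (auto simp: K_def intro: add env_ideal_add)
  have Kscalar: "scalar c * f \<in> K" if "f \<in> K" for c f
    using that by (auto simp: K_def intro: scalar env_ideal_mult_left)
  have Kzero: "0 \<in> K" by (simp add: K_def zero env_ideal_zero)
  have Kleft: "Poly_Mapping.single w 1 * f \<in> K" if "f \<in> K" for w f
  proof (induction w)
    case Nil
    then show ?case using that by (simp flip: free_one)
  next
    case (Cons x w)
    then show ?case
      by (auto simp: K_def mult.assoc gen_mult_single[symmetric] intro: left env_ideal_mult_left)
  qed
  have Kright: "f * Poly_Mapping.single w 1 \<in> K" if "f \<in> K" for w f
  proof (induction w rule: rev_induct)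
    case Nil
    then show ?case using that by (simp flip: free_one)
  next
    case (snoc x w)
    then show ?case
      by (auto simp: K_def mult.assoc[symmetric] single_mult_gen[symmetric] intro: right env_ideal_mult_right)
  qed
  have Kmult: "g * f \<in> K \<and> f * g \<in> K" if "f \<in> K" for f g
    by (induction g rule: poly_mapping_linear_induct)
      (use that in \<open>auto simp: Kzero distrib_left distrib_right scalar_mult_left_commute mult.assoc
        intro: Kadd Kscalar Kleft Kright\<close>)
  have "ideal K ring_of_type_algebra"
  proof (rule idealI[OF ring_ring_of_type_algebra])
    show "subgroup K (add_monoid ring_of_type_algebra)"
    proof (rule group.subgroupI)
      show "Group.group (add_monoid (ring_of_type_algebra :: ('g, 'k) free_alg ring))"
        using ring_ring_of_type_algebra[THEN ring.is_abelian_group] by (rule abelian_group.a_group)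
      show "inv\<^bsub>add_monoid ring_of_type_algebra\<^esub> f \<in> K" if "f \<in> K" for f
      proof -
        have "inv\<^bsub>add_monoid ring_of_type_algebra\<^esub> f = - f"
          by (rule group.inv_equality[OF \<open>Group.group (add_monoid ring_of_type_algebra)\<close>]) simp_all
        then show ?thesis using Kmult[OF that, of "- 1"] by simp
      qed
    qed (use Kzero Kadd in auto)
  qed (use Kmult in auto)
  moreover have "env_relations \<subseteq> K"
    using rels gen_add_rel gen_scale_rel gen_bracket_rel by (auto simp: K_def env_relations_def)
  ultimately have "env_ideal \<subseteq> K"
    unfolding env_ideal_def by (rule ring.genideal_minimal[OF ring_ring_of_type_algebra])
  then show ?thesis using f by (auto simp: K_def)
qed

lemma ring_env: "ring env"
  unfolding env_def by (rule env.quotient_is_ring)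

interpretation env_ring: ring env
  by (rule ring_env)

lemma env_class_eq: "env_class f = (\<lambda>i. i + f) ` env_ideal"
  by (auto simp: env_class_def a_r_coset_def')

lemma env_class_eq_iff: "env_class f = env_class g \<longleftrightarrow> f - g \<in> env_ideal"
proof
  assume "env_class f = env_class g"
  moreover have "f \<in> env_class f"
    unfolding env_class_eq using env_ideal_zero by force
  ultimately show "f - g \<in> env_ideal"
    by (auto simp: env_class_eq)
next
  have "env_class f \<subseteq> env_class g" if fg: "f - g \<in> env_ideal" for f g
  proof
    fix h assume "h \<in> env_class f"
    then have "h - f \<in> env_ideal" by (auto simp: env_class_eq)
    then have "h - g \<in> env_ideal" using env_ideal_add[OF _ fg] by force
    then show "h \<in> env_class g" by (force simp: env_class_eq)
  qed
  moreover assume "f - g \<in> env_ideal"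
  moreover from this have "g - f \<in> env_ideal" using env_ideal_minus by fastforce
  ultimately show "env_class f = env_class g" by blast
qed

lemma carrier_env: "carrier env = range env_class"
  by (auto simp: env_def FactRing_def A_RCOSETS_def' env_class_def)

lemma env_class_in_carrier [simp]: "env_class f \<in> carrier env"
  by (simp add: carrier_env)

lemma env_class_add: "env_class f \<oplus>\<^bsub>env\<^esub> env_class g = env_class (f + g)"
  using ring_hom_add[OF env.rcos_ring_hom, of f g] by (simp add: env_def env_class_def)

lemma env_class_mult: "env_class f \<otimes>\<^bsub>env\<^esub> env_class g = env_class (f * g)"
  using ring_hom_mult[OF env.rcos_ring_hom, of f g] by (simp add: env_def env_class_def)

lemma env_one: "\<one>\<^bsub>env\<^esub> = env_class 1"
  using ring_hom_one[OF env.rcos_ring_hom] by (simp add: env_def env_class_def)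

lemma env_zero: "\<zero>\<^bsub>env\<^esub> = env_class 0"
  using env_class_add[of 0 0] env_ring.add.r_cancel_one'[of "env_class 0" "env_class 0"] by simp

lemma env_class_diff: "env_class f \<ominus>\<^bsub>env\<^esub> env_class g = env_class (f - g)"
proof -
  have "\<ominus>\<^bsub>env\<^esub> env_class g = env_class (- g)"
    by (rule env_ring.minus_equality) (simp_all add: env_class_add env_zero)
  then show ?thesis by (simp add: a_minus_def env_class_add)
qed

lemma env_class_smult: "env_smult c (env_class f) = env_class (scalar c * f)"
  by (simp add: env_smult_def env_class_mult)

lemma env_class_finsum:
  "finite S \<Longrightarrow> (\<Oplus>\<^bsub>env\<^esub>s\<in>S. env_class (h s)) = env_class (sum h S)"
  by (induction S rule: finite_induct) (simp_all add: env_zero env_class_add)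

lemma env_class_rep: "E \<in> carrier env \<Longrightarrow> env_class (env_rep E) = E"
proof -
  assume "E \<in> carrier env"
  then obtain f where f: "E = env_class f" by (auto simp: carrier_env)
  have "f \<in> E" unfolding f env_class_eq using env_ideal_zero by force
  then have "env_rep E \<in> E" unfolding env_rep_def by (rule someI)
  then have "env_rep E - f \<in> env_ideal" by (auto simp: f env_class_eq)
  then show ?thesis by (simp add: f env_class_eq_iff)
qed

lemma env_rep_class: "env_rep (env_class f) - f \<in> env_ideal"
  using env_class_rep[of "env_class f"] by (simp add: env_class_eq_iff)

lemma env_class_sweedler:
  assumes "\<And>u v. B (env_class (Poly_Mapping.single u 1)) (env_class (Poly_Mapping.single v 1)) = env_class (\<beta> (u, v))"
  shows "sweedler B E = env_class (alg_ext (coprod_sum \<beta>) (env_rep E))"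
proof -
  have "sweedler B E = env_class (alg_ext \<beta> (free_coproduct (env_rep E)))"
    by (simp add: sweedler_def Let_def assms env_class_smult env_class_finsum lin_ext_def)
  then show ?thesis by (simp add: poly_mapping.lin_ext_free_coproduct)
qed

text \<open>The universal property in terms of words: the hypotheses say that the extension of
  \<open>\<phi>\<close> kills \<open>u r v\<close> for every relation \<open>r\<close> and all words
  \<open>u\<close>, \<open>v\<close>. In the induction \<open>\<phi>\<close> varies, since a factor
  \<open>gen x\<close> is absorbed into it.\<close>

lemma lin_ext_env_ideal:
  fixes s :: "'k \<Rightarrow> 'v::ab_group_add \<Rightarrow> 'v"
  assumes "vector_space s" "f \<in> env_ideal"
    and "\<And>u x y v. \<phi> (u @ (x + y) # v) = \<phi> (u @ x # v) + \<phi> (u @ y # v)"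
    and "\<And>u c x v. \<phi> (u @ scale c x # v) = s c (\<phi> (u @ x # v))"
    and "\<And>u x y v. \<phi> (u @ x # y # v) = \<phi> (u @ y # x # v) + \<phi> (u @ bracket x y # v)"
  shows "lin_ext s \<phi> f = 0"
proof -
  interpret V: vector_space s by fact
  show ?thesis
    using assms(2-)
  proof (induction f arbitrary: \<phi> rule: env_ideal_induct)
    case (gen_left x f)
    show ?case
      unfolding V.lin_ext_gen_mult
    proof (rule gen_left.IH)
      show "\<phi> (x # u @ (a + b) # v) = \<phi> (x # u @ a # v) + \<phi> (x # u @ b # v)" for u a b v
        using gen_left.prems(1)[of "x # u" a b v] by simp
      show "\<phi> (x # u @ scale c a # v) = s c (\<phi> (x # u @ a # v))" for u c a v
        using gen_left.prems(2)[of "x # u" c a v] by simp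
      show "\<phi> (x # u @ a # b # v) = \<phi> (x # u @ b # a # v) + \<phi> (x # u @ bracket a b # v)" for u a b v
        using gen_left.prems(3)[of "x # u" a b v] by simp
    qed
  next
    case (gen_right x f)
    show ?case
      unfolding V.lin_ext_mult_gen
    proof (rule gen_right.IH)
      show "\<phi> ((u @ (a + b) # v) @ [x]) = \<phi> ((u @ a # v) @ [x]) + \<phi> ((u @ b # v) @ [x])" for u a b v
        using gen_right.prems(1)[of u a b "v @ [x]"] by simp
      show "\<phi> ((u @ scale c a # v) @ [x]) = s c (\<phi> ((u @ a # v) @ [x]))" for u c a v
        using gen_right.prems(2)[of u c a "v @ [x]"] by simp
      show "\<phi> ((u @ a # b # v) @ [x]) = \<phi> ((u @ b # a # v) @ [x]) + \<phi> ((u @ bracket a b # v) @ [x])" for u a b v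
        using gen_right.prems(3)[of u a b "v @ [x]"] by simp
    qed
  next
    case (add_rel x y)
    then show ?case using add_rel(1)[of "[]" x y "[]"] by (simp add: V.lin_ext_diff V.lin_ext_gen)
  next
    case (scale_rel c x)
    then show ?case using scale_rel(2)[of "[]" c x "[]"] by (simp add: V.lin_ext_diff V.lin_ext_gen V.lin_ext_scalar)
  next
    case (bracket_rel x y)
    then show ?case using bracket_rel(3)[of "[]" x y "[]"]
      by (simp add: V.lin_ext_diff V.lin_ext_gen V.lin_ext_gen_mult)
  next
    case zero
    show ?case by simp
  next
    case (add f g)
    have "lin_ext s \<phi> f = 0" "lin_ext s \<phi> g = 0"
      by (rule add.IH; fact)+
    then show ?case by (simp add: V.lin_ext_add)
  next
    case (scalar c f)
    have "lin_ext s \<phi> f = 0" by (rule scalar.IH; fact)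
    then show ?case by (simp add: V.lin_ext_scalar)
  qed
qed

text \<open>The condition that a bilinear map given on words descends to the quotient in each
  argument; it makes Sweedler sums independent of the representative.\<close>

definition respects_env :: "('g list \<times> 'g list \<Rightarrow> ('g, 'k) free_alg) \<Rightarrow> bool" where
  "respects_env \<beta> \<longleftrightarrow> (\<forall>f\<in>env_ideal. (\<forall>v. alg_ext (\<lambda>u. \<beta> (u, v)) f \<in> env_ideal) \<and>
     (\<forall>u. alg_ext (\<lambda>v. \<beta> (u, v)) f \<in> env_ideal))"

lemma respects_env_shift:
  assumes "respects_env \<beta>"
  shows "respects_env (\<lambda>(u, v). \<beta> (x # u, v))" "respects_env (\<lambda>(u, v). \<beta> (u, x # v))"
    "respects_env (\<lambda>(u, v). \<beta> (u @ [x], v))" "respects_env (\<lambda>(u, v). \<beta> (u, v @ [x]))"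
proof -
  have left: "alg_ext (\<lambda>u. \<phi> (x # u)) f = alg_ext \<phi> (gen x * f)"
    and right: "alg_ext (\<lambda>u. \<phi> (u @ [x])) f = alg_ext \<phi> (f * gen x)" for \<phi> f
    by (simp_all add: poly_mapping.lin_ext_gen_mult poly_mapping.lin_ext_mult_gen)
  show "respects_env (\<lambda>(u, v). \<beta> (x # u, v))"
    using assms left[of "\<lambda>u. \<beta> (u, _)"] by (auto simp: respects_env_def intro: env_ideal_mult_left)
  show "respects_env (\<lambda>(u, v). \<beta> (u, x # v))"
    using assms left[of "\<lambda>v. \<beta> (_, v)"] by (auto simp: respects_env_def intro: env_ideal_mult_left)
  show "respects_env (\<lambda>(u, v). \<beta> (u @ [x], v))"
    using assms right[of "\<lambda>u. \<beta> (u, _)"] by (auto simp: respects_env_def intro: env_ideal_mult_right)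
  show "respects_env (\<lambda>(u, v). \<beta> (u, v @ [x]))"
    using assms right[of "\<lambda>v. \<beta> (_, v)"] by (auto simp: respects_env_def intro: env_ideal_mult_right)
qed

text \<open>The ideal of relations is a coideal.\<close>

lemma coprod_sum_env_ideal:
  "f \<in> env_ideal \<Longrightarrow> respects_env \<beta> \<Longrightarrow> alg_ext (coprod_sum \<beta>) f \<in> env_ideal"
proof (induction f arbitrary: \<beta> rule: env_ideal_induct)
  case (gen_left x f)
  then show ?case
    by (simp add: poly_mapping.lin_ext_gen_mult coprod_sum_Cons poly_mapping.lin_ext_fun_add respects_env_shift env_ideal_add)
next
  case (gen_right x f)
  then show ?case
    by (simp add: poly_mapping.lin_ext_mult_gen coprod_sum_snoc poly_mapping.lin_ext_fun_add respects_env_shift env_ideal_add)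
next
  case (add_rel x y)
  let ?r = "gen (x + y) - gen x - gen y :: ('g, 'k) free_alg"
  have "alg_ext (coprod_sum \<beta>) ?r = alg_ext (\<lambda>u. \<beta> (u, [])) ?r + alg_ext (\<lambda>v. \<beta> ([], v)) ?r"
    by (simp add: poly_mapping.lin_ext_diff poly_mapping.lin_ext_gen coprod_sum_Cons)
  then show ?case
    using add_rel gen_add_rel by (auto simp: respects_env_def intro: env_ideal_add)
next
  case (scale_rel c x)
  let ?r = "gen (scale c x) - scalar c * gen x :: ('g, 'k) free_alg"
  have "alg_ext (coprod_sum \<beta>) ?r = alg_ext (\<lambda>u. \<beta> (u, [])) ?r + alg_ext (\<lambda>v. \<beta> ([], v)) ?r"
    by (simp add: poly_mapping.lin_ext_diff poly_mapping.lin_ext_gen poly_mapping.lin_ext_scalar coprod_sum_Cons distrib_left)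
  then show ?case
    using scale_rel gen_scale_rel by (auto simp: respects_env_def intro: env_ideal_add)
next
  case (bracket_rel x y)
  let ?r = "gen x * gen y - gen y * gen x - gen (bracket x y) :: ('g, 'k) free_alg"
  have "alg_ext (coprod_sum \<beta>) ?r = alg_ext (\<lambda>u. \<beta> (u, [])) ?r + alg_ext (\<lambda>v. \<beta> ([], v)) ?r"
    by (simp add: poly_mapping.lin_ext_diff poly_mapping.lin_ext_gen poly_mapping.lin_ext_gen_mult coprod_sum_Cons)
  then show ?case
    using bracket_rel gen_bracket_rel by (auto simp: respects_env_def intro: env_ideal_add)
qed (simp_all add: poly_mapping.lin_ext_add poly_mapping.lin_ext_scalar env_ideal_zero env_ideal_add env_ideal_mult_left)

text \<open>The faithful representation of \<open>g\<close> extends multiplicatively to words and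
  kills the relations, so it separates generators in the quotient.\<close>

lemma env_incl_inj: "env_incl x = env_incl y \<Longrightarrow> x = y"
proof -
  assume "env_incl x = env_incl y"
  then have mem: "gen x - gen y \<in> env_ideal" by (simp add: env_incl_def env_class_eq_iff)
  obtain \<kappa> :: "'k \<Rightarrow> ('g multiset \<Rightarrow>\<^sub>0 'k) endo" and \<rho> where rep: "lie_rep scale bracket \<kappa> \<rho>" and inj: "inj \<rho>"
    using ex_faithful_rep by blast
  interpret lie_rep scale bracket \<kappa> \<rho> by (rule rep)
  have vs: "vector_space (\<lambda>c r. \<kappa> c * r)"
    by unfold_locales (simp_all add: \<kappa>_add \<kappa>_mult \<kappa>_one algebra_simps)
  interpret V: vector_space "\<lambda>c r. \<kappa> c * r" by (rule vs)
  have central: "(\<Prod>x\<leftarrow>u. \<rho> x) * (\<kappa> c * r) = \<kappa> c * ((\<Prod>x\<leftarrow>u. \<rho> x) * r)" for u c r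
  proof (induction u)
    case (Cons x u)
    then show ?case by (simp add: mult.assoc) (simp add: mult.assoc[symmetric] \<kappa>_central)
  qed simp
  have "lin_ext (\<lambda>c r. \<kappa> c * r) (\<lambda>w. \<Prod>x\<leftarrow>w. \<rho> x) (gen x - gen y) = 0"
    by (rule lin_ext_env_ideal[OF vs mem])
      (simp_all add: \<rho>_add \<rho>_scale \<rho>_bracket comm_def algebra_simps central)
  then have "\<rho> x = \<rho> y"
    by (simp add: V.lin_ext_diff V.lin_ext_gen)
  then show ?thesis using inj by (simp add: inj_eq)
qed

end

section \<open>The post-Lie product on the enveloping algebra\<close>

context post_lie_algebra
begin

text \<open>The terms of the derivation of the free algebra extending \<open>tri x\<close>, one for
  each position; a list, because terms may coincide.\<close>

fun word_derivs :: "'g \<Rightarrow> 'g list \<Rightarrow> 'g list list" where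
  "word_derivs x [] = []"
| "word_derivs x (y # w) = (tri x y # w) # map ((#) y) (word_derivs x w)"

lemma length_word_derivs: "u \<in> set (word_derivs x w) \<Longrightarrow> length u = length w"
  by (induction w arbitrary: u) auto

lemma word_derivs_append:
  "word_derivs x (u @ v) = map (\<lambda>a. a @ v) (word_derivs x u) @ map ((@) u) (word_derivs x v)"
  by (induction u) simp_all

definition env_deriv :: "'g \<Rightarrow> ('g, 'k) free_alg \<Rightarrow> ('g, 'k) free_alg" where
  "env_deriv x = alg_ext (\<lambda>w. \<Sum>u\<leftarrow>word_derivs x w. Poly_Mapping.single u 1)"

lemma env_deriv_add: "env_deriv x (f + g) = env_deriv x f + env_deriv x g"
  and env_deriv_diff: "env_deriv x (f - g) = env_deriv x f - env_deriv x g"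
  and env_deriv_scalar: "env_deriv x (scalar c * f) = scalar c * env_deriv x f"
  and env_deriv_zero [simp]: "env_deriv x 0 = 0"
  by (simp_all add: env_deriv_def poly_mapping.lin_ext_add poly_mapping.lin_ext_diff poly_mapping.lin_ext_scalar)

lemma linear_env_deriv: "Vector_Spaces.linear (\<lambda>c f. scalar c * f) (\<lambda>c f. scalar c * f) (env_deriv x)"
  by (simp add: Vector_Spaces.linear_iff vector_space_poly_mapping env_deriv_add env_deriv_scalar)

lemma env_deriv_single: "env_deriv x (Poly_Mapping.single w 1) = (\<Sum>u\<leftarrow>word_derivs x w. Poly_Mapping.single u 1)"
  by (simp add: env_deriv_def poly_mapping.lin_ext_single poly_mapping.scale_one)

lemma env_deriv_gen: "env_deriv x (gen y) = gen (tri x y)"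
  by (simp add: gen_def env_deriv_single)

lemma env_deriv_one: "env_deriv x 1 = 0"
  by (simp add: free_one env_deriv_single)

lemma env_deriv_mult: "env_deriv x (f * g) = env_deriv x f * g + f * env_deriv x g"
proof (induction f rule: poly_mapping_linear_induct)
  case (single u)
  show ?case
  proof (induction g rule: poly_mapping_linear_induct)
    case (single v)
    show ?case
      by (simp add: free_mult_single env_deriv_single word_derivs_append comp_def
          sum_list_const_mult[symmetric] sum_list_mult_const[symmetric])
  qed (simp_all add: distrib_left env_deriv_add scalar_mult_left_commute env_deriv_scalar)
qed (simp_all add: distrib_right env_deriv_add env_deriv_scalar mult.assoc distrib_left)

lemma env_deriv_sum_list: "env_deriv x (sum_list fs) = (\<Sum>f\<leftarrow>fs. env_deriv x f)"
  by (induction fs) (simp_all add: env_deriv_add)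

text \<open>\<open>tri x\<close> is linear and a derivation of the bracket, so relations go to
  combinations of relations.\<close>

lemma env_deriv_env_ideal: "f \<in> env_ideal \<Longrightarrow> env_deriv x f \<in> env_ideal"
proof (induction f rule: env_ideal_induct)
  case (add_rel y z)
  then show ?case by (simp add: env_deriv_diff env_deriv_gen tri_add_right gen_add_rel)
next
  case (scale_rel c y)
  then show ?case by (simp add: env_deriv_diff env_deriv_scalar env_deriv_gen tri_scale_right gen_scale_rel)
next
  case (bracket_rel y z)
  let ?y = "tri x y" and ?z = "tri x z"
  have "env_deriv x (gen y * gen z - gen z * gen y - gen (bracket y z)) =
      (gen ?y * gen z - gen z * gen ?y - gen (bracket ?y z)) + (gen y * gen ?z - gen ?z * gen y - gen (bracket y ?z))
      - (gen (bracket ?y z + bracket y ?z) - gen (bracket ?y z) - gen (bracket y ?z))"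
    by (simp only: env_deriv_diff env_deriv_mult env_deriv_gen tri_bracket) (simp add: algebra_simps)
  also have "\<dots> \<in> env_ideal"
    by (intro env_ideal_diff env_ideal_add gen_bracket_rel gen_add_rel)
  finally show ?case .
next
  case (scalar c f)
  then show ?case by (simp only: env_deriv_scalar env_ideal_mult_left)
qed (simp_all add: env_ideal_zero env_deriv_add env_ideal_add env_ideal_mult_left env_ideal_mult_right env_deriv_mult)

text \<open>The action of a word on the free algebra, as forced by the recursion for \<open>xE\<close>.\<close>

function word_tri :: "'g list \<Rightarrow> ('g, 'k) free_alg \<Rightarrow> ('g, 'k) free_alg" where
  "word_tri [] g = g"
| "word_tri (x # w) g = env_deriv x (word_tri w g) - (\<Sum>u\<leftarrow>word_derivs x w. word_tri u g)"
  by pat_completeness auto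
termination by (relation "measure (\<lambda>(w, g). length w)") (auto simp: length_word_derivs)

lemma word_tri_add: "word_tri w (f + g) = word_tri w f + word_tri w g"
proof (induction w f arbitrary: rule: word_tri.induct)
  case (2 x w f)
  have "(\<Sum>u\<leftarrow>word_derivs x w. word_tri u (f + g)) = (\<Sum>u\<leftarrow>word_derivs x w. word_tri u f + word_tri u g)"
    using "2.IH"(2) by (intro arg_cong[where f = sum_list] map_cong) auto
  then show ?case using "2.IH"(1) by (simp add: env_deriv_add sum_list_addf)
qed simp

lemma word_tri_scalar: "word_tri w (scalar c * f) = scalar c * word_tri w f"
proof (induction w f rule: word_tri.induct)
  case (2 x w f)
  have "(\<Sum>u\<leftarrow>word_derivs x w. word_tri u (scalar c * f)) = (\<Sum>u\<leftarrow>word_derivs x w. scalar c * word_tri u f)"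
    using "2.IH"(2) by (intro arg_cong[where f = sum_list] map_cong) auto
  then show ?case using "2.IH"(1) by (simp add: env_deriv_scalar sum_list_const_mult right_diff_distrib)
qed simp

lemma word_tri_zero: "word_tri w 0 = 0"
  using word_tri_add[of w 0 0] by simp

lemma word_tri_env_ideal: "f \<in> env_ideal \<Longrightarrow> word_tri w f \<in> env_ideal"
proof (induction w f rule: word_tri.induct)
  case (2 x w f)
  then show ?case
    by (auto intro!: env_ideal_diff env_deriv_env_ideal env_ideal_sum_list)
qed simp

lemma word_tri_one: "word_tri w 1 = (if w = [] then 1 else 0)"
proof (induction w "1 :: ('g, 'k) free_alg" rule: word_tri.induct)
  case (2 x w)
  have "(\<Sum>u\<leftarrow>word_derivs x w. word_tri u 1) = (\<Sum>u\<leftarrow>word_derivs x w. if u = [] then 1 else 0)"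
    using "2.hyps"(2) by (intro arg_cong[where f = sum_list] map_cong) auto
  also have "\<dots> = (\<Sum>u\<leftarrow>word_derivs x w. 0)"
    by (intro arg_cong[where f = sum_list] map_cong) (cases w; auto)+
  finally show ?case using "2.hyps"(1) by (simp add: env_deriv_one)
qed simp

text \<open>The derivation extending \<open>tri x\<close> is also a coderivation, since it sends
  generators to generators.\<close>

lemma coprod_sum_word_derivs:
  "(\<Sum>u\<leftarrow>word_derivs x w. coprod_sum \<beta> u) =
     coprod_sum (\<lambda>(u, v). (\<Sum>u'\<leftarrow>word_derivs x u. \<beta> (u', v)) + (\<Sum>v'\<leftarrow>word_derivs x v. \<beta> (u, v'))) w"
proof (induction w arbitrary: \<beta>)
  case (Cons y w)
  show ?case
    by (simp add: coprod_sum_Cons comp_def sum_list_addf Cons case_prod_beta' coprod_sum_add add_ac)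
qed simp

lemma env_deriv_coprod_sum: "env_deriv x (coprod_sum \<beta> w) = coprod_sum (\<lambda>uv. env_deriv x (\<beta> uv)) w"
  by (simp add: coprod_sum_def env_deriv_sum_list comp_def)

lemma coprod_sum_diff:
  "coprod_sum (\<lambda>uv. \<beta> uv - \<gamma> uv) w = coprod_sum \<beta> w - (coprod_sum \<gamma> w :: ('g, 'k) free_alg)"
  by (simp add: coprod_sum_def sum_list_subtractf)

text \<open>The product rule holds already in the free algebra, since the recursion is built from a
  map that is both a derivation and a coderivation.\<close>

lemma word_tri_mult: "word_tri w (f * g) = coprod_sum (\<lambda>(u, v). word_tri u f * word_tri v g) w"
proof (induction w "f * g" rule: word_tri.induct)
  case (2 x w)
  let ?\<beta> = "\<lambda>(u, v). word_tri u f * word_tri v g"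
  have "(\<Sum>u\<leftarrow>word_derivs x w. word_tri u (f * g)) = (\<Sum>u\<leftarrow>word_derivs x w. coprod_sum ?\<beta> u)"
    using "2.hyps"(2) by (intro arg_cong[where f = sum_list] map_cong) auto
  then have "word_tri (x # w) (f * g) = env_deriv x (coprod_sum ?\<beta> w) - (\<Sum>u\<leftarrow>word_derivs x w. coprod_sum ?\<beta> u)"
    using "2.hyps"(1) by simp
  then show ?case
    unfolding coprod_sum_word_derivs env_deriv_coprod_sum coprod_sum_Cons
    by (simp add: coprod_sum_add[symmetric] coprod_sum_diff[symmetric] case_prod_beta' env_deriv_mult
        sum_list_const_mult sum_list_mult_const algebra_simps)
qed simp

text \<open>
  The same recursion with values in the Lie algebra, where linearity in the letters is an identity and not only
  a congruence modulo the relations.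
\<close>

function word_tri_lie :: "'g list \<Rightarrow> 'g \<Rightarrow> 'g" where
  "word_tri_lie [] y = y"
| "word_tri_lie (x # w) y = tri x (word_tri_lie w y) - (\<Sum>u\<leftarrow>word_derivs x w. word_tri_lie u y)"
  by pat_completeness auto
termination by (relation "measure (\<lambda>(w, y). length w)") (auto simp: length_word_derivs)

text \<open>The hypothesis is confined to words as long as \<open>w\<close>: when this is applied
  inside an induction, additivity is known only for them.\<close>

lemma sum_word_derivs_add:
  fixes \<phi> :: "'g list \<Rightarrow> 'g"
  assumes "\<And>u c d v. Suc (length u + length v) = length w \<Longrightarrow> \<phi> (u @ (c + d) # v) = \<phi> (u @ c # v) + \<phi> (u @ d # v)"
  shows "(\<Sum>s\<leftarrow>word_derivs (a + b) w. \<phi> s) = (\<Sum>s\<leftarrow>word_derivs a w. \<phi> s) + (\<Sum>s\<leftarrow>word_derivs b w. \<phi> s)"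
  using assms
proof (induction w arbitrary: \<phi>)
  case (Cons y w)
  have "(\<Sum>s\<leftarrow>word_derivs (a + b) w. \<phi> (y # s)) = (\<Sum>s\<leftarrow>word_derivs a w. \<phi> (y # s)) + (\<Sum>s\<leftarrow>word_derivs b w. \<phi> (y # s))"
    by (rule Cons.IH) (use Cons.prems[of "y # _"] in simp)
  then show ?case using Cons.prems[of "[]" w] by (simp add: tri_add_left comp_def)
qed simp

lemma sum_word_derivs_scale:
  fixes \<phi> :: "'g list \<Rightarrow> 'g"
  assumes "\<And>u c a v. Suc (length u + length v) = length w \<Longrightarrow> \<phi> (u @ scale c a # v) = scale c (\<phi> (u @ a # v))"
  shows "(\<Sum>s\<leftarrow>word_derivs (scale c a) w. \<phi> s) = scale c (\<Sum>s\<leftarrow>word_derivs a w. \<phi> s)"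
  using assms
proof (induction w arbitrary: \<phi>)
  case (Cons y w)
  have "(\<Sum>s\<leftarrow>word_derivs (scale c a) w. \<phi> (y # s)) = scale c (\<Sum>s\<leftarrow>word_derivs a w. \<phi> (y # s))"
    by (rule Cons.IH) (use Cons.prems[of "y # _"] in simp)
  then show ?case using Cons.prems[of "[]" w] by (simp add: tri_scale_left comp_def scale_right_distrib)
qed simp

lemma word_tri_lie_append:
  "word_tri_lie (z # u @ a # v) y = tri z (word_tri_lie (u @ a # v) y)
     - (\<Sum>s\<leftarrow>word_derivs z u. word_tri_lie (s @ a # v) y) - word_tri_lie (u @ tri z a # v) y
     - (\<Sum>s\<leftarrow>word_derivs z v. word_tri_lie (u @ a # s) y)"
  by (simp add: word_derivs_append comp_def diff_diff_eq)

lemma sum_word_derivs_cong: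
  "(\<And>s. length s = length w \<Longrightarrow> \<phi> s = \<psi> s) \<Longrightarrow> (\<Sum>s\<leftarrow>word_derivs x w. \<phi> s) = (\<Sum>s\<leftarrow>word_derivs x w. \<psi> s)"
  by (intro arg_cong[where f = sum_list] map_cong) (auto simp: length_word_derivs)

text \<open>The induction counts the letters other than the marked one. A marked letter in front
  becomes the index of a derivation; otherwise the recursion leaves shorter words that still contain
  a marked letter.\<close>

lemma word_tri_lie_add:
  "word_tri_lie (u @ (a + b) # v) y = word_tri_lie (u @ a # v) y + word_tri_lie (u @ b # v) y"
proof (induction "length u + length v" arbitrary: u a b v rule: less_induct)
  case less
  show ?case
  proof (cases u)
    case Nil
    have "(\<Sum>s\<leftarrow>word_derivs (a + b) v. word_tri_lie s y) =
        (\<Sum>s\<leftarrow>word_derivs a v. word_tri_lie s y) + (\<Sum>s\<leftarrow>word_derivs b v. word_tri_lie s y)"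
      by (rule sum_word_derivs_add) (use less Nil in auto)
    then show ?thesis using Nil by (simp add: tri_add_left)
  next
    case (Cons z u')
    have "(\<Sum>s\<leftarrow>word_derivs z u'. word_tri_lie (s @ (a + b) # v) y) =
        (\<Sum>s\<leftarrow>word_derivs z u'. word_tri_lie (s @ a # v) y + word_tri_lie (s @ b # v) y)"
      by (rule sum_word_derivs_cong) (use less Cons in auto)
    moreover have "(\<Sum>s\<leftarrow>word_derivs z v. word_tri_lie (u' @ (a + b) # s) y) =
        (\<Sum>s\<leftarrow>word_derivs z v. word_tri_lie (u' @ a # s) y + word_tri_lie (u' @ b # s) y)"
      by (rule sum_word_derivs_cong) (use less Cons in auto)
    moreover have "word_tri_lie (u' @ (c + d) # v) y = word_tri_lie (u' @ c # v) y + word_tri_lie (u' @ d # v) y" for c d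
      by (rule less) (simp add: Cons)
    ultimately show ?thesis
      unfolding Cons append_Cons word_tri_lie_append
      by (simp add: tri_add_right sum_list_addf)
  qed
qed

lemma word_tri_lie_scale:
  "word_tri_lie (u @ scale c a # v) y = scale c (word_tri_lie (u @ a # v) y)"
proof (induction "length u + length v" arbitrary: u c a v rule: less_induct)
  case less
  show ?case
  proof (cases u)
    case Nil
    have "(\<Sum>s\<leftarrow>word_derivs (scale c a) v. word_tri_lie s y) = scale c (\<Sum>s\<leftarrow>word_derivs a v. word_tri_lie s y)"
      by (rule sum_word_derivs_scale) (use less Nil in auto)
    then show ?thesis using Nil by (simp add: tri_scale_left scale_right_diff_distrib)
  next
    case (Cons z u')
    have scale_sum_list: "(\<Sum>s\<leftarrow>ss. scale c (h s)) = scale c (\<Sum>s\<leftarrow>ss. h s)" for ss :: "'g list list" and h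
      by (induction ss) (simp_all add: scale_right_distrib)
    have "(\<Sum>s\<leftarrow>word_derivs z u'. word_tri_lie (s @ scale c a # v) y) =
        (\<Sum>s\<leftarrow>word_derivs z u'. scale c (word_tri_lie (s @ a # v) y))"
      by (rule sum_word_derivs_cong) (use less Cons in auto)
    moreover have "(\<Sum>s\<leftarrow>word_derivs z v. word_tri_lie (u' @ scale c a # s) y) =
        (\<Sum>s\<leftarrow>word_derivs z v. scale c (word_tri_lie (u' @ a # s) y))"
      by (rule sum_word_derivs_cong) (use less Cons in auto)
    moreover have "word_tri_lie (u' @ scale c b # v) y = scale c (word_tri_lie (u' @ b # v) y)" for b
      by (rule less) (simp add: Cons)
    ultimately show ?thesis
      unfolding Cons append_Cons word_tri_lie_append
      by (simp add: tri_scale_right scale_sum_list scale_right_diff_distrib)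
  qed
qed

text \<open>The second post-Lie axiom lifted from letters to words. Terms in which two derivations
  hit different letters occur on both sides; those in which they hit the same letter match by the
  axiom.\<close>

lemma sum_word_derivs_commute:
  fixes \<phi> :: "'g list \<Rightarrow> 'g"
  assumes add: "\<And>u c d v. \<phi> (u @ (c + d) # v) = \<phi> (u @ c # v) + \<phi> (u @ d # v)"
  shows "(\<Sum>s\<leftarrow>word_derivs x v. \<Sum>t\<leftarrow>word_derivs y s. \<phi> t) + (\<Sum>s\<leftarrow>word_derivs (tri x y) v. \<phi> s)
      + (\<Sum>s\<leftarrow>word_derivs (bracket x y) v. \<phi> s) =
    (\<Sum>s\<leftarrow>word_derivs y v. \<Sum>t\<leftarrow>word_derivs x s. \<phi> t) + (\<Sum>s\<leftarrow>word_derivs (tri y x) v. \<phi> s)"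
  using assms
proof (induction v arbitrary: \<phi>)
  case (Cons c v)
  let ?\<psi> = "\<lambda>s. \<phi> (c # s)"
  have IH: "(\<Sum>s\<leftarrow>word_derivs x v. \<Sum>t\<leftarrow>word_derivs y s. ?\<psi> t) + (\<Sum>s\<leftarrow>word_derivs (tri x y) v. ?\<psi> s)
      + (\<Sum>s\<leftarrow>word_derivs (bracket x y) v. ?\<psi> s) =
    (\<Sum>s\<leftarrow>word_derivs y v. \<Sum>t\<leftarrow>word_derivs x s. ?\<psi> t) + (\<Sum>s\<leftarrow>word_derivs (tri y x) v. ?\<psi> s)"
    by (rule Cons.IH) (use Cons.prems[of "c # _"] in simp)
  have two: "(\<Sum>s\<leftarrow>word_derivs x (c # v). \<Sum>t\<leftarrow>word_derivs y s. \<phi> t) =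
      \<phi> (tri y (tri x c) # v) + (\<Sum>t\<leftarrow>word_derivs y v. \<phi> (tri x c # t))
      + (\<Sum>s\<leftarrow>word_derivs x v. \<phi> (tri y c # s)) + (\<Sum>s\<leftarrow>word_derivs x v. \<Sum>t\<leftarrow>word_derivs y s. ?\<psi> t)" for x y
    by (simp add: comp_def sum_list_addf add_ac)
  have head: "\<phi> ((a + b) # v) = \<phi> (a # v) + \<phi> (b # v)" for a b
    using Cons.prems[of "[]"] by simp
  have "tri y (tri x c) + tri (tri x y) c + tri (bracket x y) c = tri x (tri y c) + tri (tri y x) c"
    using bracket_tri[of x y c] by (simp add: assoc_tri_def)
  then have "\<phi> (tri y (tri x c) # v) + \<phi> (tri (tri x y) c # v) + \<phi> (tri (bracket x y) c # v) =
      \<phi> (tri x (tri y c) # v) + \<phi> (tri (tri y x) c # v)"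
    by (simp flip: head)
  with IH show ?case
    unfolding two by (simp add: comp_def algebra_simps)
qed simp

text \<open>If the exchanged letters come first, the second post-Lie axiom is used on the value of
  the remaining word and, through \<open>sum_word_derivs_commute\<close>, on its letters. Otherwise
  the recursion reduces to a shorter prefix, where \<open>tri z\<close> is a derivation of the
  bracket.\<close>

lemma word_tri_lie_bracket:
  "word_tri_lie (u @ a # b # v) y = word_tri_lie (u @ b # a # v) y + word_tri_lie (u @ bracket a b # v) y"
proof (induction "length u" arbitrary: u a b v)
  case 0
  let ?T = "word_tri_lie v y"
  let ?D = "\<lambda>x. \<Sum>s\<leftarrow>word_derivs x v. word_tri_lie s y"
  let ?DD = "\<lambda>x z. \<Sum>s\<leftarrow>word_derivs x v. \<Sum>t\<leftarrow>word_derivs z s. word_tri_lie t y"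
  have tri_sum_list: "tri x (\<Sum>s\<leftarrow>ss. h s) = (\<Sum>s\<leftarrow>ss. tri x (h s))" for x h and ss :: "'g list list"
    by (induction ss) (simp_all add: tri_add_right)
  have two: "word_tri_lie (x # z # v) y = tri x (tri z ?T) - tri x (?D z) - tri (tri x z) ?T + ?D (tri x z)
      - tri z (?D x) + ?DD x z" for x z
    by (simp add: comp_def sum_list_subtractf tri_diff_right tri_sum_list)
  have "?DD a b + ?D (tri a b) + ?D (bracket a b) = ?DD b a + ?D (tri b a)"
    by (rule sum_word_derivs_commute) (rule word_tri_lie_add)
  moreover have "tri (bracket a b) ?T = tri a (tri b ?T) - tri (tri a b) ?T - (tri b (tri a ?T) - tri (tri b a) ?T)"
    by (simp add: bracket_tri assoc_tri_def)
  ultimately have "word_tri_lie (a # b # v) y = word_tri_lie (b # a # v) y + word_tri_lie (bracket a b # v) y"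
    unfolding two word_tri_lie.simps(2)[of "bracket a b"] by (simp add: algebra_simps)
  then show ?case using 0 by simp
next
  case (Suc n)
  then obtain z u' where u: "u = z # u'" and n: "n = length u'" by (cases u) auto
  have IH: "word_tri_lie (s @ a # b # v) y = word_tri_lie (s @ b # a # v) y + word_tri_lie (s @ bracket a b # v) y"
    if "length s = length u'" for s a b v
    by (rule Suc.hyps) (simp add: that n)
  have step: "word_tri_lie (z # u' @ a # b # v) y = tri z (word_tri_lie (u' @ a # b # v) y)
     - (\<Sum>s\<leftarrow>word_derivs z u'. word_tri_lie (s @ a # b # v) y) - word_tri_lie (u' @ tri z a # b # v) y
     - word_tri_lie (u' @ a # tri z b # v) y - (\<Sum>s\<leftarrow>word_derivs z v. word_tri_lie (u' @ a # b # s) y)" for a b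
    by (simp only: word_tri_lie_append word_derivs.simps list.map sum_list.Cons map_map) (simp add: comp_def diff_diff_eq)
  have 1: "(\<Sum>s\<leftarrow>word_derivs z u'. word_tri_lie (s @ a # b # v) y) =
      (\<Sum>s\<leftarrow>word_derivs z u'. word_tri_lie (s @ b # a # v) y + word_tri_lie (s @ bracket a b # v) y)"
    by (rule sum_word_derivs_cong) (rule IH)
  have 2: "(\<Sum>s\<leftarrow>word_derivs z v. word_tri_lie (u' @ a # b # s) y) =
      (\<Sum>s\<leftarrow>word_derivs z v. word_tri_lie (u' @ b # a # s) y + word_tri_lie (u' @ bracket a b # s) y)"
    by (rule sum_word_derivs_cong) (rule IH[OF refl])
  show ?case
    unfolding u append_Cons step 1 2 IH[OF refl, of a b] IH[OF refl, of "tri z a" b] IH[OF refl, of a "tri z b"]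
      word_tri_lie_append[of z u' "bracket a b"] tri_bracket word_tri_lie_add
    by (simp add: sum_list_addf tri_add_right)
qed

text \<open>This is a congruence because \<open>gen\<close> is additive only modulo the
  ideal.\<close>

lemma word_tri_gen: "word_tri w (gen y) - gen (word_tri_lie w y) \<in> env_ideal"
proof (induction w "gen y :: ('g, 'k) free_alg" rule: word_tri.induct)
  case 1
  then show ?case by (simp add: env_ideal_zero)
next
  case (2 x w)
  have gen_zero: "gen 0 \<in> env_ideal"
    using env_ideal_minus[OF gen_add_rel[of 0 0]] by simp
  have gen_diff: "gen (a - b) - (gen a - gen b) \<in> env_ideal" for a b
    using env_ideal_minus[OF gen_add_rel[of "a - b" b]] by (simp add: algebra_simps)
  have gen_sum_list: "(\<Sum>u\<leftarrow>us. gen (h u)) - gen (\<Sum>u\<leftarrow>us. h u) \<in> env_ideal" for h and us :: "'g list list"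
  proof (induction us)
    case Nil
    then show ?case using env_ideal_minus[OF gen_zero] by simp
  next
    case (Cons u us)
    then show ?case
      using env_ideal_diff[OF Cons gen_add_rel[of "h u" "\<Sum>u\<leftarrow>us. h u"]] by (simp add: algebra_simps)
  qed
  let ?T = "word_tri_lie w y" and ?S = "\<Sum>u\<leftarrow>word_derivs x w. word_tri_lie u y"
  have "env_deriv x (word_tri w (gen y) - gen ?T) \<in> env_ideal"
    by (rule env_deriv_env_ideal) (rule 2)
  moreover have "(\<Sum>u\<leftarrow>word_derivs x w. word_tri u (gen y) - gen (word_tri_lie u y)) \<in> env_ideal"
    by (rule env_ideal_sum_list) (rule 2)
  ultimately have "env_deriv x (word_tri w (gen y) - gen ?T)
      - (\<Sum>u\<leftarrow>word_derivs x w. word_tri u (gen y) - gen (word_tri_lie u y))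
      - ((\<Sum>u\<leftarrow>word_derivs x w. gen (word_tri_lie u y)) - gen ?S)
      - (gen (tri x ?T - ?S) - (gen (tri x ?T) - gen ?S)) \<in> env_ideal"
    by (intro env_ideal_diff gen_sum_list gen_diff)
  moreover have "word_tri (x # w) (gen y) - gen (word_tri_lie (x # w) y) = env_deriv x (word_tri w (gen y) - gen ?T)
      - (\<Sum>u\<leftarrow>word_derivs x w. word_tri u (gen y) - gen (word_tri_lie u y))
      - ((\<Sum>u\<leftarrow>word_derivs x w. gen (word_tri_lie u y)) - gen ?S)
      - (gen (tri x ?T - ?S) - (gen (tri x ?T) - gen ?S))"
    by (simp add: env_deriv_diff env_deriv_gen sum_list_subtractf)
  ultimately show ?case by (simp only:)
qed

section \<open>Descent of the product to the enveloping algebra\<close>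

definition free_tri :: "('g, 'k) free_alg \<Rightarrow> ('g, 'k) free_alg \<Rightarrow> ('g, 'k) free_alg" where
  "free_tri f g = alg_ext (\<lambda>w. word_tri w g) f"

lemma free_tri_add_left: "free_tri (f + f') g = free_tri f g + free_tri f' g"
  and free_tri_diff_left: "free_tri (f - f') g = free_tri f g - free_tri f' g"
  and free_tri_scalar_left: "free_tri (scalar c * f) g = scalar c * free_tri f g"
  by (simp_all add: free_tri_def poly_mapping.lin_ext_add poly_mapping.lin_ext_diff poly_mapping.lin_ext_scalar)

lemma free_tri_add_right: "free_tri f (g + g') = free_tri f g + free_tri f g'"
  and free_tri_scalar_right: "free_tri f (scalar c * g) = scalar c * free_tri f g"
  by (simp_all add: free_tri_def word_tri_add word_tri_scalar poly_mapping.lin_ext_fun_add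
      poly_mapping.lin_ext_fun_scale)

lemma free_tri_single: "free_tri (Poly_Mapping.single w 1) g = word_tri w g"
  by (simp add: free_tri_def poly_mapping.lin_ext_single poly_mapping.scale_one)

lemma free_tri_gen: "free_tri (gen x) g = env_deriv x g"
  by (simp add: gen_def free_tri_single)

lemma free_tri_one_left: "free_tri 1 g = g"
  by (simp add: free_one free_tri_single)

lemma free_tri_one_right: "free_tri f 1 = scalar (Poly_Mapping.lookup f [])"
proof (induction f rule: poly_mapping_linear_induct)
  case zero
  show ?case by (simp only: free_tri_def poly_mapping.lin_ext_zero) (simp add: scalar_def)
next
  case (add f g)
  then show ?case by (simp add: free_tri_add_left lookup_add) (simp add: scalar_def single_add)
next
  case (scalar c f)
  then show ?case by (simp add: free_tri_scalar_left lookup_scalar_times) (simp add: scalar_def mult_single)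
next
  case (single w)
  show ?case by (auto simp: free_tri_single word_tri_one lookup_single scalar_def)
qed

lemma free_tri_gen_mult: "free_tri (gen x * f) g = env_deriv x (free_tri f g) - free_tri (env_deriv x f) g"
proof -
  have "free_tri (env_deriv x f) g = alg_ext (\<lambda>w. \<Sum>u\<leftarrow>word_derivs x w. word_tri u g) f"
    unfolding free_tri_def env_deriv_def
    by (simp add: linear_lin_ext[OF poly_mapping.linear_lin_extI] poly_mapping.lin_ext_sum_list comp_def
        poly_mapping.lin_ext_single poly_mapping.scale_one)
  then show ?thesis
    by (simp add: free_tri_def poly_mapping.lin_ext_gen_mult poly_mapping.lin_ext_fun_diff
        linear_lin_ext[OF linear_env_deriv])
qed

lemma free_tri_mult: "free_tri f (g * h) = alg_ext (coprod_sum (\<lambda>(u, v). word_tri u g * word_tri v h)) f"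
  by (simp add: free_tri_def word_tri_mult)

lemma free_tri_env_ideal_right: "g \<in> env_ideal \<Longrightarrow> free_tri f g \<in> env_ideal"
  unfolding free_tri_def by (rule env_ideal_alg_ext) (rule word_tri_env_ideal)

text \<open>On a generator the value is congruent to the extension of \<open>word_tri_lie\<close>,
  which vanishes on the ideal by its linearity and exchange rules. The product rule and the coideal
  property carry the claim from generators to words.\<close>

lemma free_tri_env_ideal_left: "f \<in> env_ideal \<Longrightarrow> free_tri f g \<in> env_ideal"
proof -
  have gen: "free_tri f (gen y) \<in> env_ideal" if f: "f \<in> env_ideal" for f y
  proof -
    have "free_tri f (gen y) - alg_ext (\<lambda>w. gen (word_tri_lie w y)) f \<in> env_ideal"
      unfolding free_tri_def poly_mapping.lin_ext_fun_diff[symmetric]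
      by (rule env_ideal_alg_ext) (rule word_tri_gen)
    moreover have "alg_ext (\<lambda>w. gen (word_tri_lie w y)) f - gen (lin_ext scale (\<lambda>w. word_tri_lie w y) f) \<in> env_ideal" for f
    proof (induction f rule: poly_mapping_linear_induct)
      case zero
      then show ?case using gen_add_rel[of 0 0] by simp
    next
      case (add f g)
      then show ?case
        using env_ideal_diff[OF env_ideal_add[OF add] gen_add_rel[of "lin_ext scale (\<lambda>w. word_tri_lie w y) f"
            "lin_ext scale (\<lambda>w. word_tri_lie w y) g"]]
        by (simp add: poly_mapping.lin_ext_add lin_ext_add algebra_simps)
    next
      case (scalar c f)
      then show ?case
        using env_ideal_diff[OF env_ideal_mult_left[OF scalar, of "scalar c"]
            gen_scale_rel[of c "lin_ext scale (\<lambda>w. word_tri_lie w y) f"]]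
        by (simp add: poly_mapping.lin_ext_scalar lin_ext_scalar right_diff_distrib)
    next
      case (single w)
      then show ?case
        by (simp add: poly_mapping.lin_ext_single lin_ext_single poly_mapping.scale_one env_ideal_zero)
    qed
    moreover have "lin_ext scale (\<lambda>w. word_tri_lie w y) f = 0"
      by (rule lin_ext_env_ideal[OF vector_space_axioms f])
        (simp_all add: word_tri_lie_add word_tri_lie_scale, rule word_tri_lie_bracket)
    moreover have "gen 0 \<in> env_ideal"
      using env_ideal_minus[OF gen_add_rel[of 0 0]] by simp
    ultimately show ?thesis
      by (metis add_diff_cancel diff_add_cancel env_ideal_add)
  qed
  have one: "free_tri f 1 \<in> env_ideal" if "f \<in> env_ideal" for f
  proof -
    have "alg_ext (\<lambda>w. word_tri w 1) f = 0"
      by (rule lin_ext_env_ideal[OF vector_space_poly_mapping that]) (simp_all add: word_tri_one)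
    then show ?thesis by (simp add: free_tri_def env_ideal_zero)
  qed
  have "\<forall>f\<in>env_ideal. free_tri f g \<in> env_ideal"
  proof (induction g rule: poly_mapping_linear_induct)
    case zero
    then show ?case by (simp add: free_tri_def word_tri_zero poly_mapping.lin_ext_fun_zero env_ideal_zero)
  next
    case (single w)
    show ?case
    proof (induction w)
      case Nil
      then show ?case using one by (simp flip: free_one)
    next
      case (Cons y w)
      have "respects_env (\<lambda>(u, v). word_tri u (gen y) * word_tri v (Poly_Mapping.single w 1))"
        unfolding respects_env_def
      proof (intro ballI conjI allI)
        fix f :: "('g, 'k) free_alg" assume f: "f \<in> env_ideal"
        have mult_right: "alg_ext (\<lambda>u. \<phi> u * g) f = alg_ext \<phi> f * g"
          and mult_left: "alg_ext (\<lambda>u. g * \<phi> u) f = g * alg_ext \<phi> f" for \<phi> :: "'g list \<Rightarrow> ('g, 'k) free_alg" and g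
          by (simp_all add: lin_ext_def sum_distrib_right sum_distrib_left mult.assoc scalar_mult_left_commute)
        show "alg_ext (\<lambda>u. case (u, v) of (u, v) \<Rightarrow> word_tri u (gen y) * word_tri v (Poly_Mapping.single w 1)) f \<in> env_ideal" for v
          using gen[OF f, of y] by (simp add: mult_right free_tri_def env_ideal_mult_right)
        show "alg_ext (\<lambda>v. case (u, v) of (u, v) \<Rightarrow> word_tri u (gen y) * word_tri v (Poly_Mapping.single w 1)) f \<in> env_ideal" for u
          using Cons f by (simp add: mult_left free_tri_def env_ideal_mult_left)
      qed
      then show ?case
        by (simp add: gen_mult_single[symmetric] free_tri_mult coprod_sum_env_ideal)
    qed
  qed (simp_all add: free_tri_add_right env_ideal_add free_tri_scalar_right env_ideal_mult_left)
  then show "f \<in> env_ideal \<Longrightarrow> free_tri f g \<in> env_ideal" by blast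
qed

lemma env_class_free_tri_cong:
  assumes "env_class f = env_class f'" "env_class g = env_class g'"
  shows "env_class (free_tri f g) = env_class (free_tri f' g')"
proof -
  have "free_tri (f - f') g \<in> env_ideal" "free_tri f' (g - g') \<in> env_ideal"
    using assms by (simp_all add: env_class_eq_iff free_tri_env_ideal_left free_tri_env_ideal_right)
  moreover have "free_tri f' (g - g') = free_tri f' g - free_tri f' g'"
    using free_tri_add_right[of f' "g - g'" g'] by (simp add: eq_diff_eq)
  ultimately show ?thesis
    using env_ideal_add[of "free_tri (f - f') g" "free_tri f' (g - g')"]
    by (simp add: env_class_eq_iff free_tri_diff_left)
qed

definition quot_tri :: "('g, 'k) free_alg set \<Rightarrow> ('g, 'k) free_alg set \<Rightarrow> ('g, 'k) free_alg set" where
  "quot_tri E F = env_class (free_tri (env_rep E) (env_rep F))"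

lemma quot_tri_class: "quot_tri (env_class f) (env_class g) = env_class (free_tri f g)"
  unfolding quot_tri_def by (rule env_class_free_tri_cong) (simp_all add: env_class_rep)

lemma is_env_tri_quot_tri: "is_env_tri quot_tri"
  unfolding is_env_tri_def
proof (intro conjI ballI allI)
  fix E F G :: "('g, 'k) free_alg set"
  assume "E \<in> carrier env" "F \<in> carrier env" "G \<in> carrier env"
  then obtain f g where F: "F = env_class f" and G: "G = env_class g" by (auto simp: carrier_env)
  define e where "e = env_rep E"
  have E: "E = env_class e" using \<open>E \<in> carrier env\<close> by (simp add: e_def env_class_rep)
  have "sweedler (\<lambda>A B. quot_tri A F \<otimes>\<^bsub>env\<^esub> quot_tri B G) E =
      env_class (alg_ext (coprod_sum (\<lambda>(u, v). word_tri u f * word_tri v g)) (env_rep E))"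
    by (rule env_class_sweedler) (simp add: F G quot_tri_class env_class_mult free_tri_single)
  also have "\<dots> = quot_tri E (F \<otimes>\<^bsub>env\<^esub> G)"
    by (simp add: E F G env_class_mult quot_tri_class free_tri_mult e_def[symmetric])
       (simp add: free_tri_mult[symmetric] env_class_free_tri_cong[OF env_class_rep] flip: E e_def)
  finally show "quot_tri E (F \<otimes>\<^bsub>env\<^esub> G) = sweedler (\<lambda>A B. quot_tri A F \<otimes>\<^bsub>env\<^esub> quot_tri B G) E" ..
next
  fix E :: "('g, 'k) free_alg set"
  assume "E \<in> carrier env"
  then have "quot_tri E \<one>\<^bsub>env\<^esub> = quot_tri (env_class (env_rep E)) (env_class 1)"
    by (simp add: env_class_rep env_one)
  then show "quot_tri E \<one>\<^bsub>env\<^esub> = env_smult (env_counit E) \<one>\<^bsub>env\<^esub>"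
    by (simp add: quot_tri_class free_tri_one_right env_one env_class_smult env_counit_def free_counit_def)
qed (auto simp: carrier_env quot_tri_class env_class_add env_class_smult env_class_mult env_class_diff env_one env_incl_def
    free_tri_add_left free_tri_add_right free_tri_scalar_left free_tri_scalar_right free_tri_gen env_deriv_gen
    free_tri_one_left free_tri_gen_mult)

text \<open>\<open>quot_tri\<close> is the witness that gives the choice a meaning; all further
  computations rest on the defining equations alone.\<close>

lemma is_env_tri_env_tri: "is_env_tri env_tri"
  unfolding env_tri_def by (rule someI[of is_env_tri, OF is_env_tri_quot_tri])

end

section \<open>Star powers acting on the Lie algebra\<close>

context post_lie_algebra
begin

lemma env_tri_closed: "E \<in> carrier env \<Longrightarrow> F \<in> carrier env \<Longrightarrow> env_tri E F \<in> carrier env"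
  using is_env_tri_env_tri[unfolded is_env_tri_def, THEN conjunct1] by blast

lemma env_tri_add_left:
  "E \<in> carrier env \<Longrightarrow> E' \<in> carrier env \<Longrightarrow> F \<in> carrier env \<Longrightarrow>
    env_tri (E \<oplus>\<^bsub>env\<^esub> E') F = env_tri E F \<oplus>\<^bsub>env\<^esub> env_tri E' F"
  using is_env_tri_env_tri[unfolded is_env_tri_def, THEN conjunct2, THEN conjunct1] by blast

lemma env_tri_smult_left:
  "E \<in> carrier env \<Longrightarrow> F \<in> carrier env \<Longrightarrow> env_tri (env_smult c E) F = env_smult c (env_tri E F)"
  using is_env_tri_env_tri[unfolded is_env_tri_def, THEN conjunct2, THEN conjunct2, THEN conjunct2, THEN conjunct1] by blast

lemma env_tri_incl: "env_tri (env_incl x) (env_incl y) = env_incl (tri x y)"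
  using is_env_tri_env_tri[unfolded is_env_tri_def, THEN conjunct2, THEN conjunct2, THEN conjunct2, THEN conjunct2, THEN conjunct1] by blast

lemma env_tri_one: "F \<in> carrier env \<Longrightarrow> env_tri \<one>\<^bsub>env\<^esub> F = F"
  using is_env_tri_env_tri[unfolded is_env_tri_def, THEN conjunct2, THEN conjunct2, THEN conjunct2, THEN conjunct2, THEN conjunct2, THEN conjunct1] by blast

lemma env_tri_incl_mult:
  "E \<in> carrier env \<Longrightarrow> F \<in> carrier env \<Longrightarrow> env_tri (env_incl x \<otimes>\<^bsub>env\<^esub> E) F
      = env_tri (env_incl x) (env_tri E F) \<ominus>\<^bsub>env\<^esub> env_tri (env_tri (env_incl x) E) F"
  using is_env_tri_env_tri[unfolded is_env_tri_def, THEN conjunct2, THEN conjunct2, THEN conjunct2, THEN conjunct2, THEN conjunct2, THEN conjunct2, THEN conjunct2, THEN conjunct1] by blast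

lemma env_incl_in_carrier [simp]: "env_incl x \<in> carrier env"
  by (simp add: env_incl_def)

lemma env_tri_class_linear:
  assumes F: "F \<in> carrier env"
    and \<xi>: "\<And>v. env_class (\<xi> v) = env_tri (env_class (Poly_Mapping.single v 1)) F"
  shows "env_class (alg_ext \<xi> f) = env_tri (env_class f) F"
proof (induction f rule: poly_mapping_linear_induct)
  case zero
  obtain t where t: "env_tri (env_class 0) F = env_class t"
    using env_tri_closed[of "env_class 0" F] F by (auto simp: carrier_env)
  \<comment> \<open>The class of zero is written as zero times itself, so that homogeneity yields
    its image.\<close>
  have "env_tri (env_smult 0 (env_class 0)) F = env_smult 0 (env_class t)"
    using F by (simp add: env_tri_smult_left t)
  then have "env_class (scalar 0 * t) = env_tri (env_class (scalar 0 * 0)) F"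
    by (simp only: env_class_smult)
  then show ?case
    by (simp only: poly_mapping.lin_ext_zero) (simp add: scalar_def)
next
  case (add f g)
  then show ?case
    using F by (simp add: poly_mapping.lin_ext_add env_tri_add_left flip: env_class_add)
next
  case (scalar c f)
  then show ?case
    using F by (simp add: poly_mapping.lin_ext_scalar env_tri_smult_left flip: env_class_smult)
next
  case (single w)
  show ?case by (simp only: poly_mapping.lin_ext_single poly_mapping.scale_one \<xi>)
qed

text \<open>The star product is evaluated on a chosen representative of \<open>env_incl x\<close>,
  which agrees with \<open>gen x\<close> only modulo the ideal. The coideal property removes the
  difference, and \<open>gen x\<close> is primitive.\<close>

lemma star_incl:
  assumes F: "F \<in> carrier env"
  shows "star (env_incl x) F = env_incl x \<otimes>\<^bsub>env\<^esub> F \<oplus>\<^bsub>env\<^esub> env_tri (env_incl x) F"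
proof -
  \<comment> \<open>\<open>\<xi>\<close> lifts the action of words on \<open>F\<close> to the free
    algebra. It respects the relations because \<open>env_tri\<close> is defined and linear on
    classes.\<close>
  define \<xi> where "\<xi> v = env_rep (env_tri (env_class (Poly_Mapping.single v 1)) F)" for v :: "'g list"
  define \<beta> where "\<beta> = (\<lambda>(u, v). Poly_Mapping.single u 1 * \<xi> v)"
  have \<xi>: "env_class (\<xi> v) = env_tri (env_class (Poly_Mapping.single v 1)) F" for v
    unfolding \<xi>_def using F by (simp add: env_class_rep env_tri_closed)
  have \<xi>_ext: "env_class (alg_ext \<xi> f) = env_tri (env_class f) F" for f
    by (rule env_tri_class_linear[OF F \<xi>])
  have "respects_env \<beta>"
    unfolding respects_env_def
  proof (intro ballI conjI allI)
    fix f :: "('g, 'k) free_alg" assume f: "f \<in> env_ideal"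
    have "alg_ext (\<lambda>u. \<beta> (u, v)) f = f * \<xi> v" for v
    proof -
      have "alg_ext (\<lambda>u. \<beta> (u, v)) f = alg_ext (\<lambda>u. Poly_Mapping.single u 1) f * \<xi> v"
        by (simp add: \<beta>_def lin_ext_def sum_distrib_right mult.assoc)
      then show ?thesis by (simp only: lin_ext_id)
    qed
    then show "alg_ext (\<lambda>u. \<beta> (u, v)) f \<in> env_ideal" for v
      using f by (simp add: env_ideal_mult_right)
    have "env_class f = env_class 0" using f by (simp add: env_class_eq_iff)
    then have "env_class (alg_ext \<xi> f) = env_class (alg_ext \<xi> 0)" by (simp only: \<xi>_ext)
    then have "alg_ext \<xi> f \<in> env_ideal" by (simp add: env_class_eq_iff)
    moreover have "alg_ext (\<lambda>v. \<beta> (u, v)) f = Poly_Mapping.single u 1 * alg_ext \<xi> f" for u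
      by (simp add: \<beta>_def lin_ext_def sum_distrib_left scalar_mult_left_commute)
    ultimately show "alg_ext (\<lambda>v. \<beta> (u, v)) f \<in> env_ideal" for u
      by (simp add: env_ideal_mult_left)
  qed
  then have "alg_ext (coprod_sum \<beta>) (env_rep (env_incl x) - gen x) \<in> env_ideal"
    by (intro coprod_sum_env_ideal) (simp_all add: env_incl_def env_rep_class)
  then have "env_class (alg_ext (coprod_sum \<beta>) (env_rep (env_incl x))) = env_class (\<beta> ([x], []) + \<beta> ([], [x]))"
    by (simp add: env_class_eq_iff poly_mapping.lin_ext_diff poly_mapping.lin_ext_gen coprod_sum_Cons)
  moreover have "star (env_incl x) F = env_class (alg_ext (coprod_sum \<beta>) (env_rep (env_incl x)))"
    unfolding star_def by (rule env_class_sweedler) (simp add: \<beta>_def env_class_mult flip: \<xi>)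
  moreover have "env_class (Poly_Mapping.single [] 1) = \<one>\<^bsub>env\<^esub>"
    by (simp add: env_one flip: free_one)
  ultimately show ?thesis
    using F by (simp add: \<beta>_def \<xi> env_tri_one env_incl_def gen_def flip: env_class_add env_class_mult)
      (simp add: env_one env_class_mult flip: \<xi>)
qed

lemma star_incl_closed: "F \<in> carrier env \<Longrightarrow> star (env_incl x) F \<in> carrier env"
  by (simp add: star_incl ring.ring_simprules[OF ring_env] env_tri_closed)

text \<open>The correction term in the equation for \<open>x F\<close> acting on \<open>G\<close> is
  cancelled by the second summand of the star product. Hence star powers act as powers of left
  multiplication.\<close>

lemma env_tri_star_incl:
  assumes F: "F \<in> carrier env" and G: "G \<in> carrier env"
  shows "env_tri (star (env_incl x) F) G = env_tri (env_incl x) (env_tri F G)"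
proof -
  have "env_tri (env_incl x) (env_tri F G) \<in> carrier env" "env_tri (env_tri (env_incl x) F) G \<in> carrier env"
    using F G by (simp_all add: env_tri_closed)
  then obtain a b where "env_tri (env_incl x) (env_tri F G) = env_class a" "env_tri (env_tri (env_incl x) F) G = env_class b"
    unfolding carrier_env by blast
  then show ?thesis
    using F G by (simp add: star_incl env_tri_add_left env_tri_incl_mult env_tri_closed env_class_diff env_class_add
        ring.ring_simprules(5)[OF ring_env])
qed

lemma star_pow_closed: "star_pow (env_incl x) n \<in> carrier env"
  by (induction n) (simp_all add: star_pow_def env_one star_incl_closed)

lemma env_tri_star_pow: "env_tri (star_pow (env_incl x) n) (env_incl y) = env_incl ((tri x ^^ n) y)"
proof (induction n)
  case 0
  show ?case by (simp add: star_pow_def env_tri_one)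
next
  case (Suc n)
  have "star_pow (env_incl x) (Suc n) = star (env_incl x) (star_pow (env_incl x) n)"
    by (simp add: star_pow_def)
  then show ?case by (simp add: env_tri_star_incl star_pow_closed Suc env_tri_incl)
qed

lemma env_incl_diff: "env_incl a \<ominus>\<^bsub>env\<^esub> env_incl b = env_incl (a - b)"
  using gen_add_rel[of "a - b" b]
  by (simp add: env_incl_def env_class_diff env_class_eq_iff algebra_simps)

lemma env_tri_diff_left:
  assumes "E \<in> carrier env" "E' \<in> carrier env" "F \<in> carrier env"
  shows "env_tri (E \<ominus>\<^bsub>env\<^esub> E') F = env_tri E F \<ominus>\<^bsub>env\<^esub> env_tri E' F"
proof -
  obtain e e' where e: "E = env_class e" "E' = env_class e'" using assms by (auto simp: carrier_env)
  obtain a b c where abc: "env_tri E F = env_class a" "env_tri E' F = env_class b" "env_tri (E \<ominus>\<^bsub>env\<^esub> E') F = env_class c"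
    using assms env_tri_closed[of E F] env_tri_closed[of E' F] env_tri_closed[of "E \<ominus>\<^bsub>env\<^esub> E'" F]
    by (auto simp: carrier_env e env_class_diff)
  have "(E \<ominus>\<^bsub>env\<^esub> E') \<oplus>\<^bsub>env\<^esub> E' = E"
    by (simp add: e env_class_diff env_class_add)
  then have "env_class a = env_class c \<oplus>\<^bsub>env\<^esub> env_class b"
    using env_tri_add_left[of "E \<ominus>\<^bsub>env\<^esub> E'" E' F] assms by (simp add: abc[symmetric] e env_class_diff)
  then have "- (a - (c + b)) \<in> env_ideal"
    by (intro env_ideal_minus) (simp add: env_class_add env_class_eq_iff)
  then show ?thesis
    by (simp add: abc env_class_diff env_class_eq_iff algebra_simps)
qed

text \<open>The element of the enveloping algebra acts on \<open>env_incl y\<close> with value in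
  the image of \<open>g\<close>, and \<open>env_incl_inj\<close> makes its preimage unique.\<close>

lemma defect_eq: "defect p pmap x y = (tri x ^^ p) y - tri (tri_pmap scale bracket tri p pmap x) y"
proof -
  have "env_tri (star_pow (env_incl x) p \<ominus>\<^bsub>env\<^esub> env_incl (tri_pmap scale bracket tri p pmap x)) (env_incl y)
      = env_incl ((tri x ^^ p) y - tri (tri_pmap scale bracket tri p pmap x) y)"
    by (simp add: env_tri_diff_left star_pow_closed env_tri_star_pow env_tri_incl env_incl_diff)
  then show ?thesis
    unfolding defect_def by (auto intro: env_incl_inj)
qed

end

theorem theorem2p2p3:
  fixes scale :: "'k::field \<Rightarrow> 'g::ab_group_add \<Rightarrow> 'g"
    and bracket tri :: "'g \<Rightarrow> 'g \<Rightarrow> 'g"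
    and pmap :: "'g \<Rightarrow> 'g"
    and p :: nat
  assumes "CHAR('k) = p" and "p > 0"
    and "post_lie_algebra scale bracket tri"
    and "restricted_lie_algebra scale bracket p pmap"
    and "\<forall>y. restricted_derivation scale bracket p pmap (\<lambda>x. tri y x)"
  shows "let q = tri_pmap scale bracket tri p pmap;
             D = post_lie_algebra.defect scale bracket tri p pmap;
             sbr = sub_adjacent bracket tri
         in (\<forall>x y. derivation scale tri (D x) \<and>
                   (\<forall>z. D x (D y z) - D y (D x z) = 0)) \<and>
            (\<forall>x y. q (x + y) = q x + q y +
               (\<Sum>ws \<in> jacobson_words p.
                  scale (1 / of_nat (card {k. k < p \<and> ws ! k = Sym_x}))
                    (nested_bracket sbr (map (letter_val x y) ws))))"
proof -
  interpret post_lie_algebra scale bracket tri by fact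
  interpret restricted_lie_algebra scale bracket p pmap by fact
  have "prime p"
    using prime_CHAR_semidom[where 'a = 'k] assms(1,2) by simp
  interpret restricted_post_lie scale bracket tri p pmap
    by unfold_locales (use assms(1,5) \<open>prime p\<close> in \<open>auto simp: restricted_derivation_def\<close>)
  interpret S: lie_algebra scale "sub_adjacent bracket tri" by (rule lie_algebra_sbr)
  have "defect p pmap x = tri_defect x" for x
    by (simp add: fun_eq_iff defect_eq tri_defect_def)
  moreover have "derivation scale tri (tri_defect x)" for x
    by (simp add: derivation_def linear_tri_defect tri_defect_tri)
  ultimately show ?thesis
    using tri_defect_commute tri_pmap_add S.jac_sum_eq_words[OF CHAR_eq p_ge_2]
    by (simp add: Let_def)
qed

end
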